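(* Let $n\ge 1$, let $S=\mathbb{C}[x_0,\dots,x_n]$, and let $f\in S$ be a homogeneous polynomial of degree $d$ such that the projective hypersurface $V(f): f=0$ in $\mathbb{P}^n$ has only isolated singularities. Assume that the saturated Jacobian ideal $\widehat{J}_f$ is a complete intersection ideal. Let $f_s\in S$ be any homogeneous polynomial of degree $d$ such that the hypersurface $V(f_s): f_s=0$ in $\mathbb{P}^n$ is smooth. Then the difference $HP(M(f_s))(t)-HP(N(f))(t)$ is a log-concave and unimodal polynomial.
   Context: $S=\mathbb{C}[x_0,\dots,x_n]$ carries the standard grading. For a homogeneous polynomial $g\in S$, the Jacobian ideal $J_g\subset S$ is the ideal generated by the partial derivatives of $g$ with respect to $x_0,\dots,x_n$, and the Milnor (Jacobian) algebra is $M(g)=S/J_g$. With $\mathbf{m}=(x_0,\dots,x_n)$, $\widehat{J}_f$ denotes the saturation of $J_f$ with respect to $\mathbf{m}$, i.e. $\widehat{J}_f=\{h\in S: \mathbf{m}^r h\subset J_f \text{ for some } r\ge 0\}$, and $N(f)=H^0_{\mathbf{m}}(M(f))=\widehat{J}_f/J_f$, a graded $S$-module. For a graded $S$-module $M$ of finite type, $HP(M)(t)=\sum_{k\ge 0}\dim_{\mathbb{C}} M_k\, t^k$. When $V(f)$ has only isolated singularities, $HP(N(f))(t)$ is a polynomial; for $V(f_s)$ smooth of degree $d$ one has $HP(M(f_s))(t)=(1+t+\dots+t^{d-2})^{n+1}$. Saying that $\widehat{J}_f$ is a complete intersection ideal means that it is generated by $n$ homogeneous polynomials forming a regular sequence,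 of degrees $(d_1,\dots,d_n)$ (the multidegree). A sequence $a_0,\dots,a_m$ of real numbers is log-concave if $a_k^2\ge a_{k-1}a_{k+1}$ for $k=1,\dots,m-1$. It is unimodal if there is an integer $i$ between $0$ and $m$ with $a_0\le a_1\le\dots\le a_{i-1}\le a_i\ge a_{i+1}\ge\dots\ge a_m$. A polynomial $\sum_{j=0}^m a_jt^j\in\mathbb{R}[t]$ is log-concave (resp. unimodal) if its sequence of coefficients is log-concave (resp. unimodal). *)

theory Defs
  imports
    "HOL-Analysis.Analysis"
    "HOL-Library.Poly_Mapping"
    "HOL-Computational_Algebra.Polynomial_FPS"
begin

section \<open>The polynomial ring and its grading\<close>

text \<open>
  The index type of the variables is a finite type with \<open>n + 1\<close> elements, so that the
  whole type below is the ring \<open>S\<close> of complex polynomials in \<open>n + 1\<close> variables.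
  Exponent vectors are finitely supported functions, polynomials are finitely supported
  functions on exponent vectors.
\<close>

type_synonym 'v cpoly = "('v \<Rightarrow>\<^sub>0 nat) \<Rightarrow>\<^sub>0 complex"

definition var :: "'v \<Rightarrow> 'v cpoly" where
  "var i = Poly_Mapping.single (Poly_Mapping.single i 1) 1"

definition cscale :: "complex \<Rightarrow> 'v cpoly \<Rightarrow> 'v cpoly" where
  "cscale c p = Poly_Mapping.single 0 c * p"

definition mon_degree :: "('v::finite \<Rightarrow>\<^sub>0 nat) \<Rightarrow> nat" where
  "mon_degree m = (\<Sum>i\<in>UNIV. Poly_Mapping.lookup m i)"

text \<open>As usual, the zero polynomial is homogeneous of every degree.\<close>

definition homogeneous :: "nat \<Rightarrow> 'v::finite cpoly \<Rightarrow> bool" where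
  "homogeneous d p \<longleftrightarrow> (\<forall>m\<in>Poly_Mapping.keys p. mon_degree m = d)"

definition eval_poly :: "'v::finite cpoly \<Rightarrow> complex ^ 'v \<Rightarrow> complex" where
  "eval_poly p x =
    (\<Sum>m\<in>Poly_Mapping.keys p. Poly_Mapping.lookup p m * (\<Prod>i\<in>UNIV. (x $ i) ^ Poly_Mapping.lookup m i))"

text \<open>
  Subtraction of exponent vectors is truncated; this is harmless, since a monomial not
  containing the variable gets the coefficient 0.
\<close>

definition pdiff :: "'v \<Rightarrow> 'v cpoly \<Rightarrow> 'v cpoly" where
  "pdiff i p = (\<Sum>m\<in>Poly_Mapping.keys p.
     Poly_Mapping.single (m - Poly_Mapping.single i 1)
       (of_nat (Poly_Mapping.lookup m i) * Poly_Mapping.lookup p m))"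

lemma vector_space_cscale: "vector_space cscale"
  by unfold_locales
    (simp_all add: cscale_def distrib_left distrib_right single_add mult_single
      flip: mult.assoc)

lemma module_times: "module ((*) :: 'a::comm_ring_1 \<Rightarrow> 'a \<Rightarrow> 'a)"
  by unfold_locales (simp_all add: algebra_simps)


section \<open>Ideals\<close>

definition ideal_gen :: "'a::comm_ring_1 set \<Rightarrow> 'a set" where
  "ideal_gen = module.span (*)"

definition ideal_prod :: "'a::comm_ring_1 set \<Rightarrow> 'a set \<Rightarrow> 'a set" where
  "ideal_prod I J = ideal_gen {a * b | a b. a \<in> I \<and> b \<in> J}"

fun ideal_power :: "'a::comm_ring_1 set \<Rightarrow> nat \<Rightarrow> 'a set" where
  "ideal_power I 0 = UNIV"
| "ideal_power I (Suc r) = ideal_prod I (ideal_power I r)"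

definition irrelevant_ideal :: "'v cpoly set" where
  "irrelevant_ideal = ideal_gen (range var)"

definition saturation :: "'v cpoly set \<Rightarrow> 'v cpoly set" where
  "saturation I = {h. \<exists>r. \<forall>a\<in>ideal_power irrelevant_ideal r. a * h \<in> I}"

definition jacobian_ideal :: "'v cpoly \<Rightarrow> 'v cpoly set" where
  "jacobian_ideal g = ideal_gen (range (\<lambda>i. pdiff i g))"

text \<open>
  Each entry is a non-zero-divisor modulo the preceding ones, and the quotient by all of
  them is nonzero.
\<close>

definition regular_sequence :: "'a::comm_ring_1 list \<Rightarrow> bool" where
  "regular_sequence gs \<longleftrightarrow>
     (\<forall>i<length gs. \<forall>h. gs ! i * h \<in> ideal_gen (set (take i gs)) \<longrightarrow>
        h \<in> ideal_gen (set (take i gs))) \<and>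
     ideal_gen (set gs) \<noteq> UNIV"

definition complete_intersection_ideal :: "nat \<Rightarrow> 'v::finite cpoly set \<Rightarrow> bool" where
  "complete_intersection_ideal n I \<longleftrightarrow>
     (\<exists>gs ds. length gs = n \<and> length ds = n \<and> (\<forall>i<n. homogeneous (ds ! i) (gs ! i)) \<and>
        regular_sequence gs \<and> I = ideal_gen (set gs))"


section \<open>Hilbert-Poincare series\<close>

text \<open>
  For complex subspaces \<open>W \<subseteq> V\<close>, the classes of the elements of \<open>B\<close> form a basis of
  \<open>V / W\<close> (and are pairwise distinct).
\<close>

definition quotient_basis :: "'v cpoly set \<Rightarrow> 'v cpoly set \<Rightarrow> 'v cpoly set \<Rightarrow> bool" where
  "quotient_basis V W B \<longleftrightarrow>
     B \<subseteq> V \<and>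
     (\<forall>T u. finite T \<and> T \<subseteq> B \<and> (\<Sum>b\<in>T. cscale (u b) b) \<in> W \<longrightarrow> (\<forall>b\<in>T. u b = 0)) \<and>
     (\<forall>v\<in>V. \<exists>T u. finite T \<and> T \<subseteq> B \<and> v - (\<Sum>b\<in>T. cscale (u b) b) \<in> W)"

definition quotient_dim :: "'v cpoly set \<Rightarrow> 'v cpoly set \<Rightarrow> nat" where
  "quotient_dim V W = card (SOME B. quotient_basis V W B)"

text \<open>
  The series of the graded module \<open>I / J\<close>, for homogeneous ideals \<open>J \<subseteq> I\<close>; its component of
  degree \<open>k\<close> is the quotient of the components of degree \<open>k\<close> of \<open>I\<close> and \<open>J\<close>.
\<close>

definition HP :: "'v::finite cpoly set \<Rightarrow> 'v cpoly set \<Rightarrow> real fps" where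
  "HP I J = Abs_fps (\<lambda>k. real (quotient_dim (I \<inter> Collect (homogeneous k)) (J \<inter> Collect (homogeneous k))))"

definition HP_M :: "'v::finite cpoly \<Rightarrow> real fps" where
  "HP_M g = HP UNIV (jacobian_ideal g)"

definition HP_N :: "'v::finite cpoly \<Rightarrow> real fps" where
  "HP_N g = HP (saturation (jacobian_ideal g)) (jacobian_ideal g)"


section \<open>Projective hypersurfaces and their singularities\<close>

text \<open>
  A point of projective space is the set of all its homogeneous coordinate vectors. A set of
  points is open (in the classical topology, the quotient topology) iff its preimage in
  affine space without the origin is open; this preimage is the union of the set.
\<close>

definition proj_point :: "complex ^ 'v \<Rightarrow> (complex ^ 'v) set" where
  "proj_point x = {c *s x | c. c \<noteq> 0}"

definition proj_space :: "(complex ^ 'v) set set" where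
  "proj_space = proj_point ` (UNIV - {0})"

definition proj_topology :: "(complex ^ 'v::finite) set topology" where
  "proj_topology = topology (\<lambda>U. U \<subseteq> proj_space \<and> open (\<Union>U))"

lemma proj_point_eq:
  assumes "z \<in> proj_point x" shows "proj_point x = proj_point z"
proof -
  from assms obtain c where c: "c \<noteq> 0" "z = c *s x" by (auto simp: proj_point_def)
  have "a *s x = (a / c) *s z" for a using c by simp
  moreover have "a *s z = (a * c) *s x" for a using c by simp
  ultimately show ?thesis using c(1)
    unfolding proj_point_def by (safe; metis divide_eq_0_iff mult_eq_0_iff)
qed

lemma openin_proj_topology:
  fixes U :: "(complex ^ 'v::finite) set set"
  shows "openin proj_topology U \<longleftrightarrow> U \<subseteq> proj_space \<and> open (\<Union>U)"
proof -
  have "istopology (\<lambda>U. U \<subseteq> (proj_space :: (complex ^ 'v) set set) \<and> open (\<Union>U))"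
    unfolding istopology_def
  proof (intro conjI allI impI)
    fix A B :: "(complex ^ 'v) set set"
    assume A: "A \<subseteq> proj_space \<and> open (\<Union>A)" and B: "B \<subseteq> proj_space \<and> open (\<Union>B)"
    then show "A \<inter> B \<subseteq> proj_space" by auto
    have "P = Q" if "z \<in> P" "z \<in> Q" "P \<in> A" "Q \<in> B" for z P Q
    proof -
      from that A B obtain x y where "P = proj_point x" "Q = proj_point y"
        unfolding proj_space_def by blast
      then show ?thesis using that proj_point_eq by metis
    qed
    then have "\<Union>(A \<inter> B) = \<Union>A \<inter> \<Union>B" by blast
    then show "open (\<Union>(A \<inter> B))" using A B by auto
  next
    fix K :: "(complex ^ 'v) set set set"
    assume K: "\<forall>U\<in>K. U \<subseteq> proj_space \<and> open (\<Union>U)"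
    then show "\<Union>K \<subseteq> proj_space" by auto
    have "\<Union>(\<Union>K) = (\<Union>U\<in>K. \<Union>U)" by auto
    then show "open (\<Union>(\<Union>K))" using K by auto
  qed
  then show ?thesis by (simp add: proj_topology_def topology_inverse')
qed

definition singular_locus :: "'v::finite cpoly \<Rightarrow> (complex ^ 'v) set set" where
  "singular_locus g =
     proj_point ` {x. x \<noteq> 0 \<and> eval_poly g x = 0 \<and> (\<forall>i. eval_poly (pdiff i g) x = 0)}"

definition smooth_hypersurface :: "'v::finite cpoly \<Rightarrow> bool" where
  "smooth_hypersurface g \<longleftrightarrow> singular_locus g = {}"

definition only_isolated_singularities :: "'v::finite cpoly \<Rightarrow> bool" where
  "only_isolated_singularities g \<longleftrightarrow>
     (\<forall>P\<in>singular_locus g. \<exists>U. openin proj_topology U \<and> U \<inter> singular_locus g = {P})"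


section \<open>Log-concavity and unimodality\<close>

definition log_concave_seq :: "nat \<Rightarrow> (nat \<Rightarrow> real) \<Rightarrow> bool" where
  "log_concave_seq m a \<longleftrightarrow> (\<forall>k. 1 \<le> k \<and> k < m \<longrightarrow> (a k)\<^sup>2 \<ge> a (k - 1) * a (k + 1))"

definition unimodal_seq :: "nat \<Rightarrow> (nat \<Rightarrow> real) \<Rightarrow> bool" where
  "unimodal_seq m a \<longleftrightarrow>
     (\<exists>i\<le>m. (\<forall>j<i. a j \<le> a (j + 1)) \<and> (\<forall>j. i \<le> j \<and> j < m \<longrightarrow> a j \<ge> a (j + 1)))"

definition log_concave_poly :: "real poly \<Rightarrow> bool" where
  "log_concave_poly p \<longleftrightarrow> log_concave_seq (Polynomial.degree p) (poly.coeff p)"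

definition unimodal_poly :: "real poly \<Rightarrow> bool" where
  "unimodal_poly p \<longleftrightarrow> unimodal_seq (Polynomial.degree p) (poly.coeff p)"

end

theory Submission
  imports Defs "HOL-Computational_Algebra.Fundamental_Theorem_Algebra"
begin

text \<open>
  Write \<open>e = d - 1\<close>, let \<open>J\<close> be the Jacobian ideal of \<open>f\<close> and \<open>K = (g\<^sub>1, \<dots>, g\<^sub>n)\<close> its
  saturation, with \<open>g\<^sub>i\<close> of degree \<open>d\<^sub>i\<close>. Since \<open>J\<close> has grade \<open>n\<close>, generic linear combinations
  \<open>h\<^sub>1, \<dots>, h\<^sub>n\<close> of the partial derivatives form a regular sequence; let \<open>C\<close> be the ideal they
  generate, so that \<open>J = C + (h)\<close> for one further form \<open>h\<close> of degree \<open>e\<close>. As \<open>C\<close> is saturated,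
  \<open>C : h = C : J = C : K\<close>, whence
  \<open>HP(S/J) = HP(S/C) - t\<^sup>e HP(S/(C : K))\<close>. By Rees's theorem, \<open>(C : K)/C = Hom(S/K, S/C)\<close> agrees
  up to a shift with \<open>Hom(S/K, S/K) = S/K\<close>, the shift being \<open>n e - \<Sum> d\<^sub>i\<close>. For smooth \<open>f\<^sub>s\<close> the
  partial derivatives generate a complete intersection of type \<open>(e, \<dots>, e)\<close>, so
  \<open>HP(M(f\<^sub>s)) = (1 - t\<^sup>e) HP(S/C)\<close>. Together,
  \<open>HP(M(f\<^sub>s)) - HP(N(f)) = (1 - t\<^sup>E) HP(S/K)\<close> with \<open>E = (n + 1) e - \<Sum> d\<^sub>i\<close>, which is the product of
  the polynomials \<open>1 + t + \<dots> + t\<^bsup>m-1\<^esup>\<close> for \<open>m = d\<^sub>1, \<dots>, d\<^sub>n, E\<close>.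

  Genericity arguments rest on the uncountability of the complex numbers instead of prime
  avoidance: \<open>S\<close> has countable dimension.
\<close>

text \<open>The grade of \<open>J\<close> comes from the complete intersection hypothesis on
  \<open>K\<close>. An ideal \<open>C\<close> generated by a regular sequence of at most
  \<open>n\<close> forms of positive degree is saturated, because the \<open>n + 1\<close> variables
  form a longer regular sequence. Hence the annihilators of \<open>J\<close> and of \<open>K\<close>
  modulo \<open>C\<close> agree, and as long as \<open>C\<close> has fewer than \<open>n\<close>
  generators they are trivial, since \<open>K\<close> contains a regular sequence of length
  \<open>n\<close>. A generic combination of the partial derivatives then prolongs the sequence. The
  \<open>n\<close> forms obtained in this way are linearly independent in a space spanned by
  \<open>n + 1\<close> partial derivatives, which is why only one further form \<open>h\<close>
  remains. Colon ideals stand in for homological algebra: \<open>Hom(S/I, S/C)\<close> appears as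
  \<open>(C : I)/C\<close>, and Rees's theorem becomes an exchange argument on Hilbert series. That
  argument moves a new element to the front of a regular sequence, which is legitimate for forms of
  positive degree.\<close>

interpretation idl: module "(*) :: 'a::comm_ring_1 \<Rightarrow> 'a \<Rightarrow> 'a"
  by (rule module_times)

declare idl.scale_scale [simp del] \<comment> \<open>loops together with \<open>mult.assoc\<close>\<close>

interpretation cvs: vector_space "cscale :: complex \<Rightarrow> 'v cpoly \<Rightarrow> 'v cpoly"
  by (rule vector_space_cscale)

section \<open>Ideals, colon ideals and regular sequences\<close>

abbreviation is_ideal :: "'a::comm_ring_1 set \<Rightarrow> bool" where
  "is_ideal \<equiv> idl.subspace"

lemma is_ideal_scale_right: "is_ideal I \<Longrightarrow> x \<in> I \<Longrightarrow> x * (c :: 'a::comm_ring_1) \<in> I"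
  using idl.subspace_scale[of I x c] by (simp add: mult.commute)

lemma is_ideal_ideal_gen [simp, intro]: "is_ideal (ideal_gen A)"
  by (simp add: ideal_gen_def)

lemma ideal_gen_subset: "A \<subseteq> I \<Longrightarrow> is_ideal I \<Longrightarrow> ideal_gen A \<subseteq> I"
  by (simp add: ideal_gen_def idl.span_minimal)

lemma ideal_gen_superset: "A \<subseteq> ideal_gen A"
  by (simp add: ideal_gen_def idl.span_superset)

lemma ideal_gen_base: "a \<in> A \<Longrightarrow> a \<in> ideal_gen A"
  using ideal_gen_superset by blast

lemma ideal_eq_UNIV: "is_ideal I \<Longrightarrow> (1 :: 'a::comm_ring_1) \<in> I \<Longrightarrow> I = UNIV"
  using idl.subspace_scale[of I 1] by auto

definition nzd_mod :: "'a::comm_ring_1 set \<Rightarrow> 'a \<Rightarrow> bool" where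
  "nzd_mod I x \<longleftrightarrow> (\<forall>h. x * h \<in> I \<longrightarrow> h \<in> I)"

text \<open>The ideal \<open>I + xS\<close>. The base \<open>I\<close> stays a parameter, here and
  in \<open>adjs\<close> and \<open>regular_mod\<close>, because inductions over a sequence change
  it at each step.\<close>

definition adjoin :: "'a::comm_ring_1 set \<Rightarrow> 'a \<Rightarrow> 'a set" where
  "adjoin I x = {p + x * q | p q. p \<in> I}"

definition adjs :: "'a::comm_ring_1 set \<Rightarrow> 'a list \<Rightarrow> 'a set" where
  "adjs = foldl adjoin"

text \<open>Properness of the generated ideal is not part of this notion.\<close>

fun regular_mod :: "'a::comm_ring_1 set \<Rightarrow> 'a list \<Rightarrow> bool" where
  "regular_mod I [] \<longleftrightarrow> True"
| "regular_mod I (x # xs) \<longleftrightarrow> nzd_mod I x \<and> regular_mod (adjoin I x) xs"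

text \<open>The colon ideal \<open>I : (ws)\<close>; by \<open>annih_iff_ideal_gen\<close> only the
  ideal generated by \<open>ws\<close> matters. The condition
  \<open>annih ws I \<subseteq> I\<close>, used throughout, says that \<open>(ws)\<close> kills no
  nonzero class modulo \<open>I\<close>.\<close>

definition annih :: "'a::comm_ring_1 list \<Rightarrow> 'a set \<Rightarrow> 'a set" where
  "annih ws I = {u. \<forall>w\<in>set ws. u * w \<in> I}"

lemma adjs_Nil [simp]: "adjs I [] = I"
  and adjs_Cons [simp]: "adjs I (x # xs) = adjs (adjoin I x) xs"
  and adjs_snoc [simp]: "adjs I (xs @ [x]) = adjoin (adjs I xs) x"
  by (simp_all add: adjs_def)

lemma adjoin_mem: "p \<in> I \<Longrightarrow> p + x * q \<in> adjoin I x"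
  by (auto simp: adjoin_def)

lemma adjoin_cases:
  assumes "z \<in> adjoin I x" obtains p q where "p \<in> I" "z = p + x * q"
  using assms by (auto simp: adjoin_def)

lemma is_ideal_adjoin [simp, intro]:
  assumes "is_ideal I" shows "is_ideal (adjoin I x)"
proof (rule idl.subspaceI)
  show "0 \<in> adjoin I x" using adjoin_mem[OF idl.subspace_0[OF assms], of x 0] by simp
next
  fix y z assume "y \<in> adjoin I x" "z \<in> adjoin I x"
  then obtain p q p' q' where "p \<in> I" "p' \<in> I" "y = p + x * q" "z = p' + x * q'"
    by (elim adjoin_cases)
  then show "y + z \<in> adjoin I x"
    using adjoin_mem[of "p + p'" I x "q + q'"] idl.subspace_add[OF assms, of p p']
    by (simp add: algebra_simps)
next
  fix c y assume "y \<in> adjoin I x"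
  then obtain p q where "p \<in> I" "y = p + x * q" by (elim adjoin_cases)
  then show "c * y \<in> adjoin I x"
    using adjoin_mem[of "c * p" I x "c * q"] idl.subspace_scale[OF assms, of p c]
    by (simp add: distrib_left mult.left_commute)
qed

lemma adjoin_superset: "I \<subseteq> adjoin I x"
  using adjoin_mem[of _ I x 0] by auto

lemma adjoin_self: "is_ideal I \<Longrightarrow> x \<in> adjoin I x"
  using adjoin_mem[OF idl.subspace_0, of I x 1] by auto

lemma adjoin_self_mult: "is_ideal I \<Longrightarrow> x * q \<in> adjoin I x"
  using adjoin_mem[OF idl.subspace_0, of I x q] by auto

lemma adjoin_subset: "I \<subseteq> K \<Longrightarrow> x \<in> K \<Longrightarrow> is_ideal K \<Longrightarrow> adjoin I x \<subseteq> K"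
  by (auto simp: adjoin_def intro!: idl.subspace_add is_ideal_scale_right)

lemma adjoin_commute: "adjoin (adjoin I x) y = adjoin (adjoin I y) x"
proof -
  have *: "adjoin (adjoin I x) y \<subseteq> adjoin (adjoin I y) x" for x y
  proof
    fix z assume "z \<in> adjoin (adjoin I x) y"
    then obtain p q r where "p \<in> I" "z = p + x * q + y * r" by (fastforce elim!: adjoin_cases)
    then show "z \<in> adjoin (adjoin I y) x"
      using adjoin_mem[OF adjoin_mem, of p I y r x q] by (simp add: algebra_simps)
  qed
  then show ?thesis by blast
qed

lemma adjs_adjoin: "adjs (adjoin I x) xs = adjoin (adjs I xs) x"
  by (induction xs arbitrary: I) (simp_all add: adjoin_commute)

lemma is_ideal_adjs [simp, intro]: "is_ideal I \<Longrightarrow> is_ideal (adjs I xs)"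
  by (induction xs arbitrary: I) auto

lemma adjs_superset: "I \<subseteq> adjs I xs"
  by (induction xs arbitrary: I) (use adjoin_superset in fastforce)+

lemma adjs_set_superset: "is_ideal I \<Longrightarrow> set xs \<subseteq> adjs I xs"
proof (induction xs arbitrary: I)
  case (Cons x xs)
  then have "x \<in> adjs (adjoin I x) xs" using adjs_superset adjoin_self by blast
  with Cons show ?case by simp
qed simp

lemma adjs_subset: "I \<subseteq> K \<Longrightarrow> set xs \<subseteq> K \<Longrightarrow> is_ideal K \<Longrightarrow> adjs I xs \<subseteq> K"
  by (induction xs arbitrary: I) (auto simp: adjoin_subset)

lemma adjs_zero: "adjs {0} xs = ideal_gen (set xs)"
proof
  show "adjs {0} xs \<subseteq> ideal_gen (set xs)"
    by (intro adjs_subset) (auto simp: idl.subspace_0 ideal_gen_base)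
  show "ideal_gen (set xs) \<subseteq> adjs {0} xs"
    by (intro ideal_gen_subset adjs_set_superset is_ideal_adjs) auto
qed

lemma regular_mod_append:
  "regular_mod I (xs @ ys) \<longleftrightarrow> regular_mod I xs \<and> regular_mod (adjs I xs) ys"
  by (induction xs arbitrary: I) auto

lemma regular_mod_snoc: "regular_mod I (xs @ [x]) \<longleftrightarrow> regular_mod I xs \<and> nzd_mod (adjs I xs) x"
  by (simp add: regular_mod_append)

lemma regular_mod_iff_nth:
  "regular_mod I xs \<longleftrightarrow> (\<forall>i<length xs. nzd_mod (adjs I (take i xs)) (xs ! i))"
proof (induction xs rule: rev_induct)
  case (snoc x xs)
  then show ?case by (auto simp: regular_mod_snoc less_Suc_eq nth_append)
qed simp

lemma regular_sequence_imp_regular_mod: "regular_sequence xs \<Longrightarrow> regular_mod {0} xs"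
  by (simp add: regular_mod_iff_nth regular_sequence_def adjs_zero nzd_mod_def)

lemma is_ideal_annih [simp, intro]: "is_ideal I \<Longrightarrow> is_ideal (annih ws I)"
  unfolding annih_def
  by (rule idl.subspaceI)
    (simp_all add: distrib_right idl.subspace_0 mult.assoc idl.subspace_add idl.subspace_scale)

lemma annih_superset: "is_ideal I \<Longrightarrow> I \<subseteq> annih ws I"
  by (auto simp: annih_def is_ideal_scale_right)

lemma annih_iff_ideal_gen:
  assumes "is_ideal I"
  shows "u \<in> annih ws I \<longleftrightarrow> (\<forall>a\<in>ideal_gen (set ws). u * a \<in> I)"
proof -
  have "is_ideal {a. u * a \<in> I}"
    using assms by (intro idl.subspaceI)
      (simp_all add: distrib_left idl.subspace_0 idl.subspace_add idl.subspace_scale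
        mult.left_commute[of u])
  then show ?thesis
    using ideal_gen_subset[of "set ws" "{a. u * a \<in> I}"] ideal_gen_superset[of "set ws"]
    by (auto simp: annih_def)
qed

lemma annih_gens: "is_ideal I \<Longrightarrow> u \<in> annih ws I \<Longrightarrow> a \<in> ideal_gen (set ws) \<Longrightarrow> u * a \<in> I"
  using annih_iff_ideal_gen by blast

section \<open>The grading\<close>

definition hcomp :: "nat \<Rightarrow> 'v::finite cpoly \<Rightarrow> 'v cpoly" where
  "hcomp k p = (\<Sum>m\<in>{m \<in> Poly_Mapping.keys p. mon_degree m = k}.
     Poly_Mapping.single m (Poly_Mapping.lookup p m))"

lemma lookup_hcomp:
  "Poly_Mapping.lookup (hcomp k p) m = (if mon_degree m = k then Poly_Mapping.lookup p m else 0)"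
proof -
  have "Poly_Mapping.lookup (hcomp k p) m =
      (\<Sum>m'\<in>{m \<in> Poly_Mapping.keys p. mon_degree m = k}. if m' = m then Poly_Mapping.lookup p m else 0)"
    unfolding hcomp_def lookup_sum by (intro sum.cong) (auto simp: lookup_single when_def)
  then show ?thesis by (auto simp: in_keys_iff)
qed

lemma mon_degree_zero [simp]: "mon_degree 0 = 0"
  and mon_degree_add: "mon_degree (a + b) = mon_degree a + mon_degree b"
  by (simp_all add: mon_degree_def lookup_add sum.distrib)

lemma mon_degree_single [simp]: "mon_degree (Poly_Mapping.single i k) = k"
  by (simp add: mon_degree_def lookup_single when_def)

lemma hcomp_add: "hcomp k (p + q) = hcomp k p + hcomp k q"
  by (rule poly_mapping_eqI) (simp add: lookup_hcomp lookup_add)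

lemma hcomp_zero [simp]: "hcomp k 0 = 0"
  by (rule poly_mapping_eqI) (simp add: lookup_hcomp)

lemma hcomp_sum: "hcomp k (\<Sum>x\<in>A. f x) = (\<Sum>x\<in>A. hcomp k (f x))"
  by (induction A rule: infinite_finite_induct) (auto simp: hcomp_add)

lemma homogeneous_hcomp [simp]: "homogeneous k (hcomp k p)"
  by (auto simp: homogeneous_def in_keys_iff lookup_hcomp split: if_splits)

lemma hcomp_homogeneous: "homogeneous j p \<Longrightarrow> hcomp k p = (if k = j then p else 0)"
  by (rule poly_mapping_eqI) (auto simp: homogeneous_def in_keys_iff lookup_hcomp)

lemma homogeneous_iff_hcomp: "homogeneous k p \<longleftrightarrow> hcomp k p = p"
  using homogeneous_hcomp hcomp_homogeneous by metis

lemma homogeneous_zero [simp]: "homogeneous k 0"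
  by (simp add: homogeneous_def)

lemma homogeneous_one [simp]: "homogeneous 0 1"
  by (simp add: homogeneous_def)

lemma homogeneous_add: "homogeneous k p \<Longrightarrow> homogeneous k q \<Longrightarrow> homogeneous k (p + q)"
  by (simp add: homogeneous_iff_hcomp hcomp_add)

lemma homogeneous_sum: "(\<And>x. x \<in> A \<Longrightarrow> homogeneous k (f x)) \<Longrightarrow> homogeneous k (\<Sum>x\<in>A. f x)"
  by (simp add: homogeneous_iff_hcomp hcomp_sum)

lemma homogeneous_mult: "homogeneous j p \<Longrightarrow> homogeneous k q \<Longrightarrow> homogeneous (j + k) (p * q)"
  using keys_mult[of p q] by (fastforce simp: homogeneous_def mon_degree_add)

lemma homogeneous_power: "homogeneous j p \<Longrightarrow> homogeneous (j * N) (p ^ N)"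
  by (induction N) (auto simp: homogeneous_mult)

lemma homogeneous_single [simp]: "homogeneous k (Poly_Mapping.single m c) \<longleftrightarrow> c = 0 \<or> mon_degree m = k"
  by (simp add: homogeneous_def)

lemma homogeneous_var [simp]: "homogeneous (Suc 0) (var i)"
  by (simp add: var_def)

lemma homogeneous_unique: "homogeneous j p \<Longrightarrow> homogeneous k p \<Longrightarrow> p \<noteq> 0 \<Longrightarrow> j = k"
  by (metis hcomp_homogeneous)

lemma hcomp_decomp: obtains N where "p = (\<Sum>k<N. hcomp k p)"
proof
  define N where "N = Suc (Max (insert 0 (mon_degree ` Poly_Mapping.keys p)))"
  show "p = (\<Sum>k<N. hcomp k p)"
  proof (rule poly_mapping_eqI)
    fix m
    have "mon_degree m < N" if "Poly_Mapping.lookup p m \<noteq> 0"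
      using that by (auto simp: N_def less_Suc_eq_le in_keys_iff intro!: Max_ge)
    then show "Poly_Mapping.lookup p m = Poly_Mapping.lookup (\<Sum>k<N. hcomp k p) m"
      by (auto simp: lookup_sum lookup_hcomp)
  qed
qed

lemma hcomp_mult:
  assumes "homogeneous e x"
  shows "hcomp k (x * p) = (if e \<le> k then x * hcomp (k - e) p else 0)"
proof -
  obtain N where N: "p = (\<Sum>j<N. hcomp j p)" by (rule hcomp_decomp)
  have *: "hcomp k (x * hcomp j p) = (if e + j = k then x * hcomp j p else 0)" for j
    using hcomp_homogeneous[OF homogeneous_mult[OF assms homogeneous_hcomp, of j p], of k] by auto
  have "hcomp k (x * p) = (\<Sum>j<N. if e + j = k then x * hcomp j p else 0)"
    by (subst N, simp only: sum_distrib_left hcomp_sum *)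
  also have "\<dots> = (if e \<le> k then x * hcomp (k - e) p else 0)"
  proof (cases "e \<le> k")
    case True
    have "hcomp j p = 0" if "j \<ge> N" for j
      by (subst N) (use that in \<open>auto simp: hcomp_sum hcomp_homogeneous[OF homogeneous_hcomp]\<close>)
    moreover have "(\<Sum>j<N. if e + j = k then x * hcomp j p else 0) =
        (\<Sum>j<N. if j = k - e then x * hcomp j p else 0)"
      using True by (intro sum.cong) auto
    ultimately show ?thesis using True by (auto simp: not_less)
  qed auto
  finally show ?thesis .
qed

definition homog_ideal :: "'v::finite cpoly set \<Rightarrow> bool" where
  "homog_ideal I \<longleftrightarrow> is_ideal I \<and> (\<forall>p\<in>I. \<forall>k. hcomp k p \<in> I)"

lemma homog_idealD: "homog_ideal I \<Longrightarrow> is_ideal I" "homog_ideal I \<Longrightarrow> p \<in> I \<Longrightarrow> hcomp k p \<in> I"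
  by (auto simp: homog_ideal_def)

lemma homog_ideal_memI:
  assumes "homog_ideal I" "\<And>k. hcomp k p \<in> I" shows "p \<in> I"
proof -
  obtain N where N: "p = (\<Sum>j<N. hcomp j p)" by (rule hcomp_decomp)
  show ?thesis by (subst N) (intro idl.subspace_sum homog_idealD assms)
qed

lemma homog_ideal_zero [simp]: "homog_ideal {0}"
  and homog_ideal_UNIV [simp]: "homog_ideal UNIV"
  by (auto simp: homog_ideal_def)

lemma homog_ideal_adjoin [intro]:
  assumes "homog_ideal I" "homogeneous e x" shows "homog_ideal (adjoin I x)"
  unfolding homog_ideal_def
proof (intro conjI ballI allI)
  show "is_ideal (adjoin I x)" using assms homog_idealD by blast
next
  fix p k assume "p \<in> adjoin I x"
  then obtain a q where a: "a \<in> I" "p = a + x * q" by (elim adjoin_cases)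
  show "hcomp k p \<in> adjoin I x"
    using adjoin_mem[OF homog_idealD(2)[OF assms(1) a(1)], of k x "if e \<le> k then hcomp (k - e) q else 0"]
    by (simp add: a hcomp_add hcomp_mult[OF assms(2)] split: if_splits)
qed

lemma homog_ideal_adjs [intro]:
  assumes "homog_ideal I" "\<And>x. x \<in> set xs \<Longrightarrow> \<exists>e. homogeneous e x" shows "homog_ideal (adjs I xs)"
  using assms
proof (induction xs arbitrary: I)
  case (Cons x xs)
  then have "homog_ideal (adjoin I x)" using homog_ideal_adjoin by (meson list.set_intros(1))
  with Cons show ?case by simp
qed auto

lemma homog_ideal_annih [intro]:
  assumes "homog_ideal I" "\<And>x. x \<in> set ws \<Longrightarrow> \<exists>e. homogeneous e x" shows "homog_ideal (annih ws I)"
  unfolding homog_ideal_def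
proof (intro conjI ballI allI)
  show "is_ideal (annih ws I)" using assms homog_idealD by blast
next
  fix p k assume p: "p \<in> annih ws I"
  show "hcomp k p \<in> annih ws I" unfolding annih_def
  proof (intro CollectI ballI)
    fix w assume w: "w \<in> set ws"
    then obtain e where e: "homogeneous e w" using assms by blast
    have "hcomp (e + k) (w * p) = hcomp k p * w" using hcomp_mult[OF e, of "e + k" p] by (simp add: mult.commute[of w])
    moreover have "w * p \<in> I" using p w by (simp add: annih_def mult.commute[of w])
    ultimately show "hcomp k p * w \<in> I" using homog_idealD(2)[OF assms(1)] by metis
  qed
qed

text \<open>Multiplication by such a form strictly raises degrees, on which inductions over the
  degree rest. The polynomial 0 is included.\<close>

definition pos_homog :: "'v::finite cpoly \<Rightarrow> bool" where
  "pos_homog p \<longleftrightarrow> (\<exists>d>0. homogeneous d p)"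

lemma homog_ideal_adjs_pos [intro]:
  "homog_ideal I \<Longrightarrow> \<forall>x\<in>set xs. pos_homog x \<Longrightarrow> homog_ideal (adjs I xs)"
  by (rule homog_ideal_adjs) (auto simp: pos_homog_def)

lemma homog_ideal_annih_pos [intro]:
  "homog_ideal I \<Longrightarrow> \<forall>x\<in>set ws. pos_homog x \<Longrightarrow> homog_ideal (annih ws I)"
  by (rule homog_ideal_annih) (auto simp: pos_homog_def)

lemma homog_ideal_ideal_gen:
  assumes "finite A" "\<And>x. x \<in> A \<Longrightarrow> \<exists>e. homogeneous e x" shows "homog_ideal (ideal_gen A)"
  using assms finite_list[OF assms(1)] homog_ideal_adjs[OF homog_ideal_zero] adjs_zero by metis

subsection \<open>Permuting regular sequences\<close>

text \<open>If \<open>y * h\<close> lies in \<open>I\<close>, then \<open>h = a + x * q\<close> with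
  \<open>a\<close> in \<open>I\<close>, since \<open>y\<close> is regular modulo
  \<open>I + xS\<close>; cancelling \<open>x\<close> shows that \<open>y * q\<close> lies in
  \<open>I\<close> as well. In a fixed degree \<open>q\<close> has smaller degree than
  \<open>h\<close>, because \<open>d > 0\<close>, so the descent ends. The second claim is a direct
  cancellation.\<close>

lemma nzd_mod_swap:
  assumes I: "homog_ideal I" and x: "homogeneous d x" "d > 0" and y: "homogeneous e y"
    and xI: "nzd_mod I x" and yx: "nzd_mod (adjoin I x) y"
  shows "nzd_mod I y" "nzd_mod (adjoin I y) x"
proof -
  have iI: "is_ideal I" using I homog_idealD by blast
  show y_nzd: "nzd_mod I y" unfolding nzd_mod_def
  proof (intro allI impI)
    fix h assume "y * h \<in> I"
    \<comment> \<open>The condition ranges over all components so that it applies again to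
      \<open>hcomp (k - d) q\<close>, whose other components are 0.\<close>
    moreover have "hcomp k h \<in> I" if "\<forall>k. y * hcomp k h \<in> I" for h k
      using that
    proof (induction k arbitrary: h rule: less_induct)
      case (less k)
      have "y * hcomp k h \<in> adjoin I x" using less.prems adjoin_superset by blast
      then have "hcomp k h \<in> adjoin I x" using yx by (simp add: nzd_mod_def)
      then obtain a q where a: "a \<in> I" "hcomp k h = a + x * q" by (elim adjoin_cases)
      have "hcomp k (hcomp k h) = hcomp k a + hcomp k (x * q)"
        by (simp add: a hcomp_add)
      then have *: "hcomp k h = hcomp k a + (if d \<le> k then x * hcomp (k - d) q else 0)"
        by (simp add: hcomp_homogeneous[OF homogeneous_hcomp] hcomp_mult[OF x(1)])
      have ka: "hcomp k a \<in> I" using a I homog_idealD by blast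
      show ?case
      proof (cases "d \<le> k")
        case True
        have "y * hcomp k h - y * hcomp k a \<in> I"
          using idl.subspace_diff[OF iI spec[OF less.prems, of k] idl.subspace_scale[OF iI ka]] by simp
        then have "x * (y * hcomp (k - d) q) \<in> I"
          using True by (simp add: * algebra_simps)
        then have **: "y * hcomp (k - d) q \<in> I" using xI by (simp add: nzd_mod_def)
        have "hcomp (k - d) (hcomp (k - d) q) \<in> I"
        proof (rule less.IH)
          show "k - d < k" using x True by simp
          show "\<forall>j. y * hcomp j (hcomp (k - d) q) \<in> I"
            using ** iI by (auto simp: hcomp_homogeneous[OF homogeneous_hcomp] idl.subspace_0)
        qed
        then have "x * hcomp (k - d) q \<in> I"
          using iI by (simp add: hcomp_homogeneous[OF homogeneous_hcomp] idl.subspace_scale)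
        then show ?thesis using * ka True iI by (auto intro: idl.subspace_add)
      next
        case False
        then show ?thesis using * ka by simp
      qed
    qed
    moreover have "y * hcomp k h \<in> I" if "y * h \<in> I" for k
      using homog_idealD(2)[OF I that, of "e + k"] by (simp add: hcomp_mult[OF y])
    ultimately show "h \<in> I" using homog_ideal_memI[OF I] by blast
  qed
  show "nzd_mod (adjoin I y) x" unfolding nzd_mod_def
  proof (intro allI impI)
    fix u assume "x * u \<in> adjoin I y"
    then obtain a v where a: "a \<in> I" "x * u = a + y * v" by (elim adjoin_cases)
    then have "y * v = - a + x * u" by (simp add: algebra_simps)
    then have "y * v \<in> adjoin I x" using adjoin_mem[OF idl.subspace_neg[OF iI a(1)]] by metis
    then have "v \<in> adjoin I x" using yx by (simp add: nzd_mod_def)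
    then obtain b w where b: "b \<in> I" "v = b + x * w" by (elim adjoin_cases)
    have "x * (u - y * w) = a + y * b" using a b by (simp add: algebra_simps)
    also have "\<dots> \<in> I" using a b iI by (intro idl.subspace_add idl.subspace_scale)
    finally have "u - y * w \<in> I" using xI by (simp add: nzd_mod_def)
    from adjoin_mem[OF this, of y w] show "u \<in> adjoin I y" by simp
  qed
qed

text \<open>The last element travels to the front by successive swaps with its left
  neighbour.\<close>

lemma regular_mod_rotate:
  assumes "homog_ideal I" "\<forall>c\<in>set cs. pos_homog c" "pos_homog x" "regular_mod I (cs @ [x])"
  shows "regular_mod I (x # cs)"
  using assms
proof (induction cs arbitrary: I)
  case (Cons c cs)
  from Cons.prems obtain d where d: "d > 0" "homogeneous d c" by (auto simp: pos_homog_def)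
  from Cons.prems obtain e where e: "e > 0" "homogeneous e x" by (auto simp: pos_homog_def)
  have "regular_mod (adjoin I c) (x # cs)"
    using Cons.prems d by (intro Cons.IH) (auto intro: homog_ideal_adjoin)
  then show ?case
    using nzd_mod_swap[OF Cons.prems(1) d(2,1) e(2)] Cons.prems(4)
    by (auto simp: adjoin_commute)
qed simp

section \<open>Dimensions of quotients\<close>

text \<open>\<open>cvs.dim\<close> is informative only for finite-dimensional spaces, and the
  polynomial ring is not one, so this side condition is carried along.\<close>

definition fin_dim :: "'v cpoly set \<Rightarrow> bool" where
  "fin_dim V \<longleftrightarrow> (\<exists>F. finite F \<and> V \<subseteq> cvs.span F)"

lemma fin_dim_subset: "fin_dim V \<Longrightarrow> U \<subseteq> V \<Longrightarrow> fin_dim U"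
  by (auto simp: fin_dim_def)

lemma fin_dim_independent:
  assumes "fin_dim V" "B \<subseteq> V" "cvs.independent B" shows "finite B"
proof -
  obtain F where F: "finite F" "V \<subseteq> cvs.span F" using assms by (auto simp: fin_dim_def)
  then show ?thesis using cvs.independent_span_bound[OF F(1) assms(3)] assms(2) by blast
qed

lemma fin_dim_basis:
  assumes "fin_dim V" "cvs.subspace V"
  obtains C where "finite C" "C \<subseteq> V" "cvs.independent C" "cvs.span C = V" "card C = cvs.dim V"
proof -
  obtain C where C: "C \<subseteq> V" "cvs.independent C" "V \<subseteq> cvs.span C" "card C = cvs.dim V"
    using cvs.basis_exists by blast
  have "finite C" using fin_dim_independent[OF assms(1) C(1,2)] .
  then show thesis using C that cvs.span_subspace[OF C(1,3) assms(2)] by blast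
qed

lemma quotient_basis_indep:
  "quotient_basis V W B \<Longrightarrow> finite T \<Longrightarrow> T \<subseteq> B \<Longrightarrow> (\<Sum>b\<in>T. cscale (u b) b) \<in> W \<Longrightarrow> b \<in> T \<Longrightarrow> u b = 0"
  by (simp add: quotient_basis_def)

lemma quotient_basis_span:
  assumes "quotient_basis V W B" "v \<in> V"
  obtains T u where "finite T" "T \<subseteq> B" "v - (\<Sum>b\<in>T. cscale (u b) b) \<in> W"
  using assms by (auto simp: quotient_basis_def)

text \<open>A basis of \<open>W\<close> is extended to one of \<open>V\<close>; the added vectors
  represent a basis of the quotient.\<close>

lemma quotient_basis_exists:
  assumes V: "cvs.subspace V" "fin_dim V" and W: "cvs.subspace W" "W \<subseteq> V"
  shows "\<exists>B. quotient_basis V W B"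
proof -
  obtain C where C: "finite C" "C \<subseteq> W" "cvs.independent C" "cvs.span C = W" "card C = cvs.dim W"
    by (rule fin_dim_basis[OF fin_dim_subset[OF V(2) W(2)] W(1)])
  then obtain B' where B': "C \<subseteq> B'" "B' \<subseteq> V" "cvs.independent B'" "V \<subseteq> cvs.span B'"
    using cvs.maximal_independent_subset_extend[of C V] W by blast
  have finB: "finite B'"
    using fin_dim_independent[OF V(2) B'(2,3)] .
  have "quotient_basis V W (B' - C)" unfolding quotient_basis_def
  proof (intro conjI allI impI ballI)
    show "B' - C \<subseteq> V" using B' by auto
  next
    fix T u b assume T: "finite T \<and> T \<subseteq> B' - C \<and> (\<Sum>b\<in>T. cscale (u b) b) \<in> W" "b \<in> T"
    then obtain r where r: "(\<Sum>b\<in>T. cscale (u b) b) = (\<Sum>c\<in>C. cscale (r c) c)"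
      using C cvs.span_finite[OF C(1)] by auto
    let ?s = "\<lambda>b. if b \<in> T then u b else - r b"
    have "(\<Sum>b\<in>T \<union> C. cscale (?s b) b) = (\<Sum>b\<in>T. cscale (?s b) b) + (\<Sum>b\<in>C. cscale (?s b) b)"
      using T C by (intro sum.union_disjoint) auto
    also have "(\<Sum>b\<in>T. cscale (?s b) b) = (\<Sum>b\<in>T. cscale (u b) b)" by simp
    also have "(\<Sum>b\<in>C. cscale (?s b) b) = - (\<Sum>c\<in>C. cscale (r c) c)"
      unfolding sum_negf[symmetric] using T by (intro sum.cong) (auto simp: cvs.scale_minus_left)
    finally have "(\<Sum>b\<in>T \<union> C. cscale (?s b) b) = 0" using r by simp
    then have "?s b = 0"
      by (rule cvs.independentD[OF B'(3), rotated 2]) (use T C B' in auto)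
    then show "u b = 0" using T by simp
  next
    fix v assume "v \<in> V"
    then obtain r where r: "v = (\<Sum>b\<in>B'. cscale (r b) b)"
      using B'(4) cvs.span_finite[OF finB] by auto
    have "v - (\<Sum>b\<in>B' - C. cscale (r b) b) = (\<Sum>b\<in>C. cscale (r b) b)"
      using r sum.subset_diff[OF B'(1) finB, of "\<lambda>b. cscale (r b) b"] by simp
    also have "\<dots> \<in> W" using C W by (auto intro!: cvs.subspace_sum cvs.subspace_scale)
    finally show "\<exists>T u. finite T \<and> T \<subseteq> B' - C \<and> v - (\<Sum>b\<in>T. cscale (u b) b) \<in> W"
      using finB by blast
  qed
  then show ?thesis by blast
qed

text \<open>Adding a basis of \<open>W\<close> to \<open>B\<close> gives a basis of
  \<open>V\<close>. So all quotient bases have the same size, and \<open>quotient_dim\<close> does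
  not depend on the one picked by \<open>SOME\<close>.\<close>

lemma quotient_basis_card:
  assumes V: "cvs.subspace V" "fin_dim V" and W: "cvs.subspace W" "W \<subseteq> V"
    and B: "quotient_basis V W B"
  shows "finite B" "card B + cvs.dim W = cvs.dim V"
proof -
  obtain C where C: "finite C" "C \<subseteq> W" "cvs.independent C" "cvs.span C = W" "card C = cvs.dim W"
    by (rule fin_dim_basis[OF fin_dim_subset[OF V(2) W(2)] W(1)])
  have B1: "B \<subseteq> V" using B by (simp add: quotient_basis_def)
  have B2: "u b = 0" if "finite T" "T \<subseteq> B" "(\<Sum>b\<in>T. cscale (u b) b) \<in> W" "b \<in> T" for T u b
    using quotient_basis_indep[OF B that] .
  have disj: "B \<inter> C = {}"
  proof (rule ccontr)
    assume "B \<inter> C \<noteq> {}"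
    then obtain b where "b \<in> B" "b \<in> C" by blast
    then show False using B2[of "{b}" "\<lambda>_. 1" b] C by auto
  qed
  have ind: "cvs.independent (B \<union> C)"
    unfolding cvs.independent_explicit_finite_subsets
  proof (intro allI impI ballI)
    fix A u v assume A: "A \<subseteq> B \<union> C" "finite A" "(\<Sum>v\<in>A. cscale (u v) v) = 0" "v \<in> A"
    have "(\<Sum>v\<in>A. cscale (u v) v) =
        (\<Sum>v\<in>(A \<inter> B) \<union> (A \<inter> C). cscale (u v) v)"
      using A by (intro sum.cong) auto
    also have "\<dots> = (\<Sum>v\<in>A \<inter> B. cscale (u v) v) + (\<Sum>v\<in>A \<inter> C. cscale (u v) v)"
      using A disj by (intro sum.union_disjoint) auto
    finally have eq: "(\<Sum>v\<in>A \<inter> B. cscale (u v) v) + (\<Sum>v\<in>A \<inter> C. cscale (u v) v) = 0"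
      using A by simp
    have "(\<Sum>v\<in>A \<inter> C. cscale (u v) v) \<in> W"
      using C W by (auto intro!: cvs.subspace_sum cvs.subspace_scale)
    moreover have "(\<Sum>v\<in>A \<inter> B. cscale (u v) v) = - (\<Sum>v\<in>A \<inter> C. cscale (u v) v)"
      using eq by (simp add: eq_neg_iff_add_eq_0)
    ultimately have "(\<Sum>v\<in>A \<inter> B. cscale (u v) v) \<in> W"
      using cvs.subspace_neg[OF W(1), of "\<Sum>v\<in>A \<inter> C. cscale (u v) v"] by simp
    from B2[OF _ _ this] have u0: "u b = 0" if "b \<in> A \<inter> B" for b
      using A(2) that by simp
    then have "(\<Sum>v\<in>A \<inter> C. cscale (u v) v) = 0" using eq by simp
    then have "u b = 0" if "b \<in> A \<inter> C" for b
      using cvs.independentD[OF C(3) _ _ _ that] A(2) by blast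
    with u0 A show "u v = 0" by blast
  qed
  have sp: "V \<subseteq> cvs.span (B \<union> C)"
  proof
    fix v assume v: "v \<in> V"
    obtain T u where T: "finite T" "T \<subseteq> B" "v - (\<Sum>b\<in>T. cscale (u b) b) \<in> W"
      by (rule quotient_basis_span[OF B v])
    have "v - (\<Sum>b\<in>T. cscale (u b) b) \<in> cvs.span (B \<union> C)"
      using T C cvs.span_mono[of C "B \<union> C"] by blast
    moreover have "(\<Sum>b\<in>T. cscale (u b) b) \<in> cvs.span (B \<union> C)"
      by (rule cvs.span_sum, rule cvs.span_scale, rule cvs.span_base) (use T in auto)
    ultimately show "v \<in> cvs.span (B \<union> C)" using cvs.span_add by fastforce
  qed
  have sub: "B \<union> C \<subseteq> V" using B1 C W by auto
  have fin: "finite (B \<union> C)"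
    using fin_dim_independent[OF V(2) sub ind] .
  then show "finite B" by simp
  have "card (B \<union> C) = cvs.dim V" using cvs.basis_card_eq_dim[OF sub sp ind] .
  then show "card B + cvs.dim W = cvs.dim V"
    using C fin disj by (simp add: card_Un_disjoint)
qed

lemma quotient_dim_basis:
  assumes "cvs.subspace V" "fin_dim V" "cvs.subspace W" "W \<subseteq> V"
  obtains B where "quotient_basis V W B" "finite B" "card B = quotient_dim V W"
  using someI_ex[OF quotient_basis_exists[OF assms]] quotient_basis_card[OF assms] that
  by (metis quotient_dim_def)

lemma quotient_dim_add_dim:
  assumes "cvs.subspace V" "fin_dim V" "cvs.subspace W" "W \<subseteq> V"
  shows "quotient_dim V W + cvs.dim W = cvs.dim V"
  using quotient_dim_basis[OF assms] quotient_basis_card[OF assms] by metis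

text \<open>Multiplication by \<open>x\<close> induces an isomorphism from \<open>V/W\<close> to
  \<open>V'/W'\<close> and carries a quotient basis to a quotient basis.\<close>

lemma quotient_dim_iso:
  assumes V: "cvs.subspace V" "fin_dim V" and W: "cvs.subspace W" "W \<subseteq> V"
    and V': "cvs.subspace V'" "fin_dim V'" and W': "cvs.subspace W'" "W' \<subseteq> V'"
    and maps: "\<And>v. v \<in> V \<Longrightarrow> x * v \<in> V'"
    and surj: "\<And>v'. v' \<in> V' \<Longrightarrow> \<exists>v\<in>V. v' - x * v \<in> W'"
    and ker: "\<And>v. v \<in> V \<Longrightarrow> x * v \<in> W' \<longleftrightarrow> v \<in> W"
  shows "quotient_dim V W = quotient_dim V' W'"
proof -
  obtain B where B: "quotient_basis V W B" "finite B" "card B = quotient_dim V W"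
    using quotient_dim_basis[OF V W] .
  have B1: "B \<subseteq> V" using B by (simp add: quotient_basis_def)
  have B2: "u b = 0" if "T \<subseteq> B" "(\<Sum>b\<in>T. cscale (u b) b) \<in> W" "b \<in> T" for T u b
    using quotient_basis_indep[OF B(1) finite_subset[OF that(1) B(2)] that] .
  have lin: "x * (\<Sum>b\<in>T. cscale (u b) b) = (\<Sum>b\<in>T. cscale (u b) (x * b))" for T u
    by (simp add: sum_distrib_left cscale_def mult.left_commute)
  have sumV: "(\<Sum>b\<in>T. cscale (u b) b) \<in> V" if "T \<subseteq> B" for T u
    using that B1 V by (auto intro!: cvs.subspace_sum cvs.subspace_scale)
  have inj: "inj_on ((*) x) B"
  proof (rule inj_onI, rule ccontr)
    fix b b' assume b: "b \<in> B" "b' \<in> B" "x * b = x * b'" "b \<noteq> b'"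
    let ?u = "\<lambda>c. if c = b then 1 else -1 :: complex"
    have "(\<Sum>c\<in>{b, b'}. cscale (?u c) c) = b - b'"
      using b(4) by (simp add: cvs.scale_minus_left)
    moreover have "x * (b - b') \<in> W'" using b cvs.subspace_0[OF W'(1)] by (simp add: algebra_simps)
    moreover have "b - b' \<in> V" using b B1 V cvs.subspace_diff by blast
    ultimately have "?u b = 0" using ker b by (intro B2[of "{b, b'}"]) auto
    then show False by simp
  qed
  have "quotient_basis V' W' ((*) x ` B)" unfolding quotient_basis_def
  proof (intro conjI allI impI ballI)
    show "(*) x ` B \<subseteq> V'" using B1 maps by auto
  next
    fix T u b assume T: "finite T \<and> T \<subseteq> (*) x ` B \<and> (\<Sum>b\<in>T. cscale (u b) b) \<in> W'" "b \<in> T"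
    then obtain T0 where T0: "T0 \<subseteq> B" "T = (*) x ` T0" by (meson subset_imageE)
    have "(\<Sum>b\<in>T. cscale (u b) b) = x * (\<Sum>b\<in>T0. cscale (u (x * b)) b)"
      unfolding T0 lin by (subst sum.reindex) (use inj T0 inj_on_subset in auto)
    then have W0: "(\<Sum>b\<in>T0. cscale (u (x * b)) b) \<in> W" 
      using T(1) ker[OF sumV[OF T0(1), of "\<lambda>b. u (x * b)"]] by simp
    obtain b0 where "b0 \<in> T0" "b = x * b0" using T(2) T0(2) by blast
    then show "u b = 0" using B2[OF T0(1) W0] by simp
  next
    fix v' assume "v' \<in> V'"
    then obtain v where v: "v \<in> V" "v' - x * v \<in> W'" using surj by blast
    obtain T u where T: "finite T" "T \<subseteq> B" "v - (\<Sum>b\<in>T. cscale (u b) b) \<in> W"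
      by (rule quotient_basis_span[OF B(1) v(1)])
    \<comment> \<open>Coefficients are carried to the image along the inverse on \<open>B\<close>,
      where multiplication by \<open>x\<close> is injective.\<close>
    let ?u = "\<lambda>c. u (inv_into B ((*) x) c)"
    have "x * (\<Sum>b\<in>T. cscale (u b) b) = (\<Sum>b\<in>(*) x ` T. cscale (?u b) b)"
      unfolding lin by (subst sum.reindex)
        (use inj T inj_on_subset in \<open>auto intro!: sum.cong simp: subset_iff\<close>)
    moreover have "x * (v - (\<Sum>b\<in>T. cscale (u b) b)) \<in> W'" using T ker W by blast
    ultimately have "(v' - x * v) + (x * v - (\<Sum>b\<in>(*) x ` T. cscale (?u b) b)) \<in> W'"
      using v W' by (intro cvs.subspace_add) (auto simp: right_diff_distrib)
    then show "\<exists>T u. finite T \<and> T \<subseteq> (*) x ` B \<and> v' - (\<Sum>b\<in>T. cscale (u b) b) \<in> W'"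
      using T by (intro exI[of _ "(*) x ` T"] exI[of _ ?u]) auto
  qed
  from quotient_basis_card[OF V' W' this] quotient_dim_add_dim[OF V' W']
  show ?thesis using B(3) card_image[OF inj] by linarith
qed

section \<open>Hilbert series\<close>

lemma is_ideal_cvs_subspace: "is_ideal I \<Longrightarrow> cvs.subspace I"
  by (rule cvs.subspaceI)
    (auto simp: cscale_def idl.subspace_0 idl.subspace_add idl.subspace_scale)

lemma cvs_subspace_homogeneous: "cvs.subspace (Collect (homogeneous k))"
proof (rule cvs.subspaceI)
  fix c p assume "p \<in> Collect (homogeneous k)"
  then show "cscale c p \<in> Collect (homogeneous k)"
    using homogeneous_mult[of 0 "Poly_Mapping.single 0 c" k p] by (simp add: cscale_def)
qed (auto intro: homogeneous_add)

lemma lookup_cscale: "Poly_Mapping.lookup (cscale c p) m = c * Poly_Mapping.lookup p m"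
  using lookup_mult by (simp add: cscale_def flip: mult_map_scale_conv_mult) (simp add: Poly_Mapping.map.rep_eq when_def)

lemma poly_mapping_eq_sum_single:
  assumes "finite A" "Poly_Mapping.keys p \<subseteq> A"
  shows "p = (\<Sum>m\<in>A. Poly_Mapping.single m (Poly_Mapping.lookup p m))"
proof (rule poly_mapping_eqI)
  fix m
  have "Poly_Mapping.lookup (\<Sum>m\<in>A. Poly_Mapping.single m (Poly_Mapping.lookup p m)) m
      = (\<Sum>m'\<in>A. if m' = m then Poly_Mapping.lookup p m' else 0)"
    unfolding lookup_sum by (intro sum.cong) (auto simp: lookup_single when_def)
  then show "Poly_Mapping.lookup p m =
      Poly_Mapping.lookup (\<Sum>m\<in>A. Poly_Mapping.single m (Poly_Mapping.lookup p m)) m"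
    using assms by (auto simp: in_keys_iff subset_iff)
qed

lemma finite_mon_degree: "finite {m :: 'v::finite \<Rightarrow>\<^sub>0 nat. mon_degree m = k}"
proof -
  have "Poly_Mapping.lookup m i \<le> mon_degree m" for m :: "'v \<Rightarrow>\<^sub>0 nat" and i
    unfolding mon_degree_def by (rule member_le_sum) auto
  then have "Poly_Mapping.lookup ` {m :: 'v \<Rightarrow>\<^sub>0 nat. mon_degree m = k} \<subseteq> PiE UNIV (\<lambda>_. {..k})"
    by auto
  then have "finite (Poly_Mapping.lookup ` {m :: 'v \<Rightarrow>\<^sub>0 nat. mon_degree m = k})"
    by (rule finite_subset) (auto intro: finite_PiE)
  then show ?thesis by (rule finite_imageD) (meson inj_onI lookup_inject)
qed

lemma fin_dim_homogeneous: "fin_dim (Collect (homogeneous k) :: 'v::finite cpoly set)"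
  unfolding fin_dim_def
proof (intro exI conjI)
  let ?M = "{m :: 'v \<Rightarrow>\<^sub>0 nat. mon_degree m = k}"
  let ?F = "(\<lambda>m. Poly_Mapping.single m 1) ` ?M :: 'v cpoly set"
  show "finite ?F" using finite_mon_degree by blast
  show "Collect (homogeneous k) \<subseteq> cvs.span ?F"
  proof
    fix p :: "'v cpoly" assume "p \<in> Collect (homogeneous k)"
    then have "p = (\<Sum>m\<in>?M. Poly_Mapping.single m (Poly_Mapping.lookup p m))"
      using finite_mon_degree by (intro poly_mapping_eq_sum_single) (auto simp: homogeneous_def)
    also have "\<dots> = (\<Sum>m\<in>?M. cscale (Poly_Mapping.lookup p m) (Poly_Mapping.single m 1))"
      by (simp add: cscale_def mult_single)
    also have "\<dots> \<in> cvs.span ?F" by (rule cvs.span_sum, rule cvs.span_scale, rule cvs.span_base) auto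
    finally show "p \<in> cvs.span ?F" .
  qed
qed

lemma cvs_subspace_part: "is_ideal I \<Longrightarrow> cvs.subspace (I \<inter> Collect (homogeneous k))"
  by (intro cvs.subspace_inter is_ideal_cvs_subspace cvs_subspace_homogeneous)

lemma fin_dim_part: "fin_dim (I \<inter> Collect (homogeneous k))"
  by (rule fin_dim_subset[OF fin_dim_homogeneous]) blast

lemma HP_nth: "fps_nth (HP A B) k =
    real (quotient_dim (A \<inter> Collect (homogeneous k)) (B \<inter> Collect (homogeneous k)))"
  by (simp add: HP_def)

lemma HP_add:
  assumes "is_ideal A" "is_ideal B" "is_ideal C" "C \<subseteq> B" "B \<subseteq> A"
  shows "HP A C = HP A B + HP B C"
proof (rule fps_ext)
  fix k
  let ?H = "Collect (homogeneous k)"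
  have "quotient_dim (A \<inter> ?H) (C \<inter> ?H) + cvs.dim (C \<inter> ?H) = cvs.dim (A \<inter> ?H)"
    "quotient_dim (A \<inter> ?H) (B \<inter> ?H) + cvs.dim (B \<inter> ?H) = cvs.dim (A \<inter> ?H)"
    "quotient_dim (B \<inter> ?H) (C \<inter> ?H) + cvs.dim (C \<inter> ?H) = cvs.dim (B \<inter> ?H)"
    using assms by (auto intro!: quotient_dim_add_dim cvs_subspace_part fin_dim_part)
  then show "fps_nth (HP A C) k = fps_nth (HP A B + HP B C) k" by (simp add: HP_nth)
qed

lemma HP_self: "is_ideal A \<Longrightarrow> HP A A = 0"
  using HP_add[of A A A] by simp

text \<open>Turns an identity of Hilbert series back into an equality of ideals: a quotient basis of
  size 0 in each degree leaves nothing outside \<open>B\<close>.\<close>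

lemma HP_eq_0_imp:
  assumes A: "homog_ideal A" and B: "homog_ideal B" and "B \<subseteq> A" "HP A B = 0"
  shows "A = B"
proof
  show "A \<subseteq> B"
  proof (rule subsetI, rule homog_ideal_memI[OF B])
    fix p k assume "p \<in> A"
    let ?H = "Collect (homogeneous k)"
    have ss: "cvs.subspace (A \<inter> ?H)" "fin_dim (A \<inter> ?H)" "cvs.subspace (B \<inter> ?H)"
        "B \<inter> ?H \<subseteq> A \<inter> ?H"
      using assms homog_idealD by (auto intro!: cvs_subspace_part fin_dim_part)
    obtain T where T: "quotient_basis (A \<inter> ?H) (B \<inter> ?H) T" "finite T"
        "card T = quotient_dim (A \<inter> ?H) (B \<inter> ?H)"
      using quotient_dim_basis[OF ss] .
    have "fps_nth (HP A B) k = 0" using assms by simp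
    then have "T = {}" using T by (simp add: HP_nth)
    moreover have "hcomp k p \<in> A \<inter> ?H" using \<open>p \<in> A\<close> A homog_idealD by auto
    ultimately show "hcomp k p \<in> B" using T(1) by (force simp: quotient_basis_def)
  qed
qed (use assms in auto)

section \<open>Multiplication by a form as a shift of degrees\<close>

definition mulsum :: "'a::comm_ring_1 set \<Rightarrow> 'a \<Rightarrow> 'a set \<Rightarrow> 'a set" where
  "mulsum I x A = {p + x * q | p q. p \<in> I \<and> q \<in> A}"

lemma adjoin_eq_mulsum: "adjoin I x = mulsum I x UNIV"
  by (simp add: adjoin_def mulsum_def)

lemma mulsum_mem: "p \<in> I \<Longrightarrow> q \<in> A \<Longrightarrow> p + x * q \<in> mulsum I x A"
  by (auto simp: mulsum_def)

lemma mulsum_cases: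
  assumes "z \<in> mulsum I x A" obtains p q where "p \<in> I" "q \<in> A" "z = p + x * q"
  using assms by (auto simp: mulsum_def)

lemma mulsum_superset: "is_ideal A \<Longrightarrow> I \<subseteq> mulsum I x A"
  using mulsum_mem[of _ I 0 A x] by (auto simp: idl.subspace_0)

lemma mulsum_mult: "is_ideal I \<Longrightarrow> q \<in> A \<Longrightarrow> x * q \<in> mulsum I x A"
  using mulsum_mem[of 0 I q A x] by (simp add: idl.subspace_0)

lemma mulsum_mono: "A \<subseteq> B \<Longrightarrow> mulsum I x A \<subseteq> mulsum I x B"
  by (auto simp: mulsum_def)

lemma is_ideal_mulsum [simp, intro]:
  assumes "is_ideal I" "is_ideal A" shows "is_ideal (mulsum I x A)"
proof (rule idl.subspaceI)
  show "0 \<in> mulsum I x A" using mulsum_superset[OF assms(2)] idl.subspace_0[OF assms(1)] by blast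
next
  fix y z assume "y \<in> mulsum I x A" "z \<in> mulsum I x A"
  then obtain p q p' q' where *: "p \<in> I" "p' \<in> I" "q \<in> A" "q' \<in> A" "y = p + x * q" "z = p' + x * q'"
    by (elim mulsum_cases)
  then have "(p + p') + x * (q + q') \<in> mulsum I x A"
    using assms by (intro mulsum_mem idl.subspace_add)
  then show "y + z \<in> mulsum I x A" using * by (simp add: algebra_simps)
next
  fix c y assume "y \<in> mulsum I x A"
  then obtain p q where *: "p \<in> I" "q \<in> A" "y = p + x * q" by (elim mulsum_cases)
  then have "c * p + x * (c * q) \<in> mulsum I x A"
    using assms by (intro mulsum_mem idl.subspace_scale)
  then show "c * y \<in> mulsum I x A" using * by (simp add: algebra_simps)
qed

text \<open>Multiplication by \<open>x\<close> sends \<open>A/B\<close> onto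
  \<open>(I + xA)/(I + xB)\<close> and raises degrees by \<open>e\<close>; \<open>ker\<close> makes
  it injective. In degrees below \<open>e\<close> multiples of \<open>x\<close> contribute nothing,
  so both ideals reduce to \<open>I\<close>.\<close>

lemma HP_shift:
  assumes I: "homog_ideal I" and A: "homog_ideal A" and B: "homog_ideal B" "B \<subseteq> A"
    and x: "homogeneous e x" and ker: "\<And>u. u \<in> A \<Longrightarrow> x * u \<in> mulsum I x B \<Longrightarrow> u \<in> B"
  shows "HP (mulsum I x A) (mulsum I x B) = fps_X ^ e * HP A B"
proof (rule fps_ext)
  fix k
  note id = I[THEN homog_idealD(1)] A[THEN homog_idealD(1)] B(1)[THEN homog_idealD(1)]
  let ?H = "Collect (homogeneous k)" and ?H' = "Collect (homogeneous (k - e))"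
  have dec: "z = hcomp k p + (if e \<le> k then x * hcomp (k - e) q else 0)"
    if "homogeneous k z" "z = p + x * q" for z p q
    using that hcomp_homogeneous[of k z k] by (simp add: hcomp_add hcomp_mult[OF x])
  show "fps_nth (HP (mulsum I x A) (mulsum I x B)) k = fps_nth (fps_X ^ e * HP A B) k"
  proof (cases "e \<le> k")
    case True
    have "quotient_dim (A \<inter> ?H') (B \<inter> ?H') =
        quotient_dim (mulsum I x A \<inter> ?H) (mulsum I x B \<inter> ?H)"
    proof (rule quotient_dim_iso[where x = x])
      show "x * v \<in> mulsum I x A \<inter> ?H" if "v \<in> A \<inter> ?H'" for v
        using that homogeneous_mult[OF x, of "k - e" v] True mulsum_mult[OF id(1)] by auto
      show "\<exists>v\<in>A \<inter> ?H'. z - x * v \<in> mulsum I x B \<inter> ?H" if "z \<in> mulsum I x A \<inter> ?H" for z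
      proof -
        from that obtain p q where pq: "p \<in> I" "q \<in> A" "z = p + x * q" by (auto elim: mulsum_cases)
        have "z - x * hcomp (k - e) q = hcomp k p" using dec[of z p q] that pq True by auto
        moreover have "hcomp k p \<in> mulsum I x B \<inter> ?H"
          using homog_idealD(2)[OF I pq(1)] mulsum_superset[OF id(3)] by auto
        moreover have "hcomp (k - e) q \<in> A \<inter> ?H'" using homog_idealD(2)[OF A pq(2)] by auto
        ultimately show ?thesis by metis
      qed
      show "x * v \<in> mulsum I x B \<inter> ?H \<longleftrightarrow> v \<in> B \<inter> ?H'" if "v \<in> A \<inter> ?H'" for v
        using that ker[of v] homogeneous_mult[OF x, of "k - e" v] True mulsum_mult[OF id(1)] by auto
    qed (use id B mulsum_mono[OF B(2)] in \<open>auto intro!: cvs_subspace_part fin_dim_part\<close>)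
    then show ?thesis using True by (simp add: HP_nth fps_X_power_mult_nth)
  next
    case False
    have "mulsum I x D \<inter> ?H = I \<inter> ?H" if "is_ideal D" for D
    proof
      show "mulsum I x D \<inter> ?H \<subseteq> I \<inter> ?H"
      proof
        fix z assume z: "z \<in> mulsum I x D \<inter> ?H"
        then obtain p q where pq: "p \<in> I" "q \<in> D" "z = p + x * q" by (auto elim: mulsum_cases)
        then have "z = hcomp k p" using dec[of z p q] z False by simp
        then show "z \<in> I \<inter> ?H" using homog_idealD(2)[OF I pq(1)] z by auto
      qed
    qed (use mulsum_superset[OF that] in auto)
    then have "quotient_dim (mulsum I x A \<inter> ?H) (mulsum I x B \<inter> ?H) =
        quotient_dim (I \<inter> ?H) (I \<inter> ?H)" using id by simp
    also have "\<dots> = 0" using HP_self[OF id(1)] HP_nth[of I I k] by simp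
    finally show ?thesis using False by (simp add: HP_nth fps_X_power_mult_nth)
  qed
qed

section \<open>Generic elements\<close>

text \<open>Gaussian elimination: the unknown \<open>x0\<close> is solved from the equation
  \<open>e\<close>, which leaves one equation and one unknown fewer.\<close>

lemma linear_system_nontrivial_solution:
  fixes M :: "'a \<Rightarrow> 'e \<Rightarrow> 'f::field"
  assumes "finite E" "finite X" "card E < card X"
  shows "\<exists>c. (\<exists>x\<in>X. c x \<noteq> 0) \<and> (\<forall>e\<in>E. (\<Sum>x\<in>X. c x * M x e) = 0)"
  using assms
proof (induction E arbitrary: X M rule: finite_induct)
  case empty
  then obtain x where "x \<in> X" by fastforce
  then show ?case by (intro exI[of _ "\<lambda>_. 1"]) auto
next
  case (insert e E)
  show ?case
  proof (cases "\<forall>x\<in>X. M x e = 0")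
    case True
    have "card E < card X" using insert by simp
    from insert.IH[OF insert.prems(1) this, of M] True show ?thesis by auto
  next
    case False
    then obtain x0 where x0: "x0 \<in> X" "M x0 e \<noteq> 0" by blast
    define X' where "X' = X - {x0}"
    have X': "finite X'" "card E < card X'" "X = insert x0 X'" "x0 \<notin> X'"
      using insert x0 by (auto simp: X'_def)
    obtain c where c: "\<exists>x\<in>X'. c x \<noteq> 0"
        "\<forall>e'\<in>E. (\<Sum>x\<in>X'. c x * (M x e' - M x e / M x0 e * M x0 e')) = 0"
      using insert.IH[OF X'(1,2), of "\<lambda>x e'. M x e' - M x e / M x0 e * M x0 e'"] by blast
    define c' where "c' = c(x0 := - (\<Sum>x\<in>X'. c x * M x e) / M x0 e)"
    have sum': "(\<Sum>x\<in>X. c' x * M x e') = c' x0 * M x0 e' + (\<Sum>x\<in>X'. c x * M x e')" for e'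
    proof -
      have "(\<Sum>x\<in>X'. c' x * M x e') = (\<Sum>x\<in>X'. c x * M x e')"
        using X'(4) by (intro sum.cong) (auto simp: c'_def)
      then show ?thesis unfolding X'(3) using X' by simp
    qed
    have "(\<Sum>x\<in>X. c' x * M x e) = 0" unfolding sum' by (simp add: c'_def x0)
    moreover have "(\<Sum>x\<in>X. c' x * M x e') = 0" if "e' \<in> E" for e'
    proof -
      have "0 = (\<Sum>x\<in>X'. c x * (M x e' - M x e / M x0 e * M x0 e'))" using c that by simp
      also have "\<dots> = (\<Sum>x\<in>X'. c x * M x e') - (\<Sum>x\<in>X'. c x * M x e) / M x0 e * M x0 e'"
        by (simp add: sum_subtractf sum_distrib_right sum_divide_distrib right_diff_distrib mult.assoc)
      finally show ?thesis unfolding sum' by (simp add: c'_def)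
    qed
    moreover have "\<exists>x\<in>X. c' x \<noteq> 0" using c(1) X' by (auto simp: c'_def)
    ultimately show ?thesis by blast
  qed
qed

text \<open>A countable set has only countably many finite subsets, so infinitely many of the
  vectors share one support \<open>F\<close>, and more than \<open>card F\<close> vectors supported
  in \<open>F\<close> are dependent. Zero coefficients are discarded at the end.\<close>

lemma uncountable_family_dependent:
  fixes M :: "'a \<Rightarrow> 'e \<Rightarrow> 'f::field"
  assumes "uncountable A" "countable (UNIV :: 'e set)" "\<And>a. a \<in> A \<Longrightarrow> finite {e. M a e \<noteq> 0}"
  obtains X c where "finite X" "X \<subseteq> A" "X \<noteq> {}" "\<forall>x\<in>X. c x \<noteq> 0" "\<forall>e. (\<Sum>x\<in>X. c x * M x e) = 0"
proof -
  let ?S = "\<lambda>a. {e. M a e \<noteq> 0}"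
  have "countable {F :: 'e set. finite F \<and> F \<subseteq> UNIV}"
    using assms(2) by (rule countable_Collect_finite_subset)
  moreover have "A \<subseteq> (\<Union>F\<in>{F. finite F \<and> F \<subseteq> UNIV}. {a \<in> A. ?S a = F})"
    using assms(3) by auto
  ultimately obtain F where F: "finite F" "uncountable {a \<in> A. ?S a = F}"
    using assms(1) countable_subset countable_UN by (smt (verit) mem_Collect_eq)
  then have "infinite {a \<in> A. ?S a = F}" using countable_finite by blast
  then obtain X0 where X0: "finite X0" "card X0 = Suc (card F)" "X0 \<subseteq> {a \<in> A. ?S a = F}"
    using infinite_arbitrarily_large by blast
  obtain c where c: "\<exists>x\<in>X0. c x \<noteq> 0" "\<forall>e\<in>F. (\<Sum>x\<in>X0. c x * M x e) = 0"
    using linear_system_nontrivial_solution[of F X0 M] F X0 by auto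
  have "(\<Sum>x\<in>X0. c x * M x e) = 0" for e
    by (cases "e \<in> F") (use c X0 in \<open>auto intro!: sum.neutral\<close>)
  moreover have "(\<Sum>x\<in>{x\<in>X0. c x \<noteq> 0}. c x * M x e) = (\<Sum>x\<in>X0. c x * M x e)" for e
    using X0 by (intro sum.mono_neutral_left) auto
  ultimately show thesis
    using X0 c by (intro that[of "{x\<in>X0. c x \<noteq> 0}" c]) auto
qed

text \<open>McCoy's theorem modulo \<open>I\<close>. By induction on the length of \<open>q\<close>,
  and for fixed \<open>q\<close> by descending induction on \<open>i\<close>, all of
  \<open>p_i q\<close> lies in \<open>I\<close>: coefficient \<open>i + n\<close> of
  \<open>p q\<close> shows this for the top term \<open>p_i q_n\<close>, and
  \<open>p_i (q - q_n T^n)\<close> is shorter. Every coefficient of \<open>q\<close> then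
  annihilates all coefficients of \<open>p\<close>, so \<open>ann\<close> applies.\<close>

lemma mccoy:
  fixes p q :: "'a::comm_ring_1 poly"
  assumes I: "is_ideal I" and ann: "\<And>u. (\<forall>j. u * coeff p j \<in> I) \<Longrightarrow> u \<in> I"
    and "\<forall>j. coeff (p * q) j \<in> I"
  shows "coeff q j \<in> I"
proof -
  have "\<forall>j. coeff q j \<in> I" if "\<forall>j\<ge>n. coeff q j = 0" "\<forall>j. coeff (p * q) j \<in> I" for n q
    using that
  proof (induction n arbitrary: q)
    case 0
    then show ?case using I by (simp add: idl.subspace_0)
  next
    case (Suc n)
    note q_top = Suc.prems(1) and pq = spec[OF Suc.prems(2)]
    have key: "\<forall>j. coeff p i * coeff q j \<in> I" if "i + d > degree p" for i d
      using that
    proof (induction d arbitrary: i)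
      case 0
      then show ?case using I by (simp add: coeff_eq_0 idl.subspace_0)
    next
      case (Suc d)
      have "coeff (p * q) (i + n) = (\<Sum>k\<le>i + n. coeff p k * coeff q (i + n - k))"
        by (simp add: coeff_mult)
      also have "\<dots> = coeff p i * coeff q n + (\<Sum>k\<in>{..i + n} - {i}. coeff p k * coeff q (i + n - k))"
        by (subst sum.remove[of _ i]) auto
      finally have top_eq: "coeff p i * coeff q n =
          coeff (p * q) (i + n) - (\<Sum>k\<in>{..i + n} - {i}. coeff p k * coeff q (i + n - k))" by simp
      have "(\<Sum>k\<in>{..i + n} - {i}. coeff p k * coeff q (i + n - k)) \<in> I"
      proof (rule idl.subspace_sum[OF I])
        fix k assume k: "k \<in> {..i + n} - {i}"
        show "coeff p k * coeff q (i + n - k) \<in> I"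
        proof (cases "k > i")
          case True
          then show ?thesis using Suc.IH[of k] Suc.prems by simp
        next
          case False
          then have "coeff q (i + n - k) = 0" using k q_top by simp
          then show ?thesis using I by (simp add: idl.subspace_0)
        qed
      qed
      then have top: "coeff p i * coeff q n \<in> I"
        unfolding top_eq by (rule idl.subspace_diff[OF I pq])
      define q' where "q' = smult (coeff p i) (q - monom (coeff q n) n)"
      have mon: "coeff (monom (coeff p i * coeff q n) n * r) j \<in> I" for r j
        using top I by (simp add: coeff_monom_mult idl.subspace_0 is_ideal_scale_right)
      have q'_eq: "smult (coeff p i) q = q' + monom (coeff p i * coeff q n) n"
        by (simp add: q'_def smult_diff_right smult_monom)
      have q'_I: "\<forall>j. coeff q' j \<in> I"
      proof (rule \<open>\<And>q. \<lbrakk>\<forall>j\<ge>n. coeff q j = 0; \<forall>j. coeff (p * q) j \<in> I\<rbrakk> \<Longrightarrow> \<forall>j. coeff q j \<in> I\<close>)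
        show "\<forall>j\<ge>n. coeff q' j = 0"
        proof (intro allI impI)
          fix j assume "n \<le> j"
          then show "coeff q' j = 0"
            using q_top by (cases "j = n") (auto simp: q'_def)
        qed
        show "\<forall>j. coeff (p * q') j \<in> I"
        proof
          fix j
          have "p * q' = smult (coeff p i) (p * q) - monom (coeff p i * coeff q n) n * p"
            by (simp add: q'_def smult_diff_right smult_monom algebra_simps)
          then have "coeff (p * q') j = coeff p i * coeff (p * q) j -
              coeff (monom (coeff p i * coeff q n) n * p) j" by simp
          then show "coeff (p * q') j \<in> I"
            using idl.subspace_diff[OF I idl.subspace_scale[OF I pq] mon] by simp
        qed
      qed
      have coeff_eq: "coeff p i * coeff q j = coeff q' j + coeff (monom (coeff p i * coeff q n) n) j" for j
        using arg_cong[OF q'_eq, of "\<lambda>r. coeff r j"] by simp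
      show ?case
      proof
        fix j
        have "coeff (monom (coeff p i * coeff q n) n) j \<in> I" using mon[of 1 j] by simp
        then show "coeff p i * coeff q j \<in> I"
          by (subst coeff_eq) (rule idl.subspace_add[OF I spec[OF q'_I]])
      qed
    qed
    show ?case
    proof
      fix j
      have "coeff q j * coeff p i \<in> I" for i
        using key[of i "Suc (degree p)"] by (simp add: mult.commute[of "coeff q j"])
      then show "coeff q j \<in> I" using ann by blast
    qed
  qed
  from this[of "Suc (degree q)" q] show ?thesis using assms(3) by (simp add: coeff_eq_0)
qed

definition const :: "complex \<Rightarrow> 'v cpoly" where
  "const c = Poly_Mapping.single 0 c"

lemma const_simps: "const (a + b) = const a + const b" "const (a - b) = const a - const b"
  "const (a * b) = const a * const b" "const 0 = 0" "const 1 = 1" "const (- a) = - const a"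
  by (simp_all add: const_def single_add single_diff mult_single single_uminus)

lemma const_prod: "const (prod f A) = (\<Prod>x\<in>A. const (f x))"
  by (induction A rule: infinite_finite_induct) (simp_all add: const_simps)

lemma homogeneous_const [simp]: "homogeneous 0 (const c)"
  by (simp add: const_def)

lemma const_mult_eq_cscale: "const c * p = cscale c p"
  by (simp add: const_def cscale_def)

lemma lookup_const_mult: "Poly_Mapping.lookup (const c * p) m = c * Poly_Mapping.lookup p m"
  using lookup_cscale[of c p m] by (simp add: cscale_def const_def)

lemma const_mult_memD:
  assumes "is_ideal I" "const c * p \<in> I" "c \<noteq> 0" shows "p \<in> I"
proof -
  have "const (inverse c) * (const c * p) \<in> I" using assms by (simp add: idl.subspace_scale)
  moreover have "const (inverse c) * (const c * p) = p"
    using assms(3) by (simp add: mult.assoc[symmetric] flip: const_simps(3)) (simp add: const_simps)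
  ultimately show ?thesis by simp
qed

lemma countable_exponents: "countable (UNIV :: ('v::finite \<Rightarrow>\<^sub>0 nat) set)"
proof -
  have "(UNIV :: ('v \<Rightarrow>\<^sub>0 nat) set) = (\<Union>k. {m. mon_degree m = k})" by auto
  also have "countable \<dots>" using finite_mon_degree by (auto intro: countable_finite)
  finally show ?thesis .
qed

lemma smult_mult_add:
  fixes L :: "'a::comm_ring_1 poly"
  shows "smult a D * (L * q + [:r:]) = smult a ((L * D) * q) + smult (a * r) D"
  by (simp add: distrib_left smult_add_right mult_ac)

text \<open>
  Let \<open>W(T) = w\<^sub>0 + w\<^sub>1 T + \<dots>\<close>. If \<open>W(l)\<close> kills \<open>v \<notin> I\<close> modulo \<open>I\<close>, then
  \<open>v W(T) = (T - l) q(T)\<close> modulo \<open>I\<close>. For uncountably many \<open>l\<close> the polynomials \<open>q\<close> are linearly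
  dependent, and clearing the denominators \<open>T - l\<close> in \<open>\<Sum> c q = W \<Sum> c v/(T - l)\<close> gives a nonzero
  polynomial that kills \<open>W\<close> modulo \<open>I\<close>; now apply McCoy's theorem.
\<close>

lemma countable_bad_specializations:
  fixes ws :: "'v::finite cpoly list"
  assumes I: "is_ideal I" and ann: "annih ws I \<subseteq> I"
  shows "countable {l. \<not> nzd_mod I (poly (Poly ws) (const l))}"
proof (rule ccontr)
  let ?A = "{l. \<not> nzd_mod I (poly (Poly ws) (const l))}"
  assume unc: "uncountable ?A"
  define P where "P = Poly ws"
  have "\<forall>l\<in>?A. \<exists>v. poly P (const l) * v \<in> I \<and> v \<notin> I" by (auto simp: nzd_mod_def P_def)
  then obtain v where v: "\<And>l. l \<in> ?A \<Longrightarrow> poly P (const l) * v l \<in> I" "\<And>l. l \<in> ?A \<Longrightarrow> v l \<notin> I"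
    by metis
  define q where "q l = synthetic_div (smult (v l) P) (const l)" for l
  have q: "smult (v l) P = [:- const l, 1:] * q l + [:v l * poly P (const l):]" for l
    using synthetic_div_correct'[of "const l" "smult (v l) P"] by (simp add: q_def)
  have "countable (UNIV :: (nat \<times> ('v \<Rightarrow>\<^sub>0 nat)) set)"
    using countable_SIGMA[of "UNIV :: nat set" "\<lambda>_. UNIV :: ('v \<Rightarrow>\<^sub>0 nat) set"] countable_exponents
    by auto
  moreover have "finite {e. (case e of (j, m) \<Rightarrow> Poly_Mapping.lookup (coeff (q l) j) m) \<noteq> 0}" for l
  proof (rule finite_subset)
    show "{e. (case e of (j, m) \<Rightarrow> Poly_Mapping.lookup (coeff (q l) j) m) \<noteq> 0} \<subseteq>
        (SIGMA j:{..degree (q l)}. Poly_Mapping.keys (coeff (q l) j))"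
      by (auto simp: in_keys_iff intro: le_degree)
  qed auto
  ultimately obtain X c where X: "finite X" "X \<subseteq> ?A" "X \<noteq> {}" "\<forall>l\<in>X. c l \<noteq> 0"
    and dep: "\<forall>e. (\<Sum>l\<in>X. c l * (case e of (j, m) \<Rightarrow> Poly_Mapping.lookup (coeff (q l) j) m)) = 0"
    by (rule uncountable_family_dependent[OF unc])
  have dep': "(\<Sum>l\<in>X. smult (const (c l)) (q l)) = 0"
  proof (rule poly_eqI, rule poly_mapping_eqI)
    fix j m
    show "Poly_Mapping.lookup (coeff (\<Sum>l\<in>X. smult (const (c l)) (q l)) j) m =
        Poly_Mapping.lookup (coeff 0 j) m"
      using dep[rule_format, of "(j, m)"] by (simp add: coeff_sum lookup_sum lookup_const_mult)
  qed
  define D where "D l = (\<Prod>m\<in>X - {l}. [:- const m, 1 :: 'v cpoly:])" for l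
  define s where "s = (\<Sum>l\<in>X. smult (const (c l) * v l) (D l))"
  have "P * s = (\<Sum>l\<in>X. smult (const (c l)) (D l) * smult (v l) P)"
    by (simp add: s_def sum_distrib_left mult.commute)
  also have "\<dots> = (\<Sum>l\<in>X. smult (const (c l)) (([:- const l, 1:] * D l) * q l) +
      smult (const (c l) * (v l * poly P (const l))) (D l))"
    unfolding q by (intro sum.cong refl smult_mult_add)
  also have "\<dots> = (\<Sum>l\<in>X. smult (const (c l)) ((\<Prod>m\<in>X. [:- const m, 1:]) * q l)) +
      (\<Sum>l\<in>X. smult (const (c l) * (v l * poly P (const l))) (D l))"
    unfolding sum.distrib D_def using X(1)
    by (intro arg_cong2[where f = "(+)"] sum.cong refl) (simp add: prod.remove)
  also have "(\<Sum>l\<in>X. smult (const (c l)) ((\<Prod>m\<in>X. [:- const m, 1:]) * q l)) =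
      (\<Prod>m\<in>X. [:- const m, 1:]) * (\<Sum>l\<in>X. smult (const (c l)) (q l))"
    by (simp add: sum_distrib_left)
  finally have Ps: "P * s = (\<Sum>l\<in>X. smult (const (c l) * (v l * poly P (const l))) (D l))"
    by (simp add: dep')
  have "coeff (P * s) j \<in> I" for j
    unfolding Ps coeff_sum coeff_smult
  proof (rule idl.subspace_sum[OF I])
    fix l assume "l \<in> X"
    then have "poly P (const l) * v l \<in> I" using v(1) X by blast
    then have "const (c l) * (v l * poly P (const l)) \<in> I"
      using idl.subspace_scale[OF I] by (simp add: mult.commute[of "v l"])
    then show "const (c l) * (v l * poly P (const l)) * coeff (D l) j \<in> I"
      using is_ideal_scale_right[OF I] by blast
  qed
  moreover have "u \<in> I" if u: "\<forall>j. u * coeff P j \<in> I" for u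
  proof -
    have "u * w \<in> I" if "w \<in> set ws" for w
    proof -
      from that obtain j where "j < length ws" "w = ws ! j" by (auto simp: in_set_conv_nth)
      then have "coeff P j = w" by (simp add: P_def nth_default_def)
      then show ?thesis using u by metis
    qed
    then show ?thesis using ann by (auto simp: annih_def)
  qed
  ultimately have s_I: "coeff s j \<in> I" for j using mccoy[OF I] by blast
  obtain l where l: "l \<in> X" using X by blast
  \<comment> \<open>For \<open>m\<close> in \<open>X\<close> other than \<open>l\<close>, the
    product \<open>D m\<close> vanishes at \<open>l\<close>. So this value is a nonzero constant
    times \<open>v l\<close>, against \<open>v l \<notin> I\<close>.\<close>
  have "poly s (const l) \<in> I" unfolding poly_altdef
    using s_I I by (intro idl.subspace_sum is_ideal_scale_right) auto
  also have "poly s (const l) = (\<Sum>m\<in>X. const (c m) * v m * poly (D m) (const l))"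
    by (simp add: s_def poly_sum)
  also have "\<dots> = (\<Sum>m\<in>X. if m = l then const (c l) * v l * poly (D l) (const l) else 0)"
  proof (intro sum.cong refl)
    fix m assume "m \<in> X"
    have "poly (D m) (const l) = 0" if "m \<noteq> l"
      unfolding D_def poly_prod using that l X(1) by (intro prod_zero) auto
    then show "const (c m) * v m * poly (D m) (const l) =
        (if m = l then const (c l) * v l * poly (D l) (const l) else 0)" by auto
  qed
  also have "\<dots> = const (c l * (\<Prod>m\<in>X - {l}. l - m)) * v l"
    using l X(1) by (simp add: D_def poly_prod const_simps const_prod mult_ac)
  finally have "const (c l * (\<Prod>m\<in>X - {l}. l - m)) * v l \<in> I" .
  moreover have "c l * (\<Prod>m\<in>X - {l}. l - m) \<noteq> 0" using X l by simp
  ultimately have "v l \<in> I" by (rule const_mult_memD[OF I])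
  then show False using v(2) l X by blast
qed

text \<open>From a \<open>u\<close> outside \<open>I\<close> killed by the powers one builds a
  multiple \<open>r * u\<close> outside \<open>I\<close> killed by the \<open>w\<close> themselves,
  treating one \<open>w\<close> at a time: take the least \<open>t\<close> with
  \<open>r * u * w ^ t\<close> in \<open>I\<close> and multiply by
  \<open>w ^ (t - 1)\<close>.\<close>

lemma annih_powers:
  fixes ws :: "'a::comm_ring_1 list" and N :: "'a \<Rightarrow> nat"
  assumes I: "is_ideal I" and ann: "annih ws I \<subseteq> I"
  shows "annih (map (\<lambda>w. w ^ N w) ws) I \<subseteq> I"
proof (rule ccontr)
  assume "\<not> ?thesis"
  then obtain u where u: "u \<notin> I" "\<forall>w\<in>set ws. u * w ^ N w \<in> I" by (auto simp: annih_def)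
  have "\<exists>r. r * u \<notin> I \<and> (\<forall>w\<in>set vs. r * u * w \<in> I)" if "set vs \<subseteq> set ws" for vs
    using that
  proof (induction vs)
    case Nil
    then show ?case using u by (intro exI[of _ 1]) auto
  next
    case (Cons w vs)
    then obtain r where r: "r * u \<notin> I" "\<forall>w\<in>set vs. r * u * w \<in> I" by auto
    define t where "t = (LEAST t. r * u * w ^ t \<in> I)"
    have "r * (u * w ^ N w) \<in> I"
      using idl.subspace_scale[OF I, of "u * w ^ N w" r] u Cons.prems by simp
    then have t: "r * u * w ^ t \<in> I"
      using LeastI[of "\<lambda>t. r * u * w ^ t \<in> I" "N w"] by (simp add: t_def mult.assoc)
    with r have "t \<noteq> 0" by (auto intro: ccontr)
    then obtain t' where t': "t = Suc t'" by (cases t) auto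
    then have "r * u * w ^ t' \<notin> I" using not_less_Least[of t' "\<lambda>t. r * u * w ^ t \<in> I"] t_def by auto
    moreover have "w ^ t' * (r * u * x) \<in> I" if "x \<in> set (w # vs)" for x
    proof (cases "x \<in> set vs")
      case True
      then show ?thesis using idl.subspace_scale[OF I] r(2) by blast
    next
      case False
      then show ?thesis using t that by (simp add: t' mult_ac)
    qed
    ultimately show ?case by (intro exI[of _ "w ^ t' * r"]) (simp add: mult_ac)
  qed
  from this[of ws] ann show False by (auto simp: annih_def)
qed

section \<open>Homogeneous non-zero-divisors in spans and ideals\<close>

lemma specialization_homogeneous:
  "\<forall>w\<in>set ws. homogeneous e w \<Longrightarrow> homogeneous e (poly (Poly ws) (const l))"
proof (induction ws)
  case (Cons w ws)
  then show ?case
    using homogeneous_mult[OF homogeneous_const, of e "poly (Poly ws) (const l)" l]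
    by (auto intro!: homogeneous_add)
qed simp

lemma specialization_span: "poly (Poly ws) (const l) \<in> cvs.span (set ws)"
proof (induction ws)
  case (Cons w ws)
  then have "cscale l (poly (Poly ws) (const l)) \<in> cvs.span (set (w # ws))"
    using cvs.span_mono[of "set ws" "set (w # ws)"] by (intro cvs.span_scale) auto
  then show ?case
    using cvs.span_add[OF cvs.span_base[of w "set (w # ws)"]] by (simp add: const_mult_eq_cscale)
qed (simp add: cvs.span_zero)

lemma cvs_span_subset_ideal_gen: "cvs.span A \<subseteq> ideal_gen A"
  by (intro cvs.span_minimal ideal_gen_superset is_ideal_cvs_subspace is_ideal_ideal_gen)

text \<open>The members \<open>w_0 + l w_1 + l^2 w_2 + ...\<close> of the span are forms of degree
  \<open>e\<close>, and only countably many \<open>l\<close> are bad for \<open>I\<close> or for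
  \<open>K\<close>. Two ideals are treated at once because the exchange in
  \<open>HP_annih_regular\<close> needs one element for two sequences.\<close>

lemma exists_nzd_in_span:
  fixes ws :: "'v::finite cpoly list"
  assumes ws: "\<forall>w\<in>set ws. homogeneous e w" and I: "is_ideal I" "annih ws I \<subseteq> I"
    and K: "is_ideal K" "annih ws K \<subseteq> K"
  obtains x where "x \<in> cvs.span (set ws)" "homogeneous e x" "nzd_mod I x" "nzd_mod K x"
proof -
  have "countable ({l. \<not> nzd_mod I (poly (Poly ws) (const l))} \<union>
      {l. \<not> nzd_mod K (poly (Poly ws) (const l))})"
    using countable_bad_specializations I K by blast
  moreover have "uncountable (UNIV :: complex set)" using uncountable_UNIV_complex .
  ultimately obtain l where
    "nzd_mod I (poly (Poly ws) (const l))" "nzd_mod K (poly (Poly ws) (const l))"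
    by (metis (no_types, lifting) UNIV_eq_I UnCI mem_Collect_eq)
  then show thesis using that specialization_span specialization_homogeneous[OF ws] by blast
qed

text \<open>Generators of different degrees are first raised to powers of the common degree
  \<open>L\<close>; by \<open>annih_powers\<close> this keeps the annihilators trivial.\<close>

lemma exists_nzd_in_ideal:
  fixes ws :: "'v::finite cpoly list"
  assumes ws: "\<forall>w\<in>set ws. pos_homog w" and I: "is_ideal I" "annih ws I \<subseteq> I"
    and K: "is_ideal K" "annih ws K \<subseteq> K"
  obtains x where "x \<in> ideal_gen (set ws)" "pos_homog x" "nzd_mod I x" "nzd_mod K x"
proof -
  obtain d where d: "\<And>w. w \<in> set ws \<Longrightarrow> d w > 0 \<and> homogeneous (d w) w"
    using ws unfolding pos_homog_def by metis
  define L where "L = prod d (set ws)"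
  have L: "L > 0" using d by (auto simp: L_def intro!: prod_pos)
  define vs where "vs = map (\<lambda>w. w ^ (L div d w)) ws"
  have vs_hom: "\<forall>w\<in>set vs. homogeneous L w"
  proof
    fix v assume "v \<in> set vs"
    then obtain w where w: "w \<in> set ws" "v = w ^ (L div d w)" by (auto simp: vs_def)
    then have "d w * (L div d w) = L" by (simp add: L_def dvd_prodI)
    then show "homogeneous L v" using homogeneous_power[of "d w" w "L div d w"] d w by simp
  qed
  obtain x where x: "x \<in> cvs.span (set vs)" "homogeneous L x" "nzd_mod I x" "nzd_mod K x"
    by (rule exists_nzd_in_span[OF vs_hom I(1) _ K(1)])
      (use annih_powers[OF I] annih_powers[OF K] vs_def in auto)
  have "set vs \<subseteq> ideal_gen (set ws)"
  proof
    fix v assume "v \<in> set vs"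
    then obtain w where w: "w \<in> set ws" "v = w ^ (L div d w)" by (auto simp: vs_def)
    have "d w \<le> L" "d w > 0" using d w L by (auto simp: L_def intro!: dvd_imp_le dvd_prodI)
    then have "L div d w > 0" by (simp add: div_greater_zero_iff)
    then have "v = w * w ^ (L div d w - 1)" using w by (simp add: power_eq_if)
    then show "v \<in> ideal_gen (set ws)" using w by (simp add: is_ideal_scale_right ideal_gen_base)
  qed
  then have "x \<in> ideal_gen (set ws)"
    using x(1) cvs.span_minimal[OF _ is_ideal_cvs_subspace[OF is_ideal_ideal_gen]] by blast
  then show thesis using that x L by (auto simp: pos_homog_def)
qed

section \<open>Rees's theorem on annihilators modulo regular sequences\<close>

text \<open>The core of Rees's theorem. As \<open>y\<close> lies in \<open>(ws)\<close>, an element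
  \<open>u\<close> of \<open>(c + xS) : (ws)\<close> gives \<open>y u = x v\<close> modulo
  \<open>c\<close>, and this \<open>v\<close> kills \<open>(ws)\<close> modulo
  \<open>c + yS\<close>: from \<open>u w = x s\<close> modulo \<open>c\<close> follows
  \<open>x (v w - y s) = 0\<close> modulo \<open>c\<close>, and \<open>x\<close> cancels. Exchanging
  \<open>x\<close> and \<open>y\<close> gives the equality used in
  \<open>HP_annih_exchange\<close>.\<close>

lemma mulsum_annih_swap:
  fixes c :: "'a::comm_ring_1 set"
  assumes c: "is_ideal c" and x: "nzd_mod c x" and y: "y \<in> ideal_gen (set ws)"
  shows "mulsum c y (annih ws (adjoin c x)) \<subseteq> mulsum c x (annih ws (adjoin c y))"
proof
  fix z assume "z \<in> mulsum c y (annih ws (adjoin c x))"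
  then obtain p u where u: "p \<in> c" "u \<in> annih ws (adjoin c x)" "z = p + y * u" by (elim mulsum_cases)
  have "u * y \<in> adjoin c x" using annih_gens[OF is_ideal_adjoin[OF c] u(2) y] .
  then obtain p' v where v: "p' \<in> c" "u * y = p' + x * v" by (elim adjoin_cases)
  have "v \<in> annih ws (adjoin c y)" unfolding annih_def
  proof (intro CollectI ballI)
    fix w assume w: "w \<in> set ws"
    then have "u * w \<in> adjoin c x" using u(2) by (simp add: annih_def)
    then obtain p'' s where s: "p'' \<in> c" "u * w = p'' + x * s" by (elim adjoin_cases)
    have "x * (v * w - y * s) = w * (x * v) - y * (x * s)" by (simp add: algebra_simps)
    also have "\<dots> = w * (u * y - p') - y * (u * w - p'')" using v s by simp
    also have "\<dots> = y * p'' - w * p'" by (simp add: algebra_simps)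
    also have "\<dots> \<in> c" using v s c by (intro idl.subspace_diff idl.subspace_scale)
    finally have "v * w - y * s \<in> c" using x by (simp add: nzd_mod_def)
    from adjoin_mem[OF this, of y s] show "v * w \<in> adjoin c y" by simp
  qed
  moreover have "z = (p + p') + x * v" using u v by (simp add: algebra_simps)
  ultimately show "z \<in> mulsum c x (annih ws (adjoin c y))"
    using mulsum_mem[OF idl.subspace_add[OF c u(1) v(1)]] by simp
qed

lemma mulsum_adjoin_swap:
  fixes c :: "'a::comm_ring_1 set"
  assumes "is_ideal c" shows "mulsum c y (adjoin c x) \<subseteq> mulsum c x (adjoin c y)"
proof
  fix z assume "z \<in> mulsum c y (adjoin c x)"
  then obtain p p' q where *: "p \<in> c" "p' \<in> c" "z = p + y * (p' + x * q)"
    by (auto elim!: mulsum_cases adjoin_cases)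
  then have "(p + y * p') + x * (y * q) \<in> mulsum c x (adjoin c y)"
    using assms by (intro mulsum_mem idl.subspace_add idl.subspace_scale adjoin_self_mult)
  then show "z \<in> mulsum c x (adjoin c y)" using * by (simp add: algebra_simps)
qed

text \<open>By the two swap lemmas, the quotient of \<open>c + y ((c + xS) : (ws))\<close> by
  \<open>c + y (c + xS)\<close> is symmetric in \<open>x\<close> and \<open>y\<close>. By
  \<open>HP_shift\<close> its series is the left-hand side, shifted by the degree \<open>e\<close>
  of \<open>y\<close>; read with \<open>x\<close> in place of \<open>y\<close> it is the right-hand
  side.\<close>

lemma HP_annih_exchange:
  fixes c :: "'v::finite cpoly set"
  assumes c: "homog_ideal c" and x: "homogeneous d x" "nzd_mod c x" "x \<in> ideal_gen (set ws)"
    and y: "homogeneous e y" "nzd_mod c y" "y \<in> ideal_gen (set ws)"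
    and ws: "\<forall>w\<in>set ws. pos_homog w"
  shows "fps_X ^ e * HP (annih ws (adjoin c x)) (adjoin c x) =
    fps_X ^ d * HP (annih ws (adjoin c y)) (adjoin c y)"
proof -
  have ic: "is_ideal c" using c homog_idealD by blast
  have shift: "HP (mulsum c y (annih ws (adjoin c x))) (mulsum c y (adjoin c x)) =
      fps_X ^ e * HP (annih ws (adjoin c x)) (adjoin c x)"
    if "homogeneous d x" "homogeneous e y" "nzd_mod c y" for x y d e
  proof (rule HP_shift[OF c _ _ _ that(2)])
    show "homog_ideal (adjoin c x)" using homog_ideal_adjoin[OF c that(1)] .
    then show "homog_ideal (annih ws (adjoin c x))"
      using ws by blast
    show "adjoin c x \<subseteq> annih ws (adjoin c x)" using annih_superset ic by blast
    fix u assume "y * u \<in> mulsum c y (adjoin c x)"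
    then obtain p q where pq: "p \<in> c" "q \<in> adjoin c x" "y * u = p + y * q" by (elim mulsum_cases)
    then have "y * (u - q) \<in> c" by (simp add: algebra_simps)
    then have "u - q \<in> adjoin c x" using that(3) adjoin_superset by (auto simp: nzd_mod_def)
    from idl.subspace_add[OF is_ideal_adjoin[OF ic] this pq(2)] show "u \<in> adjoin c x" by simp
  qed
  have "mulsum c y (annih ws (adjoin c x)) = mulsum c x (annih ws (adjoin c y))"
    using mulsum_annih_swap[OF ic] x y by blast
  moreover have "mulsum c y (adjoin c x) = mulsum c x (adjoin c y)"
    using mulsum_adjoin_swap[OF ic] by blast
  ultimately show ?thesis using shift[OF x(1) y(1,2)] shift[OF y(1) x(1,2)] by simp
qed

text \<open>
  The degree of a nonzero form of positive degree; on \<open>0\<close> it is an arbitrary positive number.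
\<close>

definition hdeg :: "'v::finite cpoly \<Rightarrow> nat" where
  "hdeg p = (SOME d. d > 0 \<and> homogeneous d p)"

lemma hdeg: assumes "pos_homog p" shows "hdeg p > 0" "homogeneous (hdeg p) p"
  using someI_ex[OF assms[unfolded pos_homog_def]] by (simp_all add: hdeg_def)

lemma nzd_imp_annih_subset:
  assumes "is_ideal I" "nzd_mod I x" "x \<in> ideal_gen (set ws)" shows "annih ws I \<subseteq> I"
  using annih_gens[OF assms(1) _ assms(3)] assms(2) by (auto simp: nzd_mod_def mult.commute)

text \<open>
  Both sides compute the Hilbert series of \<open>Ext\<^sup>k(S/I, S/b)\<close> up to a shift, where \<open>I\<close> is
  generated by \<open>ws\<close> and \<open>k\<close> is the common length. Exchange the last terms of both sequences for one
  generic element of \<open>I\<close>, and move that element to the front.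
\<close>

theorem HP_annih_regular:
  fixes b :: "'v::finite cpoly set"
  assumes ws: "\<forall>w\<in>set ws. pos_homog w" and b: "homog_ideal b" and len: "length cs = length gs"
    and cs: "\<forall>c\<in>set cs. pos_homog c \<and> c \<in> ideal_gen (set ws)" "regular_mod b cs"
    and gs: "\<forall>c\<in>set gs. pos_homog c \<and> c \<in> ideal_gen (set ws)" "regular_mod b gs"
  shows "fps_X ^ sum_list (map hdeg gs) * HP (annih ws (adjs b cs)) (adjs b cs) =
    fps_X ^ sum_list (map hdeg cs) * HP (annih ws (adjs b gs)) (adjs b gs)"
  using len b cs gs
proof (induction "length cs" arbitrary: b cs gs)
  case 0
  then show ?case by simp
next
  case (Suc n)
  obtain cs' c where c: "cs = cs' @ [c]" using Suc.hyps(2) by (cases cs rule: rev_cases) auto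
  obtain gs' g where g: "gs = gs' @ [g]" using Suc.hyps(2) Suc.prems(1) by (cases gs rule: rev_cases) auto
  let ?c = "adjs b cs'" and ?g = "adjs b gs'"
  have hom: "homog_ideal ?c" "homog_ideal ?g"
    using Suc.prems c g by (auto intro!: homog_ideal_adjs_pos)
  note id = hom[THEN homog_idealD(1)]
  have nzd: "nzd_mod ?c c" "nzd_mod ?g g" using Suc.prems c g by (auto simp: regular_mod_snoc)
  have "annih ws ?c \<subseteq> ?c" "annih ws ?g \<subseteq> ?g"
    using nzd_imp_annih_subset[OF id(1) nzd(1)] nzd_imp_annih_subset[OF id(2) nzd(2)]
      Suc.prems c g by auto
  then obtain x where x: "x \<in> ideal_gen (set ws)" "pos_homog x" "nzd_mod ?c x" "nzd_mod ?g x"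
    using exists_nzd_in_ideal[OF ws id(1) _ id(2)] by blast
  have "regular_mod b (x # cs')" "regular_mod b (x # gs')"
    using Suc.prems c g x regular_mod_rotate[OF Suc.prems(2) _ x(2), of cs']
      regular_mod_rotate[OF Suc.prems(2) _ x(2), of gs'] by (auto simp: regular_mod_snoc)
  moreover have "homog_ideal (adjoin b x)" using Suc.prems(2) hdeg(2)[OF x(2)] by blast
  ultimately have IH: "fps_X ^ sum_list (map hdeg gs') * HP (annih ws (adjoin ?c x)) (adjoin ?c x) =
    fps_X ^ sum_list (map hdeg cs') * HP (annih ws (adjoin ?g x)) (adjoin ?g x)"
    using Suc.hyps(1)[of cs' gs' "adjoin b x"] Suc.hyps(2) Suc.prems c g
    by (simp add: adjs_adjoin)
  let ?Q = "\<lambda>c x. HP (annih ws (adjoin c x)) (adjoin c x)"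
  have ex: "fps_X ^ hdeg x * ?Q ?c c = fps_X ^ hdeg c * ?Q ?c x"
    "fps_X ^ hdeg x * ?Q ?g g = fps_X ^ hdeg g * ?Q ?g x"
    using Suc.prems c g x nzd hom ws
    by (auto intro!: HP_annih_exchange simp: hdeg)
  \<comment> \<open>The degree of the auxiliary \<open>x\<close> enters on both sides and is
    cancelled at the end; real power series form an integral domain.\<close>
  have "fps_X ^ hdeg x * (fps_X ^ sum_list (map hdeg gs) * ?Q ?c c) =
      fps_X ^ (hdeg g + hdeg c) * (fps_X ^ sum_list (map hdeg gs') * ?Q ?c x)"
    using arg_cong[OF ex(1), of "\<lambda>z. fps_X ^ (sum_list (map hdeg gs') + hdeg g) * z"]
    by (simp add: g power_add mult_ac)
  also have "\<dots> = fps_X ^ (sum_list (map hdeg cs') + hdeg c) * (fps_X ^ hdeg g * ?Q ?g x)"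
    unfolding IH by (simp add: power_add mult_ac)
  also have "\<dots> = fps_X ^ hdeg x * (fps_X ^ sum_list (map hdeg cs) * ?Q ?g g)"
    unfolding ex(2)[symmetric] by (simp add: c power_add mult_ac)
  finally show ?case by (simp add: c g)
qed

text \<open>A regular sequence in \<open>(ws)\<close> can be prolonged as long as a longer one
  exists. Modulo the initial part of \<open>gs\<close> of the same length as \<open>cs\<close>, the
  next term of \<open>gs\<close> makes the annihilator trivial; \<open>HP_annih_regular\<close>
  transfers this to \<open>cs\<close>.\<close>

corollary annih_regular_subset:
  fixes b :: "'v::finite cpoly set"
  assumes ws: "\<forall>w\<in>set ws. pos_homog w" and b: "homog_ideal b" and len: "length cs < length gs"
    and cs: "\<forall>c\<in>set cs. pos_homog c \<and> c \<in> ideal_gen (set ws)" "regular_mod b cs"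
    and gs: "\<forall>c\<in>set gs. pos_homog c \<and> c \<in> ideal_gen (set ws)" "regular_mod b gs"
  shows "annih ws (adjs b cs) \<subseteq> adjs b cs"
proof -
  let ?gs = "take (length cs) gs"
  have sub: "set ?gs \<subseteq> set gs" by (rule set_take_subset)
  have hom: "homog_ideal (adjs b cs)" "homog_ideal (adjs b ?gs)"
    using b cs gs sub by (auto intro!: homog_ideal_adjs_pos)
  note id = hom[THEN homog_idealD(1)]
  have "nzd_mod (adjs b ?gs) (gs ! length cs)" using gs(2) len by (simp add: regular_mod_iff_nth)
  then have "annih ws (adjs b ?gs) \<subseteq> adjs b ?gs"
    using gs len by (intro nzd_imp_annih_subset[OF id(2)]) auto
  then have "annih ws (adjs b ?gs) = adjs b ?gs" using annih_superset[OF id(2)] by blast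
  moreover have "regular_mod b ?gs" using gs(2) by (simp add: regular_mod_iff_nth)
  ultimately have "fps_X ^ sum_list (map hdeg ?gs) * HP (annih ws (adjs b cs)) (adjs b cs) = 0"
    using HP_annih_regular[OF ws b _ cs, of ?gs] gs sub len id by (auto simp: HP_self)
  then have "HP (annih ws (adjs b cs)) (adjs b cs) = 0" by simp
  then show ?thesis
    using HP_eq_0_imp[OF homog_ideal_annih_pos[OF hom(1) ws] hom(1) annih_superset[OF id(1)]] by simp
qed

section \<open>The variables as a regular sequence\<close>

lemma lookup_var_mult:
  "Poly_Mapping.lookup (var i * p) (Poly_Mapping.single i 1 + m) = Poly_Mapping.lookup p m"
  "Poly_Mapping.lookup m i = 0 \<Longrightarrow> Poly_Mapping.lookup (var i * p) m = 0"
proof -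
  have eq: "var i * p = (\<Sum>m\<in>Poly_Mapping.keys p.
      Poly_Mapping.single (Poly_Mapping.single i 1 + m) (Poly_Mapping.lookup p m))"
    by (subst poly_mapping_eq_sum_single[of "Poly_Mapping.keys p" p])
      (simp_all add: sum_distrib_left var_def mult_single)
  have "Poly_Mapping.lookup (var i * p) (Poly_Mapping.single i 1 + m) =
      (\<Sum>m'\<in>Poly_Mapping.keys p. if m' = m then Poly_Mapping.lookup p m' else 0)"
    unfolding eq lookup_sum by (intro sum.cong) (auto simp: lookup_single when_def)
  then show "Poly_Mapping.lookup (var i * p) (Poly_Mapping.single i 1 + m) = Poly_Mapping.lookup p m"
    by (auto simp: in_keys_iff)
  show "Poly_Mapping.lookup (var i * p) m = 0" if "Poly_Mapping.lookup m i = 0"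
    unfolding eq lookup_sum using that
    by (intro sum.neutral) (auto simp: lookup_single when_def lookup_add)
qed

lemma single_add_diff:
  assumes "Poly_Mapping.lookup m i > 0"
  shows "Poly_Mapping.single i 1 + (m - Poly_Mapping.single i 1) = (m :: 'v \<Rightarrow>\<^sub>0 nat)"
  using assms by (intro poly_mapping_eqI) (auto simp: lookup_add lookup_minus lookup_single when_def)

text \<open>The ideal generated by the variables indexed by \<open>T\<close>, see
  \<open>adjs_vars\<close>, described by supports so that membership is tested monomial by
  monomial.\<close>

definition var_ideal :: "'v set \<Rightarrow> 'v cpoly set" where
  "var_ideal T = {p. \<forall>m\<in>Poly_Mapping.keys p. \<exists>i\<in>T. Poly_Mapping.lookup m i > 0}"

lemma nzd_mod_var:
  assumes "i \<notin> T" shows "nzd_mod (var_ideal T) (var i)"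
  unfolding nzd_mod_def var_ideal_def
proof (intro allI impI CollectI ballI)
  fix h m
  assume h: "var i * h \<in> {p. \<forall>m\<in>Poly_Mapping.keys p. \<exists>i\<in>T. Poly_Mapping.lookup m i > 0}"
    and m: "m \<in> Poly_Mapping.keys h"
  have "Poly_Mapping.single i 1 + m \<in> Poly_Mapping.keys (var i * h)"
    using m lookup_var_mult(1)[of i h m] by (simp add: in_keys_iff)
  then obtain j where j: "j \<in> T" "Poly_Mapping.lookup (Poly_Mapping.single i 1 + m) j > 0"
    using h by blast
  then have "Poly_Mapping.lookup m j > 0" using assms
    by (auto simp: lookup_add lookup_single when_def split: if_splits)
  then show "\<exists>j\<in>T. Poly_Mapping.lookup m j > 0" using j by blast
qed

lemma adjoin_var_ideal: "adjoin (var_ideal T) (var i) = var_ideal (insert i T)"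
proof
  show "adjoin (var_ideal T) (var i) \<subseteq> var_ideal (insert i T)"
  proof
    fix z assume "z \<in> adjoin (var_ideal T) (var i)"
    then obtain p q where pq: "p \<in> var_ideal T" "z = p + var i * q" by (elim adjoin_cases)
    show "z \<in> var_ideal (insert i T)" unfolding var_ideal_def
    proof (intro CollectI ballI)
      fix m assume "m \<in> Poly_Mapping.keys z"
      then have "Poly_Mapping.lookup p m \<noteq> 0 \<or> Poly_Mapping.lookup (var i * q) m \<noteq> 0"
        by (auto simp: pq in_keys_iff lookup_add)
      then show "\<exists>j\<in>insert i T. Poly_Mapping.lookup m j > 0"
        using pq(1) lookup_var_mult(2)[of m i q] by (auto simp: var_ideal_def in_keys_iff)
    qed
  qed
  show "var_ideal (insert i T) \<subseteq> adjoin (var_ideal T) (var i)"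
  proof
    fix p :: "'a cpoly" assume p: "p \<in> var_ideal (insert i T)"
    let ?K = "Poly_Mapping.keys p" and ?s = "\<lambda>m. Poly_Mapping.single m (Poly_Mapping.lookup p m)"
    define p1 where "p1 = (\<Sum>m\<in>{m\<in>?K. Poly_Mapping.lookup m i = 0}. ?s m)"
    define q where "q = (\<Sum>m\<in>{m\<in>?K. Poly_Mapping.lookup m i > 0}.
        Poly_Mapping.single (m - Poly_Mapping.single i 1) (Poly_Mapping.lookup p m))"
    have "p = (\<Sum>m\<in>?K. ?s m)" by (rule poly_mapping_eq_sum_single) auto
    also have "\<dots> = (\<Sum>m\<in>{m\<in>?K. Poly_Mapping.lookup m i = 0} \<union> {m\<in>?K. Poly_Mapping.lookup m i > 0}. ?s m)"
      by (intro sum.cong) auto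
    also have "\<dots> = p1 + (\<Sum>m\<in>{m\<in>?K. Poly_Mapping.lookup m i > 0}. ?s m)"
      unfolding p1_def by (intro sum.union_disjoint) auto
    also have "(\<Sum>m\<in>{m\<in>?K. Poly_Mapping.lookup m i > 0}. ?s m) = var i * q"
      unfolding q_def sum_distrib_left
      by (intro sum.cong) (auto simp: var_def mult_single single_add_diff[unfolded One_nat_def])
    finally have eq: "p = p1 + var i * q" .
    have "p1 \<in> var_ideal T" unfolding var_ideal_def
    proof (intro CollectI ballI)
      fix m assume "m \<in> Poly_Mapping.keys p1"
      then obtain m' where "m' \<in> ?K" "Poly_Mapping.lookup m' i = 0" "m \<in> Poly_Mapping.keys (?s m')"
        using keys_sum[of ?s] by (fastforce simp: p1_def)
      then have "m \<in> ?K" "Poly_Mapping.lookup m i = 0" by (auto split: if_splits)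
      then show "\<exists>i\<in>T. Poly_Mapping.lookup m i > 0" using p by (auto simp: var_ideal_def)
    qed
    then show "p \<in> adjoin (var_ideal T) (var i)" using eq adjoin_mem by metis
  qed
qed

lemma adjs_vars: "adjs {0} (map var vs) = var_ideal (set vs)"
proof (induction vs rule: rev_induct)
  case Nil
  then show ?case by (auto simp: var_ideal_def)
qed (simp add: adjoin_var_ideal)

lemma regular_mod_vars: "distinct vs \<Longrightarrow> regular_mod {0} (map var vs)"
  by (induction vs rule: rev_induct) (auto simp: regular_mod_snoc adjs_vars nzd_mod_var)

lemma var_ideal_UNIV: "p \<in> var_ideal UNIV \<longleftrightarrow> Poly_Mapping.lookup p 0 = 0"
proof -
  have "(\<exists>i. Poly_Mapping.lookup m i > 0) \<longleftrightarrow> m \<noteq> 0" for m :: "'v \<Rightarrow>\<^sub>0 nat"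
    by (auto simp: poly_mapping_eq_iff fun_eq_iff)
  then have "p \<in> var_ideal UNIV \<longleftrightarrow> 0 \<notin> Poly_Mapping.keys p" by (auto simp: var_ideal_def)
  then show ?thesis by (simp add: in_keys_iff)
qed

lemma pos_homog_lookup_0: "pos_homog p \<Longrightarrow> Poly_Mapping.lookup p 0 = 0"
  by (metis pos_homog_def homogeneous_def in_keys_iff mon_degree_zero less_numeral_extra(3))

lemma pos_homog_var [simp]: "pos_homog (var i)"
  using homogeneous_var by (auto simp: pos_homog_def)

lemma hdeg_eqI: "homogeneous d p \<Longrightarrow> d > 0 \<Longrightarrow> p \<noteq> 0 \<Longrightarrow> hdeg p = d"
  using hdeg homogeneous_unique unfolding pos_homog_def by metis

lemma var_nonzero [simp]: "var i \<noteq> 0"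
  unfolding var_def by (metis single_zero inj_single injD zero_neq_one lookup_single_eq lookup_zero)

lemma hdeg_var [simp]: "hdeg (var i) = 1"
  by (rule hdeg_eqI) auto

lemma homogeneous_0_eq_const:
  fixes p :: "'v::finite cpoly"
  assumes "homogeneous 0 p" shows "p = const (Poly_Mapping.lookup p 0)"
proof (rule poly_mapping_eqI)
  fix m :: "'v \<Rightarrow>\<^sub>0 nat"
  have "m = 0" if "mon_degree m = 0"
    using that by (intro poly_mapping_eqI) (auto simp: mon_degree_def)
  then show "Poly_Mapping.lookup p m = Poly_Mapping.lookup (const (Poly_Mapping.lookup p 0)) m"
    using assms by (cases "m \<in> Poly_Mapping.keys p")
      (auto simp: homogeneous_def const_def lookup_single when_def not_in_keys_iff_lookup_eq_zero)
qed

section \<open>Hilbert series of complete intersections\<close>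

lemma HP_var_ideal: "HP UNIV (var_ideal (UNIV :: 'v::finite set)) = 1"
proof (rule fps_ext)
  fix k
  let ?m = "var_ideal UNIV :: 'v cpoly set" and ?H = "Collect (homogeneous k) :: 'v cpoly set"
  obtain vs :: "'v list" where "set vs = UNIV" using finite_list[OF finite_class.finite_UNIV] by blast
  then have im: "is_ideal ?m" using is_ideal_adjs[of "{0}" "map var vs"] by (simp add: adjs_vars)
  show "fps_nth (HP UNIV ?m) k = fps_nth 1 k"
  proof (cases "k = 0")
    case True
    have qb: "quotient_basis (UNIV \<inter> ?H) (?m \<inter> ?H) {1}"
      unfolding quotient_basis_def
    proof (intro conjI allI impI ballI)
      show "{1} \<subseteq> UNIV \<inter> ?H" using True by simp
    next
      fix T :: "'v cpoly set" and u b
      assume T: "finite T \<and> T \<subseteq> {1} \<and> (\<Sum>b\<in>T. cscale (u b) b) \<in> ?m \<inter> ?H" and b: "b \<in> T"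
      then have "T = {1}" "b = 1" by auto
      then have "Poly_Mapping.lookup (cscale (u 1) (1 :: 'v cpoly)) 0 = 0"
        using T by (simp add: var_ideal_UNIV)
      then show "u b = 0" using \<open>b = 1\<close> by (simp add: lookup_cscale)
    next
      fix v :: "'v cpoly" assume "v \<in> UNIV \<inter> ?H"
      then have "v = const (Poly_Mapping.lookup v 0)" using True homogeneous_0_eq_const by auto
      then have "v - (\<Sum>b\<in>{1}. cscale (Poly_Mapping.lookup v 0) b) = 0"
        by (simp add: cscale_def const_def)
      also have "\<dots> \<in> ?m \<inter> ?H" using im by (simp add: idl.subspace_0)
      finally show "\<exists>T u. finite T \<and> T \<subseteq> {1} \<and> v - (\<Sum>b\<in>T. cscale (u b) b) \<in> ?m \<inter> ?H"
        by (intro exI[of _ "{1}"] exI[of _ "\<lambda>_. Poly_Mapping.lookup v 0"]) simp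
    qed
    have ss: "cvs.subspace (UNIV \<inter> ?H)" "fin_dim (UNIV \<inter> ?H)" "cvs.subspace (?m \<inter> ?H)"
        "?m \<inter> ?H \<subseteq> UNIV \<inter> ?H"
      using im by (auto intro: cvs_subspace_part fin_dim_part cvs_subspace_homogeneous
          fin_dim_homogeneous)
    have "quotient_dim (UNIV \<inter> ?H) (?m \<inter> ?H) = 1"
      using quotient_basis_card(2)[OF ss qb] quotient_dim_add_dim[OF ss] by simp
    then show ?thesis using True by (simp add: HP_nth)
  next
    case False
    then have "pos_homog p" if "p \<in> ?H" for p using that unfolding pos_homog_def by blast
    then have "?H \<subseteq> ?m" by (auto simp: var_ideal_UNIV pos_homog_lookup_0)
    then have "quotient_dim (UNIV \<inter> ?H) (?m \<inter> ?H) = quotient_dim (?m \<inter> ?H) (?m \<inter> ?H)"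
      by (simp add: Int_absorb1)
    also have "\<dots> = 0" using HP_self[OF im] HP_nth[of ?m ?m k] by simp
    finally show ?thesis using False by (simp add: HP_nth)
  qed
qed

text \<open>The exact sequence \<open>0 -> S/(I : x)(-e) -> S/I -> S/(I + xS) -> 0\<close>.\<close>

lemma HP_adjoin:
  assumes I: "homog_ideal I" and x: "homogeneous e x"
  shows "HP UNIV (adjoin I x) = HP UNIV I - fps_X ^ e * HP UNIV (annih [x] I)"
proof -
  note id = I[THEN homog_idealD(1)]
  have hom: "homog_ideal (annih [x] I)" using I x by (auto intro!: homog_ideal_annih)
  have "x * q \<in> I" if "q \<in> annih [x] I" for q using that by (simp add: annih_def mult.commute)
  then have "mulsum I x (annih [x] I) \<subseteq> I"
    using idl.subspace_add[OF id] by (auto elim!: mulsum_cases)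
  then have I_eq: "mulsum I x (annih [x] I) = I"
    using mulsum_superset[OF is_ideal_annih[OF id]] by blast
  have "HP (adjoin I x) I = fps_X ^ e * HP UNIV (annih [x] I)"
    unfolding adjoin_eq_mulsum
  \<comment> \<open>Rewriting \<open>I\<close> as \<open>I + x (I : x)\<close> exhibits
    \<open>(I + xS)/I\<close> as a shift of \<open>S/(I : x)\<close>.\<close>
  proof (subst (2) I_eq[symmetric], rule HP_shift[OF I _ hom _ x])
    fix u assume "x * u \<in> mulsum I x (annih [x] I)"
    then show "u \<in> annih [x] I" unfolding I_eq by (simp add: annih_def mult.commute)
  qed simp_all
  moreover have "HP UNIV I = HP UNIV (adjoin I x) + HP (adjoin I x) I"
    using id adjoin_superset by (intro HP_add) auto
  ultimately show ?thesis by simp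
qed

lemma HP_adjs_regular:
  assumes "homog_ideal b" "\<forall>x\<in>set xs. pos_homog x" "regular_mod b xs"
  shows "HP UNIV (adjs b xs) = HP UNIV b * prod_list (map (\<lambda>x. 1 - fps_X ^ hdeg x) xs)"
  using assms
proof (induction xs arbitrary: b)
  case (Cons x xs)
  have x: "homogeneous (hdeg x) x" using Cons.prems hdeg(2)[of x] by simp
  have "annih [x] b = b"
    using Cons.prems annih_superset[OF homog_idealD(1)[OF Cons.prems(1)], of "[x]"]
    by (auto simp: annih_def nzd_mod_def mult.commute)
  then have "HP UNIV (adjoin b x) = HP UNIV b * (1 - fps_X ^ hdeg x)"
    using HP_adjoin[OF Cons.prems(1) x] by (simp add: algebra_simps)
  then show ?case
    using Cons.IH[of "adjoin b x"] Cons.prems homog_ideal_adjoin[OF Cons.prems(1) x]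
    by (simp add: mult.assoc)
qed simp

text \<open>The formula for regular sequences is read backwards: the variables form a regular
  sequence whose quotient is the ground field, with series 1.\<close>

lemma HP_ring:
  "HP UNIV {0 :: 'v::finite cpoly} * (1 - fps_X) ^ CARD('v) = 1"
proof -
  obtain vs :: "'v list" where vs: "set vs = UNIV" "distinct vs"
    using finite_distinct_list[OF finite_class.finite_UNIV] by blast
  have "HP UNIV (var_ideal (set vs)) = HP UNIV {0 :: 'v cpoly} * (1 - fps_X) ^ length vs"
    using HP_adjs_regular[of "{0}" "map var vs"] regular_mod_vars[OF vs(2)]
    by (simp add: adjs_vars o_def map_replicate_const prod_list_replicate)
  then have "HP UNIV {0 :: 'v cpoly} * (1 - fps_X) ^ length vs = 1"
    by (simp only: vs(1) HP_var_ideal)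
  then show ?thesis using vs distinct_card[OF vs(2)] by simp
qed

section \<open>Generic regular sequences in a linear system\<close>

lemma homogeneous_span:
  assumes "\<forall>w\<in>A. homogeneous e w" "x \<in> cvs.span A" shows "homogeneous e x"
  using assms cvs.span_minimal[OF _ cvs_subspace_homogeneous, of A e] by blast

text \<open>The sequence grows greedily: while it is shorter than \<open>N\<close>,
  \<open>ann\<close> provides a generic non-zero-divisor in the span.\<close>

lemma exists_regular_in_span:
  fixes ws :: "'v::finite cpoly list"
  assumes ws: "\<forall>w\<in>set ws. homogeneous e w"
    and ann: "\<And>cs. length cs < N \<Longrightarrow> set cs \<subseteq> cvs.span (set ws) \<Longrightarrow> regular_mod {0} cs \<Longrightarrow>
      annih ws (adjs {0} cs) \<subseteq> adjs {0} cs"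
  obtains hs where "length hs = N" "set hs \<subseteq> cvs.span (set ws)" "regular_mod {0} hs"
proof -
  have "\<exists>hs. length hs = k \<and> set hs \<subseteq> cvs.span (set ws) \<and> regular_mod {0} hs" if "k \<le> N" for k
    using that
  proof (induction k)
    case (Suc k)
    then obtain hs where hs: "length hs = k" "set hs \<subseteq> cvs.span (set ws)" "regular_mod {0} hs" by auto
    have "annih ws (adjs {0} hs) \<subseteq> adjs {0} hs" using ann hs Suc.prems by simp
    then obtain x where "x \<in> cvs.span (set ws)" "nzd_mod (adjs {0} hs) x"
      using exists_nzd_in_span[OF ws, of "adjs {0} hs" "adjs {0} hs"] by auto
    then show ?case using hs by (intro exI[of _ "hs @ [x]"]) (auto simp: regular_mod_snoc)
  qed simp
  then show thesis using that by blast
qed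

text \<open>An element of the ideal of its predecessors that is regular modulo it forces 1 into that
  ideal. So each term lies outside the ideal, and hence outside the complex span, of the earlier
  ones. Counting independent forms later bounds the number of remaining generators.\<close>

lemma regular_mod_independent:
  assumes "regular_mod {0} hs" "adjs {0} hs \<noteq> UNIV"
  shows "distinct hs \<and> cvs.independent (set hs)"
  using assms
proof (induction hs rule: rev_induct)
  case (snoc x hs)
  let ?I = "adjs {0} hs"
  have id: "is_ideal ?I" by auto
  have proper: "?I \<noteq> UNIV" using snoc.prems(2) adjoin_superset[of ?I x] by auto
  have "x \<notin> ?I"
  proof
    assume "x \<in> ?I"
    then have "1 \<in> ?I" using snoc.prems(1) by (auto simp: regular_mod_snoc nzd_mod_def)
    then show False using ideal_eq_UNIV[OF id] proper by blast
  qed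
  moreover have "cvs.span (set hs) \<subseteq> ?I" using cvs_span_subset_ideal_gen by (simp add: adjs_zero)
  ultimately have "x \<notin> cvs.span (set hs)" by blast
  then show ?case using snoc.IH snoc.prems(1) proper cvs.span_base[of x "set hs"]
    by (auto simp: regular_mod_snoc cvs.independent_insert)
qed (simp add: cvs.independent_empty)

lemma span_extend_basis:
  assumes "cvs.independent H" "H \<subseteq> cvs.span F" "finite F"
  obtains B where "H \<subseteq> B" "finite B" "card B \<le> card F" "B \<subseteq> cvs.span F" "F \<subseteq> cvs.span B"
proof -
  obtain B where B: "H \<subseteq> B" "B \<subseteq> cvs.span F" "cvs.independent B" "cvs.span F \<subseteq> cvs.span B"
    by (rule cvs.maximal_independent_subset_extend[OF assms(2,1)])
  then show thesis
    using that cvs.independent_span_bound[OF assms(3) B(3) B(2)] cvs.span_superset[of F] by blast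
qed

section \<open>Colon ideals and saturation\<close>

text \<open>The hypotheses on \<open>xs\<close> make \<open>C\<close> saturated: factors from the
  irrelevant ideal are cancelled one at a time.\<close>

lemma mem_of_ideal_power_mult:
  assumes C: "is_ideal C" and xs: "set xs \<subseteq> irrelevant_ideal" "annih xs C \<subseteq> C"
    and v: "\<forall>a\<in>ideal_power irrelevant_ideal r. a * v \<in> C"
  shows "v \<in> C"
  using v
proof (induction r)
  case 0
  from bspec[OF this, of 1] show ?case by simp
next
  case (Suc r)
  have "b * v \<in> C" if b: "b \<in> ideal_power irrelevant_ideal r" for b
  proof -
    have "b * v \<in> annih xs C" unfolding annih_def
    proof (intro CollectI ballI)
      fix x assume "x \<in> set xs"
      then have "x * b \<in> ideal_power irrelevant_ideal (Suc r)"
        using xs(1) b by (auto simp: ideal_prod_def intro!: ideal_gen_base)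
      then show "b * v * x \<in> C" using Suc.prems by (auto simp: mult_ac)
    qed
    then show ?thesis using xs(2) by blast
  qed
  then show ?case using Suc.IH by blast
qed

lemma subset_saturation: "is_ideal J \<Longrightarrow> J \<subseteq> saturation J"
proof
  fix x assume "is_ideal J" "x \<in> J"
  then have "\<forall>a\<in>ideal_power irrelevant_ideal 0. a * x \<in> J" using idl.subspace_scale by blast
  then show "x \<in> saturation J" unfolding saturation_def by blast
qed

text \<open>For \<open>g\<close> in the saturation, a power of the irrelevant ideal carries
  \<open>g\<close> into \<open>(ws)\<close> and hence \<open>u * g\<close> into \<open>C\<close>; as
  \<open>C\<close> is saturated, \<open>u * g\<close> itself lies in \<open>C\<close>.\<close>

lemma annih_saturation_subset:
  assumes C: "is_ideal C" and xs: "set xs \<subseteq> irrelevant_ideal" "annih xs C \<subseteq> C"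
    and gs: "set gs \<subseteq> saturation (ideal_gen (set ws))"
  shows "annih ws C \<subseteq> annih gs C"
proof
  fix u assume u: "u \<in> annih ws C"
  show "u \<in> annih gs C" unfolding annih_def
  proof (intro CollectI ballI)
    fix g assume "g \<in> set gs"
    then obtain r where r: "\<forall>a\<in>ideal_power irrelevant_ideal r. a * g \<in> ideal_gen (set ws)"
      using gs by (auto simp: saturation_def)
    have "a * (u * g) \<in> C" if "a \<in> ideal_power irrelevant_ideal r" for a
      using annih_gens[OF C u, of "a * g"] r that by (simp add: mult.left_commute)
    then show "u * g \<in> C" using mem_of_ideal_power_mult[OF C xs] by blast
  qed
qed

section \<open>The projective Nullstellensatz\<close>

definition subst_poly :: "'v cpoly \<Rightarrow> complex poly \<Rightarrow> 'v cpoly" where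
  "subst_poly x p = poly (map_poly const p) x"

lemma subst_poly_0 [simp]: "subst_poly x 0 = 0"
  and subst_poly_pCons [simp]: "subst_poly x (pCons a p) = const a + x * subst_poly x p"
  by (simp_all add: subst_poly_def map_poly_pCons const_simps)

lemma subst_poly_add: "subst_poly x (p + q) = subst_poly x p + subst_poly x q"
  by (induction p q rule: poly_induct2) (simp_all add: const_simps algebra_simps)

lemma subst_poly_smult: "subst_poly x (smult c p) = const c * subst_poly x p"
  by (induction p) (simp_all add: const_simps algebra_simps)

lemma subst_poly_sum: "subst_poly x (\<Sum>a\<in>A. f a) = (\<Sum>a\<in>A. subst_poly x (f a))"
  by (induction A rule: infinite_finite_induct) (simp_all add: subst_poly_add)

lemma subst_poly_linear_mult: "subst_poly x ([:- r, 1:] * q) = (x - const r) * subst_poly x q"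
proof -
  have "[:- r, 1:] * q = smult (- r) q + pCons 0 q" by simp
  then show ?thesis
    by (simp only: subst_poly_add subst_poly_smult subst_poly_pCons const_simps) (simp add: algebra_simps)
qed

lemma subst_poly_prod: "subst_poly x (\<Prod>b\<in>B. [:- b, 1:]) = (\<Prod>b\<in>B. x - const b)"
proof (induction B rule: infinite_finite_induct)
  case (insert b B)
  then show ?case by (simp add: subst_poly_linear_mult del: mult_pCons_left)
qed (simp_all add: one_pCons const_simps del: pCons_one)

text \<open>Over the complex numbers \<open>p\<close> splits into linear factors, and each
  \<open>x - r\<close> is invertible modulo the proper ideal \<open>I\<close>.\<close>

lemma subst_poly_notin:
  assumes I: "is_ideal I" "1 \<notin> I" and unit: "\<And>a. 1 \<in> adjoin I (x - const a)" and "p \<noteq> 0"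
  shows "subst_poly x p \<notin> I"
  using \<open>p \<noteq> 0\<close>
proof (induction "degree p" arbitrary: p)
  case 0
  then obtain c where c: "p = [:c:]" "c \<noteq> 0" by (metis degree_0_id pCons_eq_0_iff)
  show ?case using const_mult_memD[OF I(1), of c 1] I(2) c by auto
next
  case (Suc n)
  have "\<not> constant (poly p)" using Suc.hyps(2) by (simp add: constant_degree)
  then obtain r where "poly p r = 0" using fundamental_theorem_of_algebra by blast
  then obtain q where q: "p = [:- r, 1:] * q" by (auto simp: poly_eq_0_iff_dvd elim: dvdE)
  then have "q \<noteq> 0" using Suc.prems by auto
  then have "n = degree q" using q Suc.hyps(2) degree_mult_eq[of "[:- r, 1:]" q] by auto
  then have IH: "subst_poly x q \<notin> I" using Suc.hyps(1) \<open>q \<noteq> 0\<close> by blast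
  obtain a u where au: "a \<in> I" "1 = a + (x - const r) * u" using unit[of r] by (elim adjoin_cases)
  show ?case
  proof
    assume "subst_poly x p \<in> I"
    then have "(x - const r) * subst_poly x q \<in> I" using q subst_poly_linear_mult by metis
    then have "a * subst_poly x q + u * ((x - const r) * subst_poly x q) \<in> I"
      using au(1) I(1) idl.subspace_add idl.subspace_scale is_ideal_scale_right by blast
    also have "a * subst_poly x q + u * ((x - const r) * subst_poly x q) =
        (a + (x - const r) * u) * subst_poly x q" by (simp add: algebra_simps)
    finally show False using IH au(2) by simp
  qed
qed

text \<open>
  If all \<open>x - a\<close> were invertible modulo \<open>I\<close>, their uncountably many inverses would be linearly
  dependent, so that \<open>x\<close> would be algebraic modulo \<open>I\<close>.
\<close>

lemma exists_proper_specialization: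
  fixes x :: "'v::finite cpoly"
  assumes I: "is_ideal I" "1 \<notin> I"
  shows "\<exists>a. 1 \<notin> adjoin I (x - const a)"
proof (rule ccontr)
  assume "\<not> ?thesis"
  then have unit: "\<And>a. 1 \<in> adjoin I (x - const a)" by blast
  then have "\<forall>a. \<exists>u. 1 - (x - const a) * u \<in> I" by (metis add_diff_cancel_right' adjoin_cases)
  then obtain u where u: "\<And>a. 1 - (x - const a) * u a \<in> I" by metis
  obtain X c where X: "finite X" "X \<noteq> {}" "\<forall>a\<in>X. c a \<noteq> 0"
    and dep: "\<forall>m. (\<Sum>a\<in>X. c a * Poly_Mapping.lookup (u a) m) = 0"
    by (rule uncountable_family_dependent[OF uncountable_UNIV_complex countable_exponents,
          of "\<lambda>a m. Poly_Mapping.lookup (u a) m"]) auto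
  have dep': "(\<Sum>a\<in>X. const (c a) * u a) = 0"
    using dep by (intro poly_mapping_eqI) (simp add: lookup_sum lookup_const_mult)
  \<comment> \<open>The numerator of the sum of \<open>c a / (T - a)\<close>. It is nonzero because
    at any \<open>a\<close> in \<open>X\<close> exactly one summand survives.\<close>
  define p where "p = (\<Sum>a\<in>X. smult (c a) (\<Prod>b\<in>X - {a}. [:- b, 1:]))"
  define D where "D a = (\<Prod>b\<in>X - {a}. x - const b)" for a
  obtain a where a: "a \<in> X" using X by blast
  have "poly p a = (\<Sum>a'\<in>X. if a' = a then c a * (\<Prod>b\<in>X - {a}. a - b) else 0)"
    unfolding p_def poly_sum
  proof (intro sum.cong refl)
    fix a' assume "a' \<in> X"
    have "(\<Prod>b\<in>X - {a'}. a - b) = 0" if "a' \<noteq> a" using that a X(1) by (intro prod_zero) auto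
    then show "poly (smult (c a') (\<Prod>b\<in>X - {a'}. [:- b, 1:])) a =
        (if a' = a then c a * (\<Prod>b\<in>X - {a}. a - b) else 0)" by (simp add: poly_prod)
  qed
  also have "\<dots> = c a * (\<Prod>b\<in>X - {a}. a - b)" using X(1) a by simp
  also have "\<dots> \<noteq> 0" using X a by simp
  finally have "p \<noteq> 0" by auto
  \<comment> \<open>Split \<open>1 = (1 - (x - a) u_a) + (x - a) u_a\<close>: the first parts lie in
    \<open>I\<close>, the second parts add up to a multiple of the combination that vanishes by
    \<open>dep'\<close>.\<close>
  have "subst_poly x p = (\<Sum>a\<in>X. const (c a) * D a)"
    by (simp add: p_def D_def subst_poly_sum subst_poly_smult subst_poly_prod)
  also have "\<dots> = (\<Sum>a\<in>X. const (c a) * D a * (1 - (x - const a) * u a)) +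
      (\<Sum>a\<in>X. const (c a) * ((x - const a) * D a) * u a)"
    unfolding sum.distrib[symmetric] by (intro sum.cong refl) (simp add: algebra_simps)
  also have "(\<Sum>a\<in>X. const (c a) * ((x - const a) * D a) * u a) =
      (\<Prod>b\<in>X. x - const b) * (\<Sum>a\<in>X. const (c a) * u a)"
    unfolding sum_distrib_left D_def using X(1)
    by (intro sum.cong refl) (simp add: prod.remove mult_ac)
  finally have "subst_poly x p = (\<Sum>a\<in>X. const (c a) * D a * (1 - (x - const a) * u a))"
    by (simp add: dep')
  also have "\<dots> \<in> I" using u by (intro idl.subspace_sum[OF I(1)] idl.subspace_scale[OF I(1)])
  finally show False using subst_poly_notin[OF I unit \<open>p \<noteq> 0\<close>] by blast
qed

text \<open>The weak Nullstellensatz: the coordinates of a zero are fixed one after the other,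
  keeping the ideal proper.\<close>

lemma exists_proper_point:
  assumes "distinct vs" "is_ideal I" "1 \<notin> I"
  shows "\<exists>a. 1 \<notin> adjs I (map (\<lambda>i. var i - const (a i)) (vs :: 'v::finite list))"
  using assms
proof (induction vs arbitrary: I)
  case (Cons i vs)
  obtain b where b: "1 \<notin> adjoin I (var i - const b)"
    using exists_proper_specialization Cons.prems by blast
  obtain a where a: "1 \<notin> adjs (adjoin I (var i - const b)) (map (\<lambda>i. var i - const (a i)) vs)"
    using Cons.IH[of "adjoin I (var i - const b)"] Cons.prems b by auto
  have eq: "map (\<lambda>j. var j - const ((a(i := b)) j)) vs = map (\<lambda>i. var i - const (a i)) vs"
    using Cons.prems(1) by auto
  then show ?case using a by (intro exI[of _ "a(i := b)"]) (simp only: list.map adjs_Cons fun_upd_same eq not_False_eq_True)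
qed simp

lemma monomial_cong_value:
  fixes a :: "'v::finite \<Rightarrow> complex"
  assumes K: "is_ideal K" and a: "\<And>i. var i - const (a i) \<in> K"
  shows "Poly_Mapping.single m 1 - const (\<Prod>i\<in>UNIV. a i ^ Poly_Mapping.lookup m i) \<in> K"
proof (induction "mon_degree m" arbitrary: m)
  case 0
  then have "m = 0" by (intro poly_mapping_eqI) (auto simp: mon_degree_def)
  then show ?case using idl.subspace_0[OF K] by (simp add: const_simps)
next
  case (Suc d)
  then have "\<exists>i. Poly_Mapping.lookup m i > 0"
    unfolding mon_degree_def by (metis gr0I nat.distinct(1) sum.neutral)
  then obtain i where i: "Poly_Mapping.lookup m i > 0" by blast
  define m' where "m' = m - Poly_Mapping.single i 1"
  have m: "m = Poly_Mapping.single i 1 + m'"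
    using single_add_diff[OF i] by (simp add: m'_def)
  let ?b = "\<Prod>i\<in>UNIV. a i ^ Poly_Mapping.lookup m' i"
  have IH: "Poly_Mapping.single m' 1 - const ?b \<in> K"
    using Suc.hyps by (intro Suc.hyps(1)) (simp add: m mon_degree_add)
  have "(\<Prod>j\<in>UNIV. a j ^ Poly_Mapping.lookup m j) =
      (\<Prod>j\<in>UNIV. (if j = i then a i else 1) * a j ^ Poly_Mapping.lookup m' j)"
    by (intro prod.cong refl) (auto simp: m lookup_add lookup_single when_def)
  also have "\<dots> = a i * ?b" by (simp add: prod.distrib)
  finally have val: "(\<Prod>j\<in>UNIV. a j ^ Poly_Mapping.lookup m j) = a i * ?b" .
  have "Poly_Mapping.single m 1 = var i * Poly_Mapping.single m' 1" by (simp add: m var_def mult_single)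
  then have "Poly_Mapping.single m 1 - const (a i * ?b) =
      var i * (Poly_Mapping.single m' 1 - const ?b) + const ?b * (var i - const (a i))"
    by (simp add: const_simps algebra_simps)
  also have "\<dots> \<in> K" by (intro idl.subspace_add[OF K] idl.subspace_scale[OF K] IH a)
  finally show ?case by (simp add: val)
qed

lemma cong_eval_poly:
  fixes a :: "'v::finite \<Rightarrow> complex"
  assumes K: "is_ideal K" and a: "\<And>i. var i - const (a i) \<in> K"
  shows "p - const (eval_poly p (\<chi> i. a i)) \<in> K"
proof -
  let ?v = "\<lambda>m. \<Prod>i\<in>UNIV. a i ^ Poly_Mapping.lookup m i"
  have const_sum: "const (sum f A) = (\<Sum>x\<in>A. const (f x))" for f :: "'b \<Rightarrow> complex" and A
    by (induction A rule: infinite_finite_induct) (simp_all add: const_simps)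
  have "p - const (eval_poly p (\<chi> i. a i)) =
      (\<Sum>m\<in>Poly_Mapping.keys p. Poly_Mapping.single m (Poly_Mapping.lookup p m)) -
      (\<Sum>m\<in>Poly_Mapping.keys p. const (Poly_Mapping.lookup p m * ?v m))"
    using poly_mapping_eq_sum_single[of "Poly_Mapping.keys p" p] by (simp add: eval_poly_def const_sum)
  also have "\<dots> = (\<Sum>m\<in>Poly_Mapping.keys p.
      const (Poly_Mapping.lookup p m) * (Poly_Mapping.single m 1 - const (?v m)))"
    unfolding sum_subtractf[symmetric]
    by (intro sum.cong refl) (simp add: const_simps(3) right_diff_distrib, simp add: const_def mult_single)
  also have "\<dots> \<in> K"
    by (intro idl.subspace_sum[OF K] idl.subspace_scale[OF K] monomial_cong_value[OF K a])
  finally show ?thesis .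
qed

text \<open>Dehomogenization. Comparing components in \<open>1 = p + (x - 1) q\<close> with
  \<open>p\<close> in \<open>J\<close> gives \<open>q_0 = -1\<close> and
  \<open>q_(k+1) = x q_k\<close> modulo \<open>J\<close>, so \<open>q_k = -x^k\<close> modulo
  \<open>J\<close>. As \<open>q\<close> has only finitely many nonzero components, some power of
  \<open>x\<close> lies in \<open>J\<close>.\<close>

lemma power_mem_of_unit:
  fixes x :: "'v::finite cpoly"
  assumes J: "homog_ideal J" and x: "homogeneous 1 x" and unit: "1 \<in> adjoin J (x - 1)"
  shows "\<exists>r. x ^ r \<in> J"
proof -
  note id = homog_idealD(1)[OF J]
  obtain p q where pq: "p \<in> J" "1 = p + (x - 1) * q" using unit by (elim adjoin_cases)
  have p: "p = 1 + q - x * q" using pq(2) by (simp add: algebra_simps)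
  have one: "hcomp k (1 :: 'v cpoly) = (if k = 0 then 1 else 0)" for k
    by (rule hcomp_homogeneous) simp
  have comp: "hcomp k q + x ^ k \<in> J" for k
  proof (induction k)
    case 0
    have "hcomp 0 p = hcomp 0 1 + hcomp 0 q"
      using hcomp_mult[OF x, of 0 q] hcomp_add[of 0 "p" "x * q"] hcomp_add[of 0 1 q] p by simp
    then show ?case using homog_idealD(2)[OF J pq(1), of 0] one
      by (simp add: add.commute)
  next
    case (Suc k)
    have "hcomp (Suc k) p + x * hcomp k q = hcomp (Suc k) q"
      using hcomp_mult[OF x, of "Suc k" q] hcomp_add[of "Suc k" p "x * q"] hcomp_add[of "Suc k" 1 q] p one
      by simp
    then have "hcomp (Suc k) q + x ^ Suc k = hcomp (Suc k) p + x * (hcomp k q + x ^ k)"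
      by (simp add: algebra_simps)
    also have "\<dots> \<in> J"
      by (intro idl.subspace_add[OF id] idl.subspace_scale[OF id] Suc homog_idealD(2)[OF J pq(1)])
    finally show ?case .
  qed
  obtain N where N: "q = (\<Sum>k<N. hcomp k q)" by (rule hcomp_decomp)
  have "hcomp N q = 0"
    by (subst N) (simp add: hcomp_sum hcomp_homogeneous[OF homogeneous_hcomp])
  then show ?thesis using comp[of N] by auto
qed

text \<open>If no power of \<open>var i\<close> lies in \<open>J\<close>, then \<open>J\<close> and
  \<open>var i - 1\<close> generate a proper ideal. A zero of it has \<open>i\<close>-th coordinate
  1, so it is a nonzero common zero of \<open>J\<close>.\<close>

theorem projective_nullstellensatz:
  fixes J :: "'v::finite cpoly set"
  assumes J: "homog_ideal J" and no_zero: "\<And>a. a \<noteq> 0 \<Longrightarrow> \<exists>p\<in>J. eval_poly p a \<noteq> 0"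
  shows "\<exists>r. var i ^ r \<in> J"
proof (rule ccontr)
  assume "\<not> ?thesis"
  then have *: "1 \<notin> adjoin J (var i - 1)" using power_mem_of_unit[OF J, of "var i"] by auto
  have id: "is_ideal (adjoin J (var i - 1))" using homog_idealD(1)[OF J] by blast
  obtain vs :: "'v list" where vs: "set vs = UNIV" "distinct vs"
    using finite_distinct_list[OF finite_class.finite_UNIV] by blast
  obtain a where a: "1 \<notin> adjs (adjoin J (var i - 1)) (map (\<lambda>i. var i - const (a i)) vs)"
    using exists_proper_point[OF vs(2) id *] by blast
  define K where "K = adjs (adjoin J (var i - 1)) (map (\<lambda>i. var i - const (a i)) vs)"
  have K: "is_ideal K" using id by (simp add: K_def)
  have aK: "var j - const (a j) \<in> K" for j
    using adjs_set_superset[OF id, of "map (\<lambda>i. var i - const (a i)) vs"] vs(1) by (auto simp: K_def)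
  have JK: "adjoin J (var i - 1) \<subseteq> K" unfolding K_def by (rule adjs_superset)
  have const0: "c = 0" if "const c \<in> K" for c
    using const_mult_memD[OF K, of c 1] that a by (auto simp: K_def)
  have "eval_poly p (\<chi> i. a i) = 0" if "p \<in> J" for p
  proof (rule const0)
    have "p \<in> K" using that JK adjoin_superset by blast
    from idl.subspace_diff[OF K this cong_eval_poly[OF K aK, of p]] show "const (eval_poly p (\<chi> i. a i)) \<in> K" by simp
  qed
  then have "(\<chi> i. a i) = 0" using no_zero by blast
  then have "a i = 0" by (simp add: vec_eq_iff)
  have "var i - 1 \<in> K" using JK adjoin_self[OF homog_idealD(1)[OF J]] by blast
  from idl.subspace_diff[OF K aK[of i] this] have "const (1 - a i) \<in> K" by (simp add: const_simps)
  then show False using const0 \<open>a i = 0\<close> by fastforce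
qed

section \<open>Euler's formula\<close>

lemma homogeneous_pdiff: "homogeneous d p \<Longrightarrow> homogeneous (d - 1) (pdiff i p)"
  unfolding pdiff_def
proof (rule homogeneous_sum)
  fix m assume p: "homogeneous d p" and m: "m \<in> Poly_Mapping.keys p"
  show "homogeneous (d - 1) (Poly_Mapping.single (m - Poly_Mapping.single i 1)
      (of_nat (Poly_Mapping.lookup m i) * Poly_Mapping.lookup p m))"
  proof (cases "Poly_Mapping.lookup m i = 0")
    case False
    then have eq: "Poly_Mapping.single i 1 + (m - Poly_Mapping.single i 1) = m"
      by (intro single_add_diff) simp
    have "1 + mon_degree (m - Poly_Mapping.single i 1) = d"
      using arg_cong[OF eq, of mon_degree] p m by (simp add: mon_degree_add homogeneous_def)
    then show ?thesis by auto
  qed simp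
qed

lemma const_mult_single: "const c * Poly_Mapping.single m x = Poly_Mapping.single m (c * x)"
  by (simp add: const_def mult_single)

lemma euler_formula:
  assumes "homogeneous d p"
  shows "const (of_nat d) * p = (\<Sum>i\<in>UNIV. var i * pdiff i p)"
proof -
  let ?l = "Poly_Mapping.lookup"
  have "var i * pdiff i p = (\<Sum>m\<in>Poly_Mapping.keys p. Poly_Mapping.single m (of_nat (?l m i) * ?l p m))" for i
    unfolding pdiff_def sum_distrib_left
  proof (intro sum.cong refl)
    fix m :: "'a \<Rightarrow>\<^sub>0 nat"
    show "var i * Poly_Mapping.single (m - Poly_Mapping.single i 1) (of_nat (?l m i) * ?l p m) =
        Poly_Mapping.single m (of_nat (?l m i) * ?l p m)"
    proof (cases "?l m i = 0")
      case False
      then have "Poly_Mapping.single i 1 + (m - Poly_Mapping.single i 1) = m"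
        by (intro single_add_diff) simp
      then show ?thesis by (simp add: var_def mult_single)
    qed simp
  qed
  then have "(\<Sum>i\<in>UNIV. var i * pdiff i p) =
      (\<Sum>m\<in>Poly_Mapping.keys p. \<Sum>i\<in>UNIV. Poly_Mapping.single m (of_nat (?l m i) * ?l p m))"
    by (simp add: sum.swap[of _ UNIV])
  also have "\<dots> = (\<Sum>m\<in>Poly_Mapping.keys p. Poly_Mapping.single m (of_nat d * ?l p m))"
  proof (intro sum.cong refl)
    fix m assume "m \<in> Poly_Mapping.keys p"
    then have d: "of_nat d = (\<Sum>i\<in>UNIV. of_nat (?l m i) :: complex)"
      using assms by (simp add: homogeneous_def mon_degree_def flip: of_nat_sum)
    have single_sum: "Poly_Mapping.single m (sum g A) = (\<Sum>i\<in>A. Poly_Mapping.single m (g i))"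
      for g :: "'a \<Rightarrow> complex" and A
      by (induction A rule: infinite_finite_induct) (simp_all add: single_add)
    show "(\<Sum>i\<in>UNIV. Poly_Mapping.single m (of_nat (?l m i) * ?l p m)) =
        Poly_Mapping.single m (of_nat d * ?l p m)"
      unfolding d by (simp add: sum_distrib_right single_sum)
  qed
  also have "\<dots> = const (of_nat d) * (\<Sum>m\<in>Poly_Mapping.keys p. Poly_Mapping.single m (?l p m))"
    by (simp only: sum_distrib_left const_mult_single)
  finally show ?thesis using poly_mapping_eq_sum_single[of "Poly_Mapping.keys p" p] by simp
qed

lemma mem_jacobian_ideal:
  fixes p :: "'v::finite cpoly"
  assumes "homogeneous d p" "d > 0" shows "p \<in> jacobian_ideal p"
proof (rule const_mult_memD)
  show "is_ideal (jacobian_ideal p)" by (simp add: jacobian_ideal_def)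
  note id = this
  show "const (of_nat d) * p \<in> jacobian_ideal p"
    unfolding euler_formula[OF assms(1)]
    by (intro idl.subspace_sum[OF id] idl.subspace_scale[OF id])
      (simp add: jacobian_ideal_def ideal_gen_base)
qed (use assms in simp)

text \<open>By Euler's formula a common zero of the partial derivatives is also a zero of
  \<open>f\<close>, hence a singular point if it is nonzero.\<close>

lemma smooth_imp_var_power_mem:
  fixes f :: "'v::finite cpoly"
  assumes "homogeneous d f" "d > 0" "smooth_hypersurface f"
  shows "\<exists>r. var i ^ r \<in> jacobian_ideal f"
proof (rule projective_nullstellensatz)
  show "homog_ideal (jacobian_ideal f)"
    unfolding jacobian_ideal_def using homogeneous_pdiff[OF assms(1)]
    by (intro homog_ideal_ideal_gen) auto
  fix a :: "complex ^ 'v" assume a: "a \<noteq> 0"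
  show "\<exists>p\<in>jacobian_ideal f. eval_poly p a \<noteq> 0"
  proof (rule ccontr)
    assume "\<not> ?thesis"
    then have "eval_poly f a = 0" "\<And>i. eval_poly (pdiff i f) a = 0"
      using mem_jacobian_ideal[OF assms(1,2)] ideal_gen_base[OF rangeI[of "\<lambda>i. pdiff i f"]]
      by (auto simp: jacobian_ideal_def)
    then have "proj_point a \<in> singular_locus f" using a by (auto simp: singular_locus_def)
    then show False using assms(3) by (simp add: smooth_hypersurface_def)
  qed
qed

section \<open>Log-concave polynomials\<close>

text \<open>Extended by 0 to negative indices, so that convolutions and minors need no boundary
  cases.\<close>

definition int_coeff :: "real poly \<Rightarrow> int \<Rightarrow> real" where
  "int_coeff p k = (if k < 0 then 0 else coeff p (nat k))"

text \<open>
  Total positivity of order 2 of the Toeplitz matrix \<open>(a(i - j))\<close>, that is, log-concavity without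
  internal zeros. In contrast to log-concavity it is preserved by convolution, by the
  Cauchy--Binet formula for minors of order 2.
\<close>

definition tp2 :: "(int \<Rightarrow> real) \<Rightarrow> bool" where
  "tp2 a \<longleftrightarrow> (\<forall>k. a k \<ge> 0) \<and> (\<forall>x y t. x \<le> y \<longrightarrow> t \<ge> 0 \<longrightarrow> a x * a (y + t) \<le> a (x + t) * a y)"

lemma tp2D: "tp2 a \<Longrightarrow> x \<le> y \<Longrightarrow> t \<ge> 0 \<Longrightarrow> a x * a (y + t) \<le> a (x + t) * a y"
  by (simp add: tp2_def)

lemma tp2_convolution:
  assumes a: "tp2 a" and c: "tp2 c" and S: "finite S" "\<And>u. u \<notin> S \<Longrightarrow> c u = 0"
  shows "tp2 (\<lambda>k. \<Sum>u\<in>S. a (k - u) * c u)"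
proof -
  let ?b = "\<lambda>k. \<Sum>u\<in>S. a (k - u) * c u"
  have "?b x * ?b (y + t) \<le> ?b (x + t) * ?b y" if xy: "x \<le> y" "t \<ge> 0" for x y t
  proof -
    \<comment> \<open>Two of the four sums are shifted by \<open>t\<close>, so that all of them run
      over \<open>T\<close> and pair \<open>a (x + t - v)\<close> or \<open>a (y + t - v)\<close>
      with \<open>c v\<close> or \<open>c (v - t)\<close>.\<close>
    define T where "T = S \<union> (\<lambda>u. u + t) ` S"
    have fT: "finite T" using S by (simp add: T_def)
    have b0: "?b k = (\<Sum>v\<in>T. a (k - v) * c v)" for k
      using S fT by (intro sum.mono_neutral_left) (auto simp: T_def)
    have b1: "?b k = (\<Sum>v\<in>T. a (k + t - v) * c (v - t))" for k
    proof -
      have "?b k = (\<Sum>v\<in>(\<lambda>u. u + t) ` S. a (k + t - v) * c (v - t))"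
        by (subst sum.reindex) (auto simp: inj_on_def algebra_simps)
      also have "\<dots> = (\<Sum>v\<in>T. a (k + t - v) * c (v - t))"
      proof (intro sum.mono_neutral_left fT ballI)
        fix v assume "v \<in> T - (\<lambda>u. u + t) ` S"
        then have "v - t \<notin> S" by (auto simp: image_iff)
        then show "a (k + t - v) * c (v - t) = 0" using S by simp
      qed (simp add: T_def)
      finally show ?thesis .
    qed
    define A1 A2 C1 C2 where "A1 v = a (x + t - v)" and "A2 v = a (y + t - v)"
      and "C1 v = c v" and "C2 v = c (v - t)" for v
    define F where "F v w = A1 v * A2 w * (C1 v * C2 w - C2 v * C1 w)" for v w
    have "?b (x + t) * ?b y - ?b x * ?b (y + t) =
        (\<Sum>v\<in>T. A1 v * C1 v) * (\<Sum>w\<in>T. A2 w * C2 w) - (\<Sum>v\<in>T. A1 v * C2 v) * (\<Sum>w\<in>T. A2 w * C1 w)"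
      unfolding b0[of "x + t"] b0[of "y + t"] b1[of x] b1[of y] A1_def A2_def C1_def C2_def ..
    also have "\<dots> = (\<Sum>v\<in>T. \<Sum>w\<in>T. F v w)"
      unfolding sum_product sum_subtractf[symmetric] F_def by (simp add: algebra_simps)
    finally have minor: "?b (x + t) * ?b y - ?b x * ?b (y + t) = (\<Sum>v\<in>T. \<Sum>w\<in>T. F v w)" .
    have "(\<Sum>v\<in>T. \<Sum>w\<in>T. F v w) = (\<Sum>v\<in>T. \<Sum>w\<in>T. F w v)" by (rule sum.swap)
    \<comment> \<open>Symmetrizing in \<open>v\<close> and \<open>w\<close> factors each term into a
      minor of \<open>a\<close> times a minor of \<open>c\<close>. Both are nonnegative for
      \<open>v \<le> w\<close>, and both change sign when \<open>v\<close> and \<open>w\<close> are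
      exchanged.\<close>
    then have "2 * (\<Sum>v\<in>T. \<Sum>w\<in>T. F v w) = (\<Sum>v\<in>T. \<Sum>w\<in>T. F v w + F w v)"
      by (simp add: sum.distrib)
    also have "\<dots> = (\<Sum>v\<in>T. \<Sum>w\<in>T. (A1 v * A2 w - A1 w * A2 v) * (C1 v * C2 w - C2 v * C1 w))"
      by (simp add: F_def algebra_simps)
    also have "\<dots> \<ge> 0"
    proof (intro sum_nonneg)
      have pos: "A1 v * A2 w - A1 w * A2 v \<ge> 0 \<and> C1 v * C2 w - C2 v * C1 w \<ge> 0" if "v \<le> w" for v w
      proof
        have "a (x + t - w) * a ((y + t - w) + (w - v)) \<le> a ((x + t - w) + (w - v)) * a (y + t - w)"
          using xy that by (intro tp2D[OF a]) auto
        then show "A1 v * A2 w - A1 w * A2 v \<ge> 0" by (simp add: A1_def A2_def algebra_simps)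
        have "c (v - t) * c ((w - t) + t) \<le> c ((v - t) + t) * c (w - t)"
          using xy that by (intro tp2D[OF c]) auto
        then show "C1 v * C2 w - C2 v * C1 w \<ge> 0" by (simp add: C1_def C2_def)
      qed
      fix v w
      show "(A1 v * A2 w - A1 w * A2 v) * (C1 v * C2 w - C2 v * C1 w) \<ge> 0"
      proof (cases "v \<le> w")
        case True
        then show ?thesis using pos by simp
      next
        case False
        have "(A1 v * A2 w - A1 w * A2 v) * (C1 v * C2 w - C2 v * C1 w) =
            (A1 w * A2 v - A1 v * A2 w) * (C1 w * C2 v - C2 w * C1 v)" by (simp add: algebra_simps)
        then show ?thesis using pos[of w v] False by simp
      qed
    qed
    finally show ?thesis using minor by simp
  qed
  moreover have "?b k \<ge> 0" for k using a c by (intro sum_nonneg mult_nonneg_nonneg) (auto simp: tp2_def)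
  ultimately show ?thesis unfolding tp2_def by blast
qed

section \<open>Coefficient sequences of products of polynomials\<close>

lemma int_coeff_mult:
  "int_coeff (p * q) k = (\<Sum>u\<in>int ` {..degree q}. int_coeff p (k - u) * int_coeff q u)"
proof (cases "k < 0")
  case True
  then show ?thesis by (auto simp: int_coeff_def intro!: sum.neutral)
next
  case False
  define n where "n = nat k"
  have k: "k = int n" using False by (simp add: n_def)
  have "int_coeff (p * q) k = (\<Sum>i\<le>n. coeff q i * coeff p (n - i))"
    by (simp add: int_coeff_def k mult.commute[of p] coeff_mult)
  also have "\<dots> = (\<Sum>i\<le>n. int_coeff p (k - int i) * int_coeff q (int i))"
    by (intro sum.cong) (auto simp: int_coeff_def k nat_diff_distrib)
  also have "\<dots> = (\<Sum>i\<le>max n (degree q). int_coeff p (k - int i) * int_coeff q (int i))"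
    by (intro sum.mono_neutral_left) (auto simp: int_coeff_def k)
  also have "\<dots> = (\<Sum>i\<le>degree q. int_coeff p (k - int i) * int_coeff q (int i))"
    by (intro sum.mono_neutral_right) (auto simp: int_coeff_def coeff_eq_0)
  also have "\<dots> = (\<Sum>u\<in>int ` {..degree q}. int_coeff p (k - u) * int_coeff q u)"
    by (subst sum.reindex) (auto simp: inj_on_def)
  finally show ?thesis .
qed

lemma tp2_mult:
  assumes "tp2 (int_coeff p)" "tp2 (int_coeff q)" shows "tp2 (int_coeff (p * q))"
proof -
  have "int_coeff q u = 0" if "u \<notin> int ` {..degree q}" for u
  proof (cases "u < 0")
    case False
    then have "nat u > degree q" using that by (metis atMost_iff image_eqI int_nat_eq not_le not_less)
    then show ?thesis by (simp add: int_coeff_def coeff_eq_0)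
  qed (simp add: int_coeff_def)
  then show ?thesis
    using tp2_convolution[OF assms, of "int ` {..degree q}"] by (simp add: int_coeff_mult[abs_def])
qed

text \<open>For \<open>m = 0\<close> this is the zero polynomial, in agreement with
  \<open>1 - fps_X ^ 0 = 0\<close>.\<close>

definition geometric_poly :: "nat \<Rightarrow> real poly" where
  "geometric_poly m = (\<Sum>j<m. monom 1 j)"

lemma tp2_geometric_poly: "tp2 (int_coeff (geometric_poly m))"
proof -
  have "int_coeff (geometric_poly m) k = (if 0 \<le> k \<and> k < int m then 1 else 0)" for k
    by (auto simp: int_coeff_def geometric_poly_def coeff_sum)
  then show ?thesis by (auto simp: tp2_def)
qed

lemma fps_of_geometric_poly:
  "fps_of_poly (geometric_poly m) * (1 - fps_X) = 1 - fps_X ^ m"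
  using one_diff_power_eq[of "fps_X :: real fps" m]
  by (simp add: geometric_poly_def fps_of_poly_sum fps_of_poly_monom' mult.commute)

lemma tp2_prod_list: "tp2 (int_coeff (prod_list (map geometric_poly ms)))"
proof (induction ms)
  case Nil
  show ?case using tp2_geometric_poly[of 1] by (simp add: geometric_poly_def)
qed (simp add: tp2_mult tp2_geometric_poly)

lemma tp2_coeff:
  assumes "tp2 (int_coeff p)"
  shows "coeff p k \<ge> 0" "i \<le> j \<Longrightarrow> coeff p i * coeff p (Suc j) \<le> coeff p (Suc i) * coeff p j"
proof -
  have "int_coeff p (int k) \<ge> 0" using assms by (simp add: tp2_def)
  then show "coeff p k \<ge> 0" by (simp add: int_coeff_def)
  assume "i \<le> j"
  then have "int_coeff p (int i) * int_coeff p (int j + 1) \<le> int_coeff p (int i + 1) * int_coeff p (int j)"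
    by (intro tp2D[OF assms]) auto
  then show "coeff p i * coeff p (Suc j) \<le> coeff p (Suc i) * coeff p j"
    by (simp add: int_coeff_def nat_add_distrib)
qed

lemma tp2_imp_log_concave:
  assumes "tp2 (int_coeff p)" shows "log_concave_poly p"
  unfolding log_concave_poly_def log_concave_seq_def
proof (intro allI impI)
  fix k assume "1 \<le> k \<and> k < degree p"
  then show "coeff p (k - 1) * coeff p (k + 1) \<le> (coeff p k)\<^sup>2"
    using tp2_coeff(2)[OF assms, of "k - 1" k] by (simp add: power2_eq_square)
qed

text \<open>The peak \<open>i\<close> is an index of a largest coefficient. A strict descent from
  \<open>j\<close> to \<open>j + 1\<close> before it would contradict
  \<open>p_j p_i \<le> p_(j+1) p_(i-1) \<le> p_(j+1) p_i\<close>, as \<open>p_i > 0\<close>; a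
  strict ascent after it is excluded likewise.\<close>

lemma tp2_imp_unimodal:
  assumes tp: "tp2 (int_coeff p)" shows "unimodal_poly p"
proof -
  define M where "M = Max (coeff p ` {..degree p})"
  have "M \<in> coeff p ` {..degree p}" unfolding M_def by (intro Max_in) auto
  then obtain i where i: "i \<le> degree p" "coeff p i = M" by auto
  have max: "coeff p j \<le> coeff p i" for j
  proof (cases "j \<le> degree p")
    case True
    then show ?thesis unfolding i(2) M_def by (intro Max_ge) auto
  next
    case False
    then show ?thesis using tp2_coeff(1)[OF tp, of i] by (simp add: coeff_eq_0)
  qed
  have "coeff p j \<le> coeff p (j + 1)" if "j < i" for j
  proof (rule ccontr)
    assume less: "\<not> ?thesis"
    then have pos: "coeff p i > 0" using max[of j] tp2_coeff(1)[OF tp, of "j + 1"] by linarith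
    have "coeff p j * coeff p (Suc (i - 1)) \<le> coeff p (Suc j) * coeff p (i - 1)"
      using that by (intro tp2_coeff(2)[OF tp]) simp
    also have "\<dots> \<le> coeff p (Suc j) * coeff p i"
      using max tp2_coeff(1)[OF tp] by (intro mult_left_mono) auto
    finally show False using less pos that by simp
  qed
  moreover have "coeff p j \<ge> coeff p (j + 1)" if "i \<le> j" for j
  proof (rule ccontr)
    assume less: "\<not> ?thesis"
    then have pos: "coeff p i > 0" using max[of "j + 1"] tp2_coeff(1)[OF tp, of j] by linarith
    have "coeff p i * coeff p (Suc j) \<le> coeff p (Suc i) * coeff p j"
      using that by (intro tp2_coeff(2)[OF tp])
    also have "\<dots> \<le> coeff p i * coeff p j"
      using max tp2_coeff(1)[OF tp] by (intro mult_right_mono) auto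
    finally show False using less pos by simp
  qed
  ultimately show ?thesis unfolding unimodal_poly_def unimodal_seq_def using i(1) by blast
qed

section \<open>The Hilbert series of the Milnor algebra\<close>

lemma vars_list:
  obtains vs :: "'v::finite list" where "set vs = UNIV" "regular_mod {0} (map var vs)"
    "length vs = CARD('v)"
  using finite_distinct_list[OF finite_class.finite_UNIV] regular_mod_vars distinct_card that by metis

lemma irrelevant_ideal_eq: "set vs = UNIV \<Longrightarrow> irrelevant_ideal = ideal_gen (set (map var vs))"
  by (simp add: irrelevant_ideal_def)

lemma pos_homog_mem_irrelevant:
  fixes p :: "'v::finite cpoly"
  assumes "pos_homog p" shows "p \<in> irrelevant_ideal"
proof -
  obtain vs :: "'v list" where vs: "set vs = UNIV" by (rule vars_list)
  then show ?thesis
    using pos_homog_lookup_0[OF assms] adjs_vars[of vs] adjs_zero[of "map var vs"]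
    by (simp add: irrelevant_ideal_eq var_ideal_UNIV)
qed

text \<open>The variables are a regular sequence of length \<open>CARD('v)\<close>, so every shorter
  one of positive degrees generates a saturated ideal.\<close>

lemma annih_vars_regular:
  fixes cs :: "'v::finite cpoly list"
  assumes vs: "set vs = (UNIV :: 'v set)"
    and cs: "\<forall>c\<in>set cs. pos_homog c" "regular_mod {0} cs" "length cs < CARD('v)"
  shows "annih (map var vs) (adjs {0} cs) \<subseteq> adjs {0} cs"
proof -
  obtain us :: "'v list" where us: "set us = UNIV" "regular_mod {0} (map var us)" "length us = CARD('v)"
    by (rule vars_list)
  have mem: "c \<in> ideal_gen (set (map var vs))" if "pos_homog c" for c
    using pos_homog_mem_irrelevant[OF that] irrelevant_ideal_eq[OF vs] by simp
  show ?thesis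
    by (rule annih_regular_subset[where gs = "map var us"])
      (use cs us mem in auto)
qed

lemma homogeneous_mem_proper_pos:
  assumes "homogeneous k p" "p \<in> I" "is_ideal I" "I \<noteq> UNIV" "p \<noteq> 0" shows "k > 0"
proof (rule ccontr)
  assume "\<not> k > 0"
  then have p: "p = const (Poly_Mapping.lookup p 0)" using assms(1) homogeneous_0_eq_const by simp
  then have "Poly_Mapping.lookup p 0 \<noteq> 0" using assms(5) const_simps(4) by metis
  then have "1 \<in> I" using const_mult_memD[OF assms(3), of "Poly_Mapping.lookup p 0" 1] assms(2) p by simp
  then show False using ideal_eq_UNIV[OF assms(3)] assms(4) by blast
qed

text \<open>Zero is a non-zero-divisor only modulo the whole ring.\<close>

lemma regular_mod_nonzero:
  assumes "regular_mod I cs" "is_ideal I" "adjs I cs \<noteq> UNIV" "c \<in> set cs" shows "c \<noteq> 0"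
proof
  assume "c = 0"
  obtain as bs where cs: "cs = as @ c # bs" using split_list[OF assms(4)] by blast
  have "nzd_mod (adjs I as) 0" using assms(1) \<open>c = 0\<close> by (simp add: cs regular_mod_append)
  then have "1 \<in> adjs I as" using idl.subspace_0[OF is_ideal_adjs[OF assms(2)]] by (auto simp: nzd_mod_def)
  moreover have "adjs I cs = adjs (adjs I as) (c # bs)" by (simp add: cs adjs_def)
  ultimately have "1 \<in> adjs I cs" using adjs_superset by blast
  then show False using ideal_eq_UNIV[OF is_ideal_adjs[OF assms(2)]] assms(3) by blast
qed

lemma span_pos_homog:
  assumes "\<forall>w\<in>W. homogeneous e w" "e > 0" "x \<in> cvs.span W" shows "pos_homog x"
  using homogeneous_span[OF assms(1,3)] assms(2) unfolding pos_homog_def by blast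

text \<open>Properness excludes \<open>h = 0\<close>, on which \<open>hdeg\<close> would be
  arbitrary.\<close>

lemma regular_span_hdeg:
  assumes "regular_mod {0} hs" "adjs {0} hs \<noteq> UNIV" "set hs \<subseteq> cvs.span W"
    "\<forall>w\<in>W. homogeneous e w" "e > 0"
  shows "\<forall>h\<in>set hs. pos_homog h \<and> hdeg h = e"
proof
  fix h assume h: "h \<in> set hs"
  then have "h \<noteq> 0" using regular_mod_nonzero[OF assms(1) _ assms(2)] by auto
  moreover have "homogeneous e h" using homogeneous_span[OF assms(4)] assms(3) h by blast
  ultimately show "pos_homog h \<and> hdeg h = e" using hdeg_eqI assms(5) by (auto simp: pos_homog_def)
qed

lemma HP_regular_span:
  fixes hs :: "'v::finite cpoly list"
  assumes "regular_mod {0} hs" "\<forall>h\<in>set hs. pos_homog h \<and> hdeg h = e"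
  shows "HP UNIV (adjs {0} hs) = HP UNIV {0 :: 'v cpoly} * (1 - fps_X ^ e) ^ length hs"
proof -
  have "map (\<lambda>x. 1 - fps_X ^ hdeg x) hs = replicate (length hs) (1 - fps_X ^ e :: real fps)"
    using assms(2) by (induction hs) auto
  then show ?thesis using HP_adjs_regular[of "{0}" hs] assms by (simp add: prod_list_replicate)
qed

lemma ideal_gen_eq_of_span:
  assumes "A \<subseteq> cvs.span B" "B \<subseteq> cvs.span A" shows "ideal_gen A = ideal_gen B"
  using assms cvs_span_subset_ideal_gen[of A] cvs_span_subset_ideal_gen[of B]
  by (intro equalityI ideal_gen_subset) auto

lemma ideal_gen_pos_homog_proper:
  assumes "\<forall>w\<in>W. pos_homog w" shows "ideal_gen W \<noteq> UNIV"
proof -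
  have "is_ideal (irrelevant_ideal :: 'a cpoly set)" by (simp add: irrelevant_ideal_def)
  then have "ideal_gen W \<subseteq> irrelevant_ideal"
    using assms pos_homog_mem_irrelevant by (intro ideal_gen_subset) auto
  moreover obtain vs :: "'a list" where vs: "set vs = UNIV" by (rule vars_list)
  have "1 \<notin> (irrelevant_ideal :: 'a cpoly set)"
    using adjs_vars[of vs] adjs_zero[of "map var vs"] var_ideal_UNIV[of 1] vs
    by (simp add: irrelevant_ideal_eq[OF vs])
  ultimately show ?thesis by blast
qed

text \<open>By the Nullstellensatz the Jacobian ideal contains powers of all variables, so its
  annihilator is as trivial as that of the irrelevant ideal modulo regular sequences in the span
  with fewer than \<open>CARD('v)\<close> terms. A generic regular sequence of full length then
  spans the same space as the partial derivatives.\<close>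

lemma HP_smooth:
  fixes f :: "'v::finite cpoly"
  assumes f: "homogeneous d f" "d \<ge> 2" "smooth_hypersurface f"
  shows "HP_M f = HP UNIV {0 :: 'v cpoly} * (1 - fps_X ^ (d - 1)) ^ CARD('v)"
proof -
  let ?e = "d - 1"
  obtain vs :: "'v list" where vs: "set vs = UNIV" "length vs = CARD('v)" by (rule vars_list)
  define ws where "ws = map (\<lambda>i. pdiff i f) vs"
  have J: "jacobian_ideal f = ideal_gen (set ws)" by (simp add: jacobian_ideal_def ws_def vs)
  have ws: "\<forall>w\<in>set ws. homogeneous ?e w" using homogeneous_pdiff[OF f(1)] by (auto simp: ws_def)
  have e: "?e > 0" using f by simp
  have proper: "adjs {0} cs \<noteq> UNIV" if "set cs \<subseteq> cvs.span (set ws)" for cs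
  proof -
    have "\<forall>c\<in>set cs. pos_homog c" using span_pos_homog[OF ws e] that by blast
    then show ?thesis using ideal_gen_pos_homog_proper by (simp add: adjs_zero)
  qed
  obtain r where r: "\<And>i. var i ^ r i \<in> jacobian_ideal f"
    using smooth_imp_var_power_mem[OF f(1) _ f(3)] f(2) by (metis zero_less_numeral less_le_trans)
  have ann: "annih ws (adjs {0} cs) \<subseteq> adjs {0} cs"
    if cs: "length cs < CARD('v)" "set cs \<subseteq> cvs.span (set ws)" "regular_mod {0} cs" for cs
  proof -
    let ?C = "adjs {0} cs"
    have C: "is_ideal ?C" by auto
    have "annih (map var vs) ?C \<subseteq> ?C"
      using regular_span_hdeg[OF cs(3) proper[OF cs(2)] cs(2) ws e] cs
      by (intro annih_vars_regular[OF vs(1)]) auto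
    \<comment> \<open>Exponents are attached to elements rather than to indices, so an index is
      recovered with \<open>SOME\<close>; any \<open>i\<close> with \<open>x = var i\<close>
      serves.\<close>
    note pow = annih_powers[OF C this, of "\<lambda>x. r (SOME i. x = var i)"]
    have "u \<in> ?C" if u: "u \<in> annih ws ?C" for u
    proof -
      have "u * var i ^ r (SOME j. var i = var j) \<in> ?C" for i
      proof -
        have "var i = var (SOME j. var i = var j)" by (rule someI[of _ i]) simp
        then have "var i ^ r (SOME j. var i = var j) \<in> jacobian_ideal f"
          using r[of "SOME j. var i = var j"] by simp
        then show ?thesis using annih_gens[OF C u] J by simp
      qed
      then show ?thesis using pow by (auto simp: annih_def)
    qed
    then show ?thesis by blast
  qed
  obtain hs where hs: "length hs = CARD('v)" "set hs \<subseteq> cvs.span (set ws)" "regular_mod {0} hs"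
    by (rule exists_regular_in_span[OF ws ann])
  have ind: "distinct hs" "cvs.independent (set hs)"
    using regular_mod_independent[OF hs(3) proper[OF hs(2)]] by auto
  obtain B where B: "set hs \<subseteq> B" "finite B" "card B \<le> card (set ws)" "set ws \<subseteq> cvs.span B"
    by (rule span_extend_basis[OF ind(2) hs(2) finite_set]) blast
  have "card (set ws) \<le> CARD('v)" using card_length[of ws] vs by (simp add: ws_def)
  \<comment> \<open>\<open>B\<close> contains the \<open>CARD('v)\<close> distinct forms in
    \<open>hs\<close> and has at most that many elements.\<close>
  then have "B = set hs"
    using card_seteq[OF B(2,1)] B(3) distinct_card[OF ind(1)] hs(1) by simp
  then have "ideal_gen (set ws) = adjs {0} hs"
    using ideal_gen_eq_of_span[OF B(4)] hs(2) by (simp add: adjs_zero)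
  then show ?thesis
    using HP_regular_span[OF hs(3) regular_span_hdeg[OF hs(3) proper[OF hs(2)] hs(2) ws e]] hs(1) J
    by (simp add: HP_M_def)
qed

section \<open>Liaison\<close>

text \<open>The exponent is \<open>E = e + (n * e - s)\<close>, where \<open>n = length gs\<close>
  and \<open>s\<close> is the sum of the degrees of \<open>gs\<close>.\<close>

lemma HP_saturation_quotient:
  fixes ws gs :: "'v::finite cpoly list"
  assumes ws: "\<forall>w\<in>set ws. homogeneous e w" "e > 0" "card (set ws) \<le> Suc (length gs)"
    and n: "CARD('v) = Suc (length gs)"
    and gs: "\<forall>g\<in>set gs. pos_homog g" "regular_mod {0} gs"
    and sat: "saturation (ideal_gen (set ws)) = ideal_gen (set gs)"
  obtains E where "HP (ideal_gen (set gs)) (ideal_gen (set ws)) =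
    HP UNIV {0 :: 'v cpoly} * (1 - fps_X ^ e) ^ CARD('v) - (1 - fps_X ^ E) * HP UNIV (ideal_gen (set gs))"
proof -
  let ?n = "length gs" and ?J = "ideal_gen (set ws)" and ?K = "ideal_gen (set gs)"
  let ?S = "HP UNIV {0 :: 'v cpoly}"
  obtain vs :: "'v list" where vs: "set vs = UNIV" by (rule vars_list)
  have vars_irr: "set (map var vs) \<subseteq> irrelevant_ideal"
    using irrelevant_ideal_eq[OF vs] ideal_gen_superset by metis
  have JK: "?J \<subseteq> ?K" using subset_saturation[of ?J] sat by simp
  have proper: "adjs {0} cs \<noteq> UNIV" if "set cs \<subseteq> cvs.span (set ws)" for cs
  proof -
    have "\<forall>c\<in>set cs. pos_homog c" using span_pos_homog[OF ws(1,2)] that by blast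
    then show ?thesis using ideal_gen_pos_homog_proper by (simp add: adjs_zero)
  qed
  \<comment> \<open>Stated for all short sequences, because it serves while \<open>hs\<close> is
    being built and again for the final \<open>hs\<close>.\<close>
  have colon: "annih ws (adjs {0} cs) = annih gs (adjs {0} cs)"
    if cs: "length cs \<le> ?n" "set cs \<subseteq> cvs.span (set ws)" "regular_mod {0} cs" for cs
  proof
    let ?C = "adjs {0} cs"
    have C: "is_ideal ?C" by auto
    have "annih (map var vs) ?C \<subseteq> ?C"
      using regular_span_hdeg[OF cs(3) proper[OF cs(2)] cs(2) ws(1,2)] cs n
      by (intro annih_vars_regular[OF vs]) auto
    then show "annih ws ?C \<subseteq> annih gs ?C"
      using sat ideal_gen_superset by (intro annih_saturation_subset[OF C vars_irr]) auto
    have "set ws \<subseteq> ?K" using JK ideal_gen_superset[of "set ws"] by blast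
    then show "annih gs ?C \<subseteq> annih ws ?C" using annih_gens[OF C] by (auto simp: annih_def)
  qed
  have span_K: "cvs.span (set ws) \<subseteq> ?K" using cvs_span_subset_ideal_gen JK by blast
  have hs_facts: "\<forall>c\<in>set cs. pos_homog c \<and> c \<in> ?K"
    if "set cs \<subseteq> cvs.span (set ws)" "regular_mod {0} cs" for cs
    using regular_span_hdeg[OF that(2) proper[OF that(1)] that(1) ws(1,2)] that span_K by blast
  \<comment> \<open>Here \<open>(ws)\<close> inherits its grade from the regular sequence
    \<open>gs\<close> in its saturation.\<close>
  have ann: "annih ws (adjs {0} cs) \<subseteq> adjs {0} cs"
    if cs: "length cs < ?n" "set cs \<subseteq> cvs.span (set ws)" "regular_mod {0} cs" for cs
  proof -
    have "annih gs (adjs {0} cs) \<subseteq> adjs {0} cs"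
      using hs_facts[OF cs(2,3)] cs gs ideal_gen_base
      by (intro annih_regular_subset[where gs = gs]) auto
    then show ?thesis using colon[of cs] cs by simp
  qed
  obtain hs where hs: "length hs = ?n" "set hs \<subseteq> cvs.span (set ws)" "regular_mod {0} hs"
    by (rule exists_regular_in_span[OF ws(1) ann])
  let ?C = "adjs {0} hs"
  have hdeg_hs: "\<forall>h\<in>set hs. pos_homog h \<and> hdeg h = e"
    by (rule regular_span_hdeg[OF hs(3) proper[OF hs(2)] hs(2) ws(1,2)])
  have hC: "homog_ideal ?C" using hdeg_hs by (intro homog_ideal_adjs_pos) auto
  note iC = homog_idealD(1)[OF hC]
  have ind: "distinct hs" "cvs.independent (set hs)"
    using regular_mod_independent[OF hs(3) proper[OF hs(2)]] by auto
  obtain B where B: "set hs \<subseteq> B" "finite B" "card B \<le> card (set ws)" "B \<subseteq> cvs.span (set ws)"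
      "set ws \<subseteq> cvs.span B"
    by (rule span_extend_basis[OF ind(2) hs(2) finite_set])
  \<comment> \<open>At most \<open>n + 1\<close> elements, \<open>n\<close> of them in
    \<open>hs\<close>, leave room for one more form; \<open>h = 0\<close> is taken if there is
    none.\<close>
  have "card (B - set hs) \<le> Suc 0"
    using B ws(3) hs(1) distinct_card[OF ind(1)] by (simp add: card_Diff_subset)
  then obtain h where h: "B \<subseteq> insert h (set hs)" "h \<in> cvs.span (set ws)"
  proof (cases "B - set hs = {}")
    case True
    then show ?thesis using that[of 0] cvs.span_zero by blast
  next
    case False
    then obtain h where "h \<in> B - set hs" by blast
    then have "B - set hs = {h}"
      using card_le_Suc0_iff_eq[of "B - set hs"] B(2) \<open>card (B - set hs) \<le> Suc 0\<close> by auto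
    then show ?thesis using that[of h] B(4) by blast
  qed
  have he: "homogeneous e h" using homogeneous_span[OF ws(1) h(2)] .
  have J_eq: "?J = adjoin ?C h"
  proof -
    have "set ws \<subseteq> cvs.span (set (hs @ [h]))" using B(5) cvs.span_mono[of B "set (hs @ [h])"] h(1) by auto
    then have "?J = ideal_gen (set (hs @ [h]))" using hs(2) h(2) by (intro ideal_gen_eq_of_span) auto
    then show ?thesis using adjs_zero[of "hs @ [h]"] by simp
  qed
  \<comment> \<open>Modulo \<open>?C\<close> the ideal \<open>(ws)\<close> is generated by
    \<open>h\<close>, so both have the same colon ideal.\<close>
  have colon_h: "annih [h] ?C = annih gs ?C"
  proof -
    have "annih [h] ?C = annih ws ?C"
    proof
      have "u * a \<in> ?C" if u: "u * h \<in> ?C" and a: "a \<in> adjoin ?C h" for u a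
      proof -
        obtain p q where pq: "p \<in> ?C" "a = p + h * q" using a by (elim adjoin_cases)
        have "u * p + (u * h) * q \<in> ?C"
          by (intro idl.subspace_add[OF iC] idl.subspace_scale[OF iC] is_ideal_scale_right[OF iC] pq u)
        then show ?thesis by (simp add: pq algebra_simps)
      qed
      then show "annih [h] ?C \<subseteq> annih ws ?C"
        using ideal_gen_superset[of "set ws"] J_eq by (auto simp: annih_def)
      have "h \<in> ?J" using h(2) cvs_span_subset_ideal_gen by blast
      then show "annih ws ?C \<subseteq> annih [h] ?C" using annih_gens[OF iC] by (auto simp: annih_def)
    qed
    then show ?thesis using colon hs by simp
  qed
  let ?Q = "HP (annih gs ?C) ?C" and ?G = "HP UNIV ?K"
  have HC: "HP UNIV ?C = ?S * (1 - fps_X ^ e) ^ ?n"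
    using HP_regular_span[OF hs(3) hdeg_hs] hs(1) by simp
  have HJ: "HP UNIV ?J = HP UNIV ?C - fps_X ^ e * HP UNIV (annih gs ?C)"
    using HP_adjoin[OF hC he] by (simp add: J_eq colon_h)
  have HA: "HP UNIV ?C = HP UNIV (annih gs ?C) + ?Q"
    using iC annih_superset[OF iC, of gs] by (intro HP_add) auto
  have HK: "HP UNIV ?J = ?G + HP ?K ?J" using JK by (intro HP_add) auto
  define s where "s = sum_list (map hdeg gs)"
  \<comment> \<open>Modulo \<open>gs\<close> the colon ideal is the whole ring, so the other side of
    Rees's theorem is the series of \<open>S/K\<close>.\<close>
  have "fps_X ^ s * ?Q = fps_X ^ sum_list (map hdeg hs) * HP (annih gs (adjs {0} gs)) (adjs {0} gs)"
    unfolding s_def using hs_facts[OF hs(2,3)] hs gs ideal_gen_base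
    by (intro HP_annih_regular) auto
  moreover have "annih gs (adjs {0} gs) = UNIV"
    using idl.subspace_scale[OF is_ideal_ideal_gen ideal_gen_base] by (auto simp: annih_def adjs_zero)
  moreover have "sum_list (map hdeg hs) = ?n * e"
    using hdeg_hs hs(1) by (simp add: sum_list_triv cong: map_cong)
  ultimately have rees: "fps_X ^ s * ?Q = fps_X ^ (?n * e) * ?G" by (simp add: adjs_zero)
  have G: "?G = ?S * prod_list (map (\<lambda>x. 1 - fps_X ^ hdeg x) gs)"
    using HP_adjs_regular[OF homog_ideal_zero gs] by (simp add: adjs_zero)
  have S0: "fps_nth ?S 0 \<noteq> 0"
    using arg_cong[OF HP_ring[where 'v = 'v], of "\<lambda>z. fps_nth z 0"] by (auto simp: fps_mult_nth_0)
  have "fps_nth (prod_list (map (\<lambda>x. 1 - fps_X ^ hdeg x) gs) :: real fps) 0 = 1"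
    using gs(1) hdeg(1) by (induction gs) (auto simp: fps_mult_nth_0 fps_X_power_nth)
  then have G0: "fps_nth ?G 0 \<noteq> 0" using S0 by (simp add: G fps_mult_nth_0)
  \<comment> \<open>Since \<open>?G\<close> has a nonzero constant term, \<open>rees\<close> would
    fail in degree \<open>?n * e\<close> if \<open>s\<close> were larger. So the truncated
    subtraction \<open>?n * e - s\<close> below is exact.\<close>
  have "s \<le> ?n * e"
  proof (rule ccontr)
    assume "\<not> ?thesis"
    then have "fps_nth (fps_X ^ s * ?Q) (?n * e) = 0" by (simp add: fps_X_power_mult_nth)
    then show False using G0 by (simp add: rees fps_X_power_mult_nth)
  qed
  then have "fps_X ^ s * ?Q = fps_X ^ s * (fps_X ^ (?n * e - s) * ?G)"
    using rees by (simp add: mult.assoc[symmetric] flip: power_add)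
  then have Q: "?Q = fps_X ^ (?n * e - s) * ?G" by simp
  show thesis
  proof (rule that)
    have "HP ?K ?J = HP UNIV ?C - fps_X ^ e * (HP UNIV ?C - ?Q) - ?G"
      using HJ HA HK by (simp add: algebra_simps)
    also have "\<dots> = ?S * (1 - fps_X ^ e) ^ CARD('v) - (1 - fps_X ^ (e + (?n * e - s))) * ?G"
      unfolding Q HC n by (simp add: algebra_simps power_add)
    finally show "HP ?K ?J =
        ?S * (1 - fps_X ^ e) ^ CARD('v) - (1 - fps_X ^ (e + (?n * e - s))) * ?G" .
  qed
qed

text \<open>Serves to exclude the degenerate case in which all partial derivatives of
  \<open>f\<close> vanish.\<close>

lemma saturation_zero:
  "saturation {0 :: 'v::finite cpoly} = {0}"
proof -
  obtain vs :: "'v list" where vs: "set vs = UNIV" by (rule vars_list)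
  have "annih (map var vs) {0} \<subseteq> {0 :: 'v cpoly}"
    using annih_vars_regular[OF vs, of "[]"] by simp
  moreover have "set (map var vs) \<subseteq> irrelevant_ideal"
    using irrelevant_ideal_eq[OF vs] ideal_gen_superset by metis
  ultimately have "v = 0" if "v \<in> saturation {0}" for v :: "'v cpoly"
    using mem_of_ideal_power_mult[of "{0}" "map var vs" _ v] that by (auto simp: saturation_def)
  then show ?thesis using subset_saturation[of "{0 :: 'v cpoly}"] by auto
qed

theorem proposition1p4:
  fixes n d :: nat and f f\<^sub>s :: "'v::finite cpoly"
  assumes "n \<ge> 1" and "CARD('v) = n + 1"
    and "homogeneous d f"
    and "only_isolated_singularities f"
    and "complete_intersection_ideal n (saturation (jacobian_ideal f))"
    and "homogeneous d f\<^sub>s"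
    and "smooth_hypersurface f\<^sub>s"
  shows "\<exists>p :: real poly. fps_of_poly p = HP_M f\<^sub>s - HP_N f \<and>
           log_concave_poly p \<and> unimodal_poly p"
proof -
  obtain gs ds where gs: "length gs = n" "\<forall>i<n. homogeneous (ds ! i) (gs ! i)" "regular_sequence gs"
    and sat: "saturation (jacobian_ideal f) = ideal_gen (set gs)"
    using assms(5) unfolding complete_intersection_ideal_def by blast
  let ?K = "ideal_gen (set gs)"
  have K: "?K \<noteq> UNIV" using gs(3) by (simp add: regular_sequence_def)
  have reg: "regular_mod {0} gs" using regular_sequence_imp_regular_mod[OF gs(3)] .
  have gs_nonzero: "g \<noteq> 0" if "g \<in> set gs" for g
    using regular_mod_nonzero[OF reg _ _ that] K by (simp add: adjs_zero)
  have gs_pos: "\<forall>g\<in>set gs. pos_homog g"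
  proof
    fix g assume g: "g \<in> set gs"
    then obtain i where "i < n" "g = gs ! i" using gs(1) by (auto simp: in_set_conv_nth)
    then have "homogeneous (ds ! i) g" using gs(2) by simp
    then show "pos_homog g"
      using homogeneous_mem_proper_pos[OF _ ideal_gen_base[OF g] is_ideal_ideal_gen K gs_nonzero[OF g]]
      by (auto simp: pos_homog_def)
  qed
  obtain vs :: "'v list" where vs: "set vs = UNIV" "length vs = CARD('v)" by (rule vars_list)
  define ws where "ws = map (\<lambda>i. pdiff i f) vs"
  have J: "jacobian_ideal f = ideal_gen (set ws)" by (simp add: jacobian_ideal_def ws_def vs)
  have ws: "\<forall>w\<in>set ws. homogeneous (d - 1) w" using homogeneous_pdiff[OF assms(3)] by (auto simp: ws_def)
  \<comment> \<open>A nonzero partial derivative lies in the proper ideal \<open>?K\<close>, hence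
    is not a constant. If all of them vanished, \<open>?K\<close> would be 0, against the nonzero
    \<open>gs ! 0\<close>, which exists as \<open>n \<ge> 1\<close>.\<close>
  have e: "d - 1 > 0"
  proof (cases "\<exists>w\<in>set ws. w \<noteq> 0")
    case True
    then obtain w where w: "w \<in> set ws" "w \<noteq> 0" by blast
    then have "w \<in> ?K" using subset_saturation[of "jacobian_ideal f"] sat J ideal_gen_base[OF w(1)] by auto
    then show ?thesis using homogeneous_mem_proper_pos[OF _ _ is_ideal_ideal_gen K w(2)] ws w(1) by blast
  next
    case False
    then have "jacobian_ideal f = {0}"
      using J ideal_gen_subset[of "set ws" "{0}"] idl.subspace_0[OF is_ideal_ideal_gen, of "set ws"] by auto
    then have "?K = {0}" using sat saturation_zero[where 'v = 'v] by simp
    moreover have "gs ! 0 \<in> set gs" using gs(1) assms(1) by auto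
    ultimately have False using gs_nonzero ideal_gen_base[of "gs ! 0" "set gs"] by blast
    then show ?thesis ..
  qed
  have cw: "card (set ws) \<le> Suc (length gs)" using card_length[of ws] vs assms(2) gs(1) by (simp add: ws_def)
  obtain E where E: "HP_N f =
      HP UNIV {0 :: 'v cpoly} * (1 - fps_X ^ (d - 1)) ^ CARD('v) - (1 - fps_X ^ E) * HP UNIV ?K"
    using HP_saturation_quotient[OF ws e cw _ gs_pos reg] assms(2) gs(1) sat J
    unfolding HP_N_def by auto
  have "HP_M f\<^sub>s = HP UNIV {0 :: 'v cpoly} * (1 - fps_X ^ (d - 1)) ^ CARD('v)"
    using HP_smooth[OF assms(6) _ assms(7)] e by simp
  then have diff: "HP_M f\<^sub>s - HP_N f = (1 - fps_X ^ E) * HP UNIV ?K" using E by simp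
  \<comment> \<open>The \<open>n + 1\<close> numerators \<open>1 - fps_X ^ m\<close> yield
    \<open>n + 1\<close> factors \<open>1 - fps_X\<close>, which cancel the series of the polynomial
    ring by \<open>HP_ring\<close>.\<close>
  define p where "p = prod_list (map geometric_poly (E # map hdeg gs))"
  have "prod_list (map (\<lambda>x. 1 - fps_X ^ hdeg x) gs) =
      fps_of_poly (prod_list (map geometric_poly (map hdeg gs))) * (1 - fps_X) ^ length gs"
    by (induction gs) (simp_all add: fps_of_poly_mult fps_of_geometric_poly[symmetric] mult_ac)
  then have "HP UNIV ?K = HP UNIV {0 :: 'v cpoly} * (1 - fps_X) ^ length gs *
      fps_of_poly (prod_list (map geometric_poly (map hdeg gs)))"
    using HP_adjs_regular[OF homog_ideal_zero gs_pos reg] by (simp add: adjs_zero mult_ac)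
  then have "HP_M f\<^sub>s - HP_N f = (HP UNIV {0 :: 'v cpoly} * (1 - fps_X) ^ CARD('v)) * fps_of_poly p"
    unfolding diff fps_of_geometric_poly[symmetric] p_def assms(2) gs(1)
    by (simp add: fps_of_poly_mult mult_ac)
  then have "fps_of_poly p = HP_M f\<^sub>s - HP_N f" by (simp add: HP_ring)
  moreover have "tp2 (int_coeff p)" unfolding p_def by (rule tp2_prod_list)
  ultimately show ?thesis using tp2_imp_log_concave tp2_imp_unimodal by blast
qed

end
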